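(* Let $\alpha$ be a real number with $0\le\alpha\le1/2$. Then \[ \mathsf{tr}(N,s)=\frac{\big(4^{1-\alpha}3^\alpha\big)^N}{16\sqrt\pi\,(1+\frac{\alpha}{3})^{3/2}N^{3/2}}\big(1+o(1)\big) \] as $N,s\to\infty$ subject to $s/N\to\alpha$.
   Context: Here $\mathsf{tr}(N,s)$ denotes the number of triangulations of the point set $\mathrm{C}(N,s)$: a convex polygon with $N-s$ corners, $s$ of whose sides are each subdivided by exactly one additional point lying on that side, the other sides not subdivided, so that the set has $N$ points in total ($N\ge 2s$). (This number does not depend on which $s$ sides are subdivided.) A triangulation of a finite planar point set is a maximal dissection of its convex hull into triangles by non-crossing segments between points of the set (no point lying in the interior of a triangle side).
   Formalization: With only s/N→α the formula fails (α=0, s=⌊√N⌋: the quotient is about (3/4)^s→0). Proved instead: the formula with α replaced by s/N in the exponential factor; and the printed formula when s−αN→0, which is exactly when it holds. *)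

theory Defs
  imports "HOL-Analysis.Analysis" "HOL-Library.Landau_Symbols"
begin

text \<open>
  \<open>subdivided_polygon N s P\<close>: the point set \<open>P\<close> is a \<open>C(N,s)\<close>, formed from the vertex set \<open>V\<close> of
  a convex polygon with \<open>N - s\<close> corners (written additively, to avoid truncated subtraction) and one
  point \<open>m e\<close> in the relative interior of each side \<open>e\<close> belonging to an arbitrary set \<open>S\<close> of
  \<open>s\<close> sides.  Three extreme points cannot be collinear, so the polygon is nondegenerate.
\<close>

definition subdivided_polygon :: "nat \<Rightarrow> nat \<Rightarrow> (real^2) set \<Rightarrow> bool" where
  "subdivided_polygon N s P \<longleftrightarrow>
     (\<exists>V S m. finite V \<and> card V \<ge> 3 \<and> card V + s = N \<and>
        (\<forall>v\<in>V. v extreme_point_of (convex hull V)) \<and>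
        S \<subseteq> {e. e edge_of (convex hull V)} \<and> finite S \<and> card S = s \<and>
        (\<forall>e\<in>S. m e \<in> rel_interior e) \<and>
        P = V \<union> m ` S)"

text \<open>
  A dissection of the convex hull of \<open>P\<close> is given by its set of triangles.  The constant
  \<^const>\<open>triangulation\<close> supplies finiteness and the requirement that any two triangles meet in a
  common face (vertex, side or the empty set).
\<close>

definition triangle_dissection :: "(real^2) set \<Rightarrow> (real^2) set set \<Rightarrow> bool" where
  "triangle_dissection P \<T> \<longleftrightarrow>
     triangulation \<T> \<and> \<Union>\<T> = convex hull P \<and>
     (\<forall>T\<in>\<T>. 2 simplex T \<and> {v. v extreme_point_of T} \<subseteq> P \<and>
             (\<forall>e. e edge_of T \<longrightarrow> rel_interior e \<inter> P = {}))"

definition refines :: "'a set set \<Rightarrow> 'a set set \<Rightarrow> bool" where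
  "refines \<T>' \<T> \<longleftrightarrow> (\<forall>T'\<in>\<T>'. \<exists>T\<in>\<T>. T' \<subseteq> T)"

definition point_set_triangulation :: "(real^2) set \<Rightarrow> (real^2) set set \<Rightarrow> bool" where
  "point_set_triangulation P \<T> \<longleftrightarrow>
     triangle_dissection P \<T> \<and>
     (\<forall>\<T>'. triangle_dissection P \<T>' \<and> refines \<T>' \<T> \<longrightarrow> \<T>' = \<T>)"

definition tr :: "(real^2) set \<Rightarrow> nat" where
  "tr P = card {\<T>. point_set_triangulation P \<T>}"

end

(*
Moving the subdivision points slightly outwards turns the point set into a convex polygon with N
corners, and the triangulations into those that use none of the s ears at these points.  Triangulations
of a convex polygon satisfy the Catalan recursion over the triangle at a fixed side; forbidding an ear
subtracts the triangulations of the polygon with that corner deleted.  So the number of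
triangulations is the s-th backward difference of the Catalan numbers at N - 2.  Catalan numbers
are the moments of sqrt ((4 - x) / x) / (2 pi) on [0, 4], which turns the difference into one integral:
  tr = (4 / pi) * integral over [0, pi/2] of (4 cos^2)^(N - 2 - s) * (4 cos^2 - 1)^s * sin^2
after x = 4 cos^2.  Laplace's method at angle 0 gives the asymptotics.
*)
theory Submission
  imports Defs "HOL-Probability.Distributions" "HOL-Real_Asymp.Real_Asymp"
begin

section \<open>Differences of Catalan numbers as integrals\<close>

text \<open>No point is actually moved: the points stay collinear, and a forbidden ear is a triangle
  of area zero. Cutting along the triangle at a base leaves runs of consecutive boundary points, so
  signs of orientations of index triples carry the geometry. The obstacle is the base itself. If all
  sides are subdivided, every base is half of a subdivided side, and the whole chain has a collinear
  triple through its end. The proof closes up in this way in all cases with s \<ge> 1: a subdivided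
  side comes last, the base joins its subdivision point to the first corner, and the ear there is
  forbidden by omitting one apex, which accounts for one of the s differences. The other s - 1
  subdivision points are inner points of the chain. The terms of an iterated difference alternate in
  sign and would cancel in a direct estimate. Under the integral they collapse to the factor (x -
  1)^s, whose modulus on [0, 4] is largest at x = 4, the peak of the other power as well.\<close>

text \<open>
  For \<open>t = 0\<close> this is the \<open>n\<close>-th Catalan number (the moment integral after \<open>x = 4 cos\<^sup>2 \<theta>\<close>), in general its
  \<open>t\<close>-th backward difference.
\<close>

definition cat_int :: "nat \<Rightarrow> nat \<Rightarrow> real" where
  "cat_int n t = 4 / pi *
     integral {0..pi/2} (\<lambda>\<theta>. (4 * (cos \<theta>)\<^sup>2) ^ (n - t) * (4 * (cos \<theta>)\<^sup>2 - 1) ^ t * (sin \<theta>)\<^sup>2)"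

section \<open>Moments and the first-order Catalan recurrence\<close>

lemma cat_int_0_0: "cat_int 0 0 = 1"
proof -
  have "((\<lambda>\<theta>::real. (sin \<theta>)\<^sup>2) has_integral
      ((pi/2 - sin (pi/2) * cos (pi/2)) / 2 - (0 - sin 0 * cos 0) / 2)) {0..pi/2}"
  proof (rule fundamental_theorem_of_calculus)
    fix x :: real
    have "((\<lambda>\<theta>. (\<theta> - sin \<theta> * cos \<theta>) / 2) has_real_derivative
        (1 - (cos x * cos x + - sin x * sin x)) / 2) (at x within {0..pi/2})"
      by (auto intro!: derivative_eq_intros)
    also have "(1 - (cos x * cos x + - sin x * sin x)) / 2 = (sin x)\<^sup>2"
      using sin_cos_squared_add[of x] by (simp add: power2_eq_square)
    finally show "((\<lambda>\<theta>. (\<theta> - sin \<theta> * cos \<theta>) / 2) has_vector_derivative (sin x)\<^sup>2) (at x within {0..pi/2})"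
      by (simp add: has_real_derivative_iff_has_vector_derivative)
  qed auto
  then have "integral {0..pi/2} (\<lambda>\<theta>::real. (sin \<theta>)\<^sup>2) = pi / 4"
    by (simp add: integral_unique)
  then show ?thesis by (simp add: cat_int_def)
qed

lemma cat_int_integrable:
  "(\<lambda>\<theta>::real. (4 * (cos \<theta>)\<^sup>2) ^ m * (4 * (cos \<theta>)\<^sup>2 - 1) ^ t * (sin \<theta>)\<^sup>2) integrable_on {0..pi/2}"
  by (intro integrable_continuous_interval continuous_intros)

text \<open>The difference of the two integrands is a multiple of the derivative of
  \<open>cos^(2n+1) * sin^3\<close>, which vanishes at both end points. This linear recurrence is
  the one by which moments and triangulation counts are matched later.\<close>

lemma cat_int_Suc_0: "real (n + 2) * cat_int (Suc n) 0 = real (4 * n + 2) * cat_int n 0"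
proof -
  let ?f = "\<lambda>n \<theta>. (4 * (cos \<theta>)\<^sup>2) ^ n * (sin (\<theta>::real))\<^sup>2"
  have int: "?f n integrable_on {0..pi/2}" for n
    using cat_int_integrable[of n 0] by simp
  have "((\<lambda>\<theta>. 4 ^ Suc n * ((cos \<theta>)^(2*n) * (sin \<theta>)\<^sup>2 * ((2*n+4) * (cos \<theta>)\<^sup>2 - (2*n+1)))) has_integral
      (4 ^ Suc n * ((cos (pi/2)) ^ Suc (2*n) * (sin (pi/2))^3) - 4 ^ Suc n * ((cos 0) ^ Suc (2*n) * (sin 0)^3))) {0..pi/2}"
  proof (rule fundamental_theorem_of_calculus)
    fix x :: real
    have *: "(sin x)^4 = (sin x)\<^sup>2 * (1 - (cos x)\<^sup>2)"
      by (simp add: sin_squared_eq[symmetric] power_add[symmetric])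
    have "((\<lambda>\<theta>. 4 ^ Suc n * ((cos \<theta>) ^ Suc (2*n) * (sin \<theta>)^3)) has_real_derivative
        4 ^ Suc n * (3 * (cos x)^(2*n) * (cos x)\<^sup>2 * (sin x)\<^sup>2 - (2*n+1) * (cos x)^(2*n) * (sin x)^4)) (at x within {0..pi/2})"
    proof -
      have "((\<lambda>\<theta>. (cos \<theta>) ^ Suc (2*n)) has_real_derivative (1 + real (2*n)) * (- sin x * (cos x) ^ (2*n))) (at x within {0..pi/2})"
        by (rule DERIV_power_Suc) (auto intro!: derivative_eq_intros)
      moreover have "((\<lambda>\<theta>. (sin \<theta>) ^ 3) has_real_derivative 3 * (sin x)\<^sup>2 * cos x) (at x within {0..pi/2})"
        by (auto intro!: derivative_eq_intros)
      ultimately have "((\<lambda>\<theta>. 4 ^ Suc n * ((cos \<theta>) ^ Suc (2*n) * (sin \<theta>)^3)) has_real_derivative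
         4 ^ Suc n * ((1 + real (2*n)) * (- sin x * (cos x) ^ (2*n)) * (sin x)^3 + 3 * (sin x)\<^sup>2 * cos x * (cos x) ^ Suc (2*n))) (at x within {0..pi/2})"
        by (intro DERIV_cmult DERIV_mult)
      then show ?thesis
        by (rule DERIV_cong) (simp add: power2_eq_square power3_eq_cube power4_eq_xxxx algebra_simps)
    qed
    also have "4 ^ Suc n * (3 * (cos x)^(2*n) * (cos x)\<^sup>2 * (sin x)\<^sup>2 - (2*n+1) * (cos x)^(2*n) * (sin x)^4)
       = 4 ^ Suc n * ((cos x)^(2*n) * (sin x)\<^sup>2 * ((2*n+4) * (cos x)\<^sup>2 - (2*n+1)))"
      unfolding * by (simp add: algebra_simps)
    finally show "((\<lambda>\<theta>. 4 ^ Suc n * ((cos \<theta>) ^ Suc (2*n) * (sin \<theta>)^3)) has_vector_derivative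
       4 ^ Suc n * ((cos x)^(2*n) * (sin x)\<^sup>2 * ((2*n+4) * (cos x)\<^sup>2 - (2*n+1)))) (at x within {0..pi/2})"
      by (simp add: has_real_derivative_iff_has_vector_derivative)
  qed auto
  from integral_unique[OF this] have "integral {0..pi/2} (\<lambda>\<theta>. 4 ^ Suc n * ((cos \<theta>)^(2*n) * (sin \<theta>)\<^sup>2 * ((2*n+4) * (cos \<theta>)\<^sup>2 - (2*n+1)))) = 0"
    by (simp only:) simp
  also have "(\<lambda>\<theta>::real. 4 ^ Suc n * ((cos \<theta>)^(2*n) * (sin \<theta>)\<^sup>2 * ((2*n+4) * (cos \<theta>)\<^sup>2 - (2*n+1))))
      = (\<lambda>\<theta>. 2 * (n+2) * ?f (Suc n) \<theta> - 2 * (4*n+2) * ?f n \<theta>)"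
    by (rule ext, simp only: power_mult power_mult_distrib power_Suc, simp add: algebra_simps)
  also have "integral {0..pi/2} (\<lambda>\<theta>. 2 * (n+2) * ?f (Suc n) \<theta> - 2 * (4*n+2) * ?f n \<theta>)
     = 2 * (n+2) * integral {0..pi/2} (?f (Suc n)) - 2 * (4*n+2) * integral {0..pi/2} (?f n)"
    by (intro integral_unique has_integral_diff has_integral_mult_right integrable_integral int)
  finally have "real (n+2) * integral {0..pi/2} (?f (Suc n)) = (4*n+2) * integral {0..pi/2} (?f n)"
    by (simp only: mult.assoc flip: right_diff_distrib)
  then show ?thesis
    by (simp add: cat_int_def field_simps)
qed

text \<open>Splitting off one factor \<open>4 cos^2 - 1\<close> leaves two integrals with
  neighbouring exponents. \<open>t < n\<close> keeps the truncated subtraction \<open>n - t\<close>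
  exact.\<close>

lemma cat_int_Suc_right:
  assumes "t < n"
  shows "cat_int n (Suc t) = cat_int n t - cat_int (n - 1) t"
proof -
  obtain m where n: "n = Suc (t + m)" using assms less_iff_Suc_add by auto
  let ?f = "\<lambda>m \<theta>. (4 * (cos \<theta>)\<^sup>2) ^ m * (4 * (cos \<theta>)\<^sup>2 - 1) ^ t * (sin (\<theta>::real))\<^sup>2"
  have "integral {0..pi/2} (?f (Suc m)) - integral {0..pi/2} (?f m)
      = integral {0..pi/2} (\<lambda>\<theta>. ?f (Suc m) \<theta> - ?f m \<theta>)"
    by (rule integral_diff[symmetric]) (rule cat_int_integrable)+
  also have "(\<lambda>\<theta>. ?f (Suc m) \<theta> - ?f m \<theta>)
     = (\<lambda>\<theta>. (4 * (cos \<theta>)\<^sup>2) ^ m * (4 * (cos \<theta>)\<^sup>2 - 1) ^ Suc t * (sin (\<theta>::real))\<^sup>2)"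
    by (rule ext) (simp add: algebra_simps)
  finally show ?thesis
    unfolding cat_int_def n
    by (simp add: Suc_diff_le del: power_Suc flip: right_diff_distrib diff_divide_distrib)
qed

section \<open>Laplace's method at the angle 0\<close>

text \<open>A crude constant suffices, as it only feeds an integrable majorant. On
  \<open>[0, 2]\<close> the Taylor error \<open>x^3 / 6\<close> is at most
  \<open>2 x / 3\<close>.\<close>

lemma sin_ge_third:
  assumes "0 \<le> x" "x \<le> pi / 2"
  shows "x / 3 \<le> sin x"
proof -
  have x2: "x \<le> 2" using assms pi_less_4 by linarith
  have "\<bar>sin x - x\<bar> \<le> x ^ 3 / 6"
    using Maclaurin_sin_bound[of x 3] assms
    by (simp add: eval_nat_numeral sin_coeff_def fact_numeral)
  moreover have "x ^ 3 \<le> x * 4"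
    using mult_left_mono[OF mult_mono[OF x2 x2], of x] assms by (simp add: eval_nat_numeral)
  ultimately show ?thesis by linarith
qed

lemma cos_sq_le_exp:
  assumes "0 \<le> x" "x \<le> pi / 2"
  shows "(cos x)\<^sup>2 \<le> exp (- x\<^sup>2 / 9)"
proof -
  have "(x / 3)\<^sup>2 \<le> (sin x)\<^sup>2"
    using sin_ge_third[OF assms] assms by (intro power_mono) auto
  then have "(cos x)\<^sup>2 \<le> 1 + (- x\<^sup>2 / 9)"
    by (simp add: cos_squared_eq power_divide)
  also have "\<dots> \<le> exp (- x\<^sup>2 / 9)" by (rule exp_ge_add_one_self)
  finally show ?thesis .
qed

text \<open>Base and exponent vary independently, so the limit is taken in the logarithm:
  \<open>m * ln (1 - a) = - m * a + O(m * a^2)\<close>, and \<open>m * a^2 = (m * a) * a\<close>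
  tends to 0.\<close>

lemma one_minus_power_tendsto_exp:
  fixes a :: "nat \<Rightarrow> real" and m :: "nat \<Rightarrow> nat"
  assumes a: "a \<longlonglongrightarrow> 0" and ma: "(\<lambda>k. m k * a k) \<longlonglongrightarrow> L"
  shows "(\<lambda>k. (1 - a k) ^ m k) \<longlonglongrightarrow> exp (- L)"
proof -
  have small: "\<forall>\<^sub>F k in sequentially. \<bar>a k\<bar> \<le> 1/2"
    using tendstoD[OF a, of "1/2"] by (auto elim!: eventually_mono)
  have "(\<lambda>k. m k * (ln (1 - a k) + a k)) \<longlonglongrightarrow> 0"
  proof (rule Lim_null_comparison)
    show "\<forall>\<^sub>F k in sequentially. norm (m k * (ln (1 - a k) + a k)) \<le> 2 * \<bar>m k * a k\<bar> * \<bar>a k\<bar>"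
      using small
    proof eventually_elim
      case (elim k)
      have "\<bar>ln (1 - a k) + a k\<bar> \<le> 2 * (a k)\<^sup>2"
        using abs_ln_one_plus_x_minus_x_bound[of "- a k"] elim by simp
      then have "m k * \<bar>ln (1 - a k) + a k\<bar> \<le> m k * (2 * (a k)\<^sup>2)"
        by (intro mult_left_mono) auto
      then show ?case by (simp add: abs_mult power2_eq_square ac_simps)
    qed
    show "(\<lambda>k. 2 * \<bar>m k * a k\<bar> * \<bar>a k\<bar>) \<longlonglongrightarrow> 0"
      using tendsto_mult[OF tendsto_mult[OF tendsto_const[of 2] tendsto_rabs[OF ma]] tendsto_rabs[OF a]] by simp
  qed
  then have "(\<lambda>k. m k * (ln (1 - a k) + a k) - m k * a k) \<longlonglongrightarrow> 0 - L"
    by (rule tendsto_diff[OF _ ma])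
  then have "(\<lambda>k. exp (m k * (ln (1 - a k) + a k) - m k * a k)) \<longlonglongrightarrow> exp (- L)"
    by (intro tendsto_exp) simp
  then show ?thesis
  proof (rule Lim_transform_eventually)
    show "\<forall>\<^sub>F k in sequentially. exp (m k * (ln (1 - a k) + a k) - m k * a k) = (1 - a k) ^ m k"
      using small
    proof eventually_elim
      case (elim k)
      then have "0 < 1 - a k" by auto
      then have "(1 - a k) ^ m k = exp (m k * ln (1 - a k))"
        by (simp add: exp_of_nat_mult)
      then show ?case by (simp add: algebra_simps)
    qed
  qed
qed

lemma gaussian_second_moment:
  fixes c :: real
  assumes "c > 0"
  shows "has_bochner_integral lborel (\<lambda>u. indicator {0..} u * (u\<^sup>2 * exp (- c * u\<^sup>2))) (sqrt pi / (4 * c powr (3/2)))"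
proof -
  have *: "has_bochner_integral lborel (\<lambda>x::real. indicator {0..} x *\<^sub>R (exp (-x\<^sup>2)*x^2)) (sqrt pi / 4)"
    using gaussian_moment_even_pos[of 1] by (simp add: eval_nat_numeral)
  have "has_bochner_integral lborel (\<lambda>x::real. indicator {0..} (0 + sqrt c * x) *\<^sub>R (exp (-(0 + sqrt c * x)\<^sup>2)*(0 + sqrt c * x)^2))
     ((sqrt pi / 4) /\<^sub>R \<bar>sqrt c\<bar>)"
    by (rule lborel_has_bochner_integral_real_affine_iff[THEN iffD1, OF _ *]) (use assms in auto)
  also have "(\<lambda>x::real. indicator {0..} (0 + sqrt c * x) *\<^sub>R (exp (-(0 + sqrt c * x)\<^sup>2)*(0 + sqrt c * x)^2))
     = (\<lambda>x. c * (indicator {0..} x * (x\<^sup>2 * exp (- c * x\<^sup>2))))"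
    using assms by (auto simp: fun_eq_iff indicator_def power_mult_distrib zero_le_mult_iff)
  finally have "has_bochner_integral lborel (\<lambda>x. (1/c) * (c * (indicator {0..} x * (x\<^sup>2 * exp (- c * x\<^sup>2)))))
     ((1/c) * ((sqrt pi / 4) /\<^sub>R \<bar>sqrt c\<bar>))"
    by (rule has_bochner_integral_mult_right)
  moreover have "(1/c) * ((sqrt pi / 4) /\<^sub>R \<bar>sqrt c\<bar>) = sqrt pi / (4 * c powr (3/2))"
  proof -
    have "c powr (3/2) = c powr (1 + 1/2)" by simp
    also have "\<dots> = c * sqrt c" using assms by (subst powr_add) (simp add: powr_half_sqrt)
    finally show ?thesis using assms by (simp add: field_simps)
  qed
  ultimately show ?thesis using assms by simp
qed

text \<open>The substitution \<open>\<theta> = u / sqrt N\<close> matches the width of the peak. The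
  value of the two powers at 0 comes out. The differential contributes \<open>N^(-1/2)\<close> and
  the vanishing factor \<open>sin^2\<close> contributes \<open>1 / N\<close>, whence the order
  \<open>N^(-3/2)\<close>.\<close>

lemma cat_int_lebesgue:
  assumes "0 < N" "s + 2 \<le> N"
  shows "cat_int (N - 2) s = 4 / pi * (4 ^ (N - 2 - s) * 3 ^ s / real N powr (3/2)) *
     (LINT u|lborel. indicator {0..sqrt N * (pi/2)} u *
        (((cos (u / sqrt N))\<^sup>2) ^ (N - 2 - s) * (1 - 4/3 * (sin (u / sqrt N))\<^sup>2) ^ s * (N * (sin (u / sqrt N))\<^sup>2)))"
proof -
  let ?h = "\<lambda>\<theta>::real. (4 * (cos \<theta>)\<^sup>2) ^ (N - 2 - s) * (4 * (cos \<theta>)\<^sup>2 - 1) ^ s * (sin \<theta>)\<^sup>2"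
  let ?g = "\<lambda>u. ((cos (u / sqrt N))\<^sup>2) ^ (N - 2 - s) * (1 - 4/3 * (sin (u / sqrt N))\<^sup>2) ^ s * (N * (sin (u / sqrt N))\<^sup>2)"
  define C :: real where "C = 4 ^ (N - 2 - s) * 3 ^ s"
  have N: "sqrt N > 0" "real N > 0" using assms by auto
  have "set_integrable lborel {0..pi/2} ?h"
    by (intro borel_integrable_atLeastAtMost' continuous_intros)
  then have "integral {0..pi/2} ?h = (LINT \<theta>|lborel. indicator {0..pi/2} \<theta> * ?h \<theta>)"
    by (simp add: set_borel_integral_eq_integral(2)[symmetric] set_lebesgue_integral_def)
  also have "\<dots> = \<bar>1 / sqrt N\<bar> *\<^sub>R (LINT u|lborel. indicator {0..pi/2} (0 + 1 / sqrt N * u) * ?h (0 + 1 / sqrt N * u))"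
    using N by (intro lborel_integral_real_affine) auto
  also have "(\<lambda>u. indicator {0..pi/2} (0 + 1 / sqrt N * u) * ?h (0 + 1 / sqrt N * u))
      = (\<lambda>u. (C / N) * (indicator {0..sqrt N * (pi/2)} u * ?g u))"
  proof
    fix u
    have 1: "0 + 1 / sqrt N * u = u / sqrt N" by simp
    have 2: "(indicator {0..pi/2} (u / sqrt N) :: real) = indicator {0..sqrt N * (pi/2)} u"
      using N by (auto simp: indicator_def field_simps zero_le_divide_iff)
    have "4 * (cos (u / sqrt N))\<^sup>2 - 1 = 3 * (1 - 4/3 * (sin (u / sqrt N))\<^sup>2)"
      by (simp add: cos_squared_eq)
    then have "?h (u / sqrt N) = (C / N) * ?g u"
      unfolding C_def by (simp only: power_mult_distrib) (use N in simp)
    then show "indicator {0..pi/2} (0 + 1 / sqrt N * u) * ?h (0 + 1 / sqrt N * u)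
        = (C / N) * (indicator {0..sqrt N * (pi/2)} u * ?g u)"
      unfolding 1 2 by (simp add: ac_simps)
  qed
  finally have "integral {0..pi/2} ?h = 1 / sqrt N * (C / N) * (LINT u|lborel. indicator {0..sqrt N * (pi/2)} u * ?g u)"
    by (simp only: integral_mult_right_zero real_scaleR_def) (use N in simp)
  moreover have "real N powr (3/2) = N * sqrt N"
    using powr_add[of N 1 "1/2"] N by (simp add: powr_half_sqrt)
  ultimately show ?thesis
    unfolding cat_int_def C_def by (simp add: ac_simps)
qed

text \<open>Dominated convergence in the rescaled variable. Both exponents vary with
  \<open>k\<close>: the pointwise limit rests on the convergence of \<open>s / N\<close>, the
  majorant on the exponent of \<open>cos^2\<close> staying above a fixed fraction of
  \<open>N\<close>.\<close>

lemma cat_int_asymptotics: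
  fixes N s :: "nat \<Rightarrow> nat"
  assumes "0 \<le> \<alpha>" "\<alpha> \<le> 1/2"
    and N: "filterlim N at_top sequentially"
    and lim: "(\<lambda>k. real (s k) / real (N k)) \<longlonglongrightarrow> \<alpha>"
  shows "(\<lambda>k. cat_int (N k - 2) (s k)) \<sim>[sequentially]
     (\<lambda>k. 4 ^ (N k - s k) * 3 ^ s k / (16 * sqrt pi * (1 + \<alpha> / 3) powr (3/2) * real (N k) powr (3/2)))"
proof -
  \<comment> \<open>The power of \<open>cos^2\<close> tends to
    \<open>exp (- (1 - \<alpha>) u^2)\<close>, the other power to
    \<open>exp (- 4/3 \<alpha> u^2)\<close>; the coefficients add up to \<open>c\<close>.\<close>
  define c where "c = 1 + \<alpha> / 3"
  have c: "c > 0" using assms by (auto simp: c_def)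
  define g where "g k u = indicator {0..sqrt (N k) * (pi/2)} u *
        (((cos (u / sqrt (N k)))\<^sup>2) ^ (N k - 2 - s k) * (1 - 4/3 * (sin (u / sqrt (N k)))\<^sup>2) ^ s k * (N k * (sin (u / sqrt (N k)))\<^sup>2))"
    for k u
  \<comment> \<open>\<open>1/72\<close> is \<open>1/9\<close> from \<open>cos_sq_le_exp\<close>
    times \<open>1/8\<close>, the fraction of \<open>N\<close> that the exponent of
    \<open>cos^2\<close> is shown to exceed.\<close>
  define w where "w u = indicator {0::real..} u * (u\<^sup>2 * exp (- (1/72) * u\<^sup>2))" for u :: real
  define l where "l u = indicator {0::real..} u * (u\<^sup>2 * exp (- c * u\<^sup>2))" for u :: real
  have rN: "filterlim (\<lambda>k. real (N k)) at_top sequentially"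
    by (rule filterlim_compose[OF filterlim_real_sequentially N])
  \<comment> \<open>The bound \<open>5/8\<close> lies above \<open>1/2\<close>, and together with
    \<open>16 \<le> N\<close> it leaves \<open>N - 2 - s\<close> at least
    \<open>N / 8\<close>.\<close>
  have "\<forall>\<^sub>F k in sequentially. real (s k) / real (N k) < 5/8"
    using order_tendstoD(2)[OF lim, of "5/8"] assms by auto
  moreover have "\<forall>\<^sub>F k in sequentially. N k \<ge> 16"
    using N by (simp add: filterlim_at_top)
  ultimately have ev: "\<forall>\<^sub>F k in sequentially. s k + 2 \<le> N k \<and> 16 \<le> N k \<and> N k \<le> 8 * (N k - 2 - s k)"
    by eventually_elim (auto simp: field_simps)
  have ptw: "(\<lambda>k. g k u) \<longlonglongrightarrow> l u" for u
  proof (cases "u \<ge> 0")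
    case False
    then show ?thesis by (simp add: g_def l_def)
  next
    case True
    have sq: "((\<lambda>x. x * (sin (u / sqrt x))\<^sup>2) \<longlongrightarrow> u\<^sup>2) at_top"
    proof (cases "u = 0")
      case False
      with True have "u > 0" by simp
      then show ?thesis by real_asymp
    qed simp
    have Ns: "(\<lambda>k. N k * (sin (u / sqrt (N k)))\<^sup>2) \<longlonglongrightarrow> u\<^sup>2"
      by (rule filterlim_compose[OF sq rN])
    have inv: "(\<lambda>k. inverse (real (N k))) \<longlonglongrightarrow> 0"
      by (rule filterlim_compose[OF tendsto_inverse_0_at_top[OF filterlim_ident] rN])
    have N0: "\<forall>\<^sub>F k in sequentially. N k > 0"
      using ev by eventually_elim auto
    have "(\<lambda>k. inverse (real (N k)) * (N k * (sin (u / sqrt (N k)))\<^sup>2)) \<longlonglongrightarrow> 0 * u\<^sup>2"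
      by (rule tendsto_mult[OF inv Ns])
    then have a: "(\<lambda>k. (sin (u / sqrt (N k)))\<^sup>2) \<longlonglongrightarrow> 0"
      unfolding mult_zero_left
      by (rule Lim_transform_eventually) (use N0 in \<open>auto elim!: eventually_mono simp: field_simps\<close>)
    have sa: "(\<lambda>k. s k * (sin (u / sqrt (N k)))\<^sup>2) \<longlonglongrightarrow> \<alpha> * u\<^sup>2"
      by (rule Lim_transform_eventually[OF tendsto_mult[OF lim Ns]])
         (use N0 in \<open>auto elim!: eventually_mono simp: field_simps\<close>)
    have "(\<lambda>k. N k * (sin (u / sqrt (N k)))\<^sup>2 - 2 * (sin (u / sqrt (N k)))\<^sup>2 - s k * (sin (u / sqrt (N k)))\<^sup>2)
        \<longlonglongrightarrow> u\<^sup>2 - 2 * 0 - \<alpha> * u\<^sup>2"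
      by (intro tendsto_diff tendsto_mult Ns a sa tendsto_const)
    then have "(\<lambda>k. real (N k - 2 - s k) * (sin (u / sqrt (N k)))\<^sup>2) \<longlonglongrightarrow> u\<^sup>2 - 2 * 0 - \<alpha> * u\<^sup>2"
      by (rule Lim_transform_eventually)
         (use ev in \<open>auto elim!: eventually_mono simp: algebra_simps of_nat_diff\<close>)
    from one_minus_power_tendsto_exp[OF a this]
    have p1: "(\<lambda>k. ((cos (u / sqrt (N k)))\<^sup>2) ^ (N k - 2 - s k)) \<longlonglongrightarrow> exp (- ((1 - \<alpha>) * u\<^sup>2))"
      by (simp add: cos_squared_eq algebra_simps)
    have "(\<lambda>k. s k * (4/3 * (sin (u / sqrt (N k)))\<^sup>2)) \<longlonglongrightarrow> 4/3 * (\<alpha> * u\<^sup>2)"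
      using tendsto_mult[OF tendsto_const[of "4/3"] sa] by (simp add: algebra_simps)
    moreover have "(\<lambda>k. 4/3 * (sin (u / sqrt (N k)))\<^sup>2) \<longlonglongrightarrow> 0"
      using tendsto_mult[OF tendsto_const[of "4/3"] a] by simp
    ultimately have p2: "(\<lambda>k. (1 - 4/3 * (sin (u / sqrt (N k)))\<^sup>2) ^ s k) \<longlonglongrightarrow> exp (- (4/3 * (\<alpha> * u\<^sup>2)))"
      by (intro one_minus_power_tendsto_exp)
    have "filterlim (\<lambda>x. sqrt x * (pi/2)) at_top at_top" by real_asymp
    from filterlim_compose[OF this rN]
    have uN: "\<forall>\<^sub>F k in sequentially. u \<le> sqrt (N k) * (pi/2)"
      unfolding filterlim_at_top by blast
    have "(\<lambda>k. ((cos (u / sqrt (N k)))\<^sup>2) ^ (N k - 2 - s k) * (1 - 4/3 * (sin (u / sqrt (N k)))\<^sup>2) ^ s k * (N k * (sin (u / sqrt (N k)))\<^sup>2))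
       \<longlonglongrightarrow> exp (- ((1 - \<alpha>) * u\<^sup>2)) * exp (- (4/3 * (\<alpha> * u\<^sup>2))) * u\<^sup>2"
      by (intro tendsto_mult p1 p2 Ns)
    moreover have "exp (- ((1 - \<alpha>) * u\<^sup>2)) * exp (- (4/3 * (\<alpha> * u\<^sup>2))) * u\<^sup>2 = l u"
      using True by (simp add: l_def c_def algebra_simps flip: exp_add)
    ultimately show ?thesis
      by (auto intro: Lim_transform_eventually[OF _ eventually_mono[OF uN]] simp: g_def True)
  qed
  have bound: "\<forall>\<^sub>F k in sequentially. \<forall>u. norm (g k u) \<le> w u"
    using ev
  proof eventually_elim
    case (elim k)
    then have N: "N k > 0" "sqrt (N k) > 0" by auto
    show ?case
    proof
      fix u
      define v where "v = u / sqrt (N k)"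
      show "norm (g k u) \<le> w u"
      proof (cases "0 \<le> u \<and> u \<le> sqrt (N k) * (pi/2)")
        case False
        then show ?thesis by (auto simp: g_def w_def indicator_def)
      next
        case True
        then have v: "0 \<le> v" "v \<le> pi / 2" using N by (auto simp: v_def field_simps)
        have v2: "v\<^sup>2 * N k = u\<^sup>2" using N by (simp add: v_def power_divide)
        have "((cos v)\<^sup>2) ^ (N k - 2 - s k) \<le> exp (- v\<^sup>2 / 9) ^ (N k - 2 - s k)"
          by (intro power_mono cos_sq_le_exp v) auto
        also have "\<dots> = exp (- (v\<^sup>2 * real (N k - 2 - s k)) / 9)"
          by (simp add: exp_of_nat_mult[symmetric] algebra_simps)
        also have "\<dots> \<le> exp (- (1/72) * u\<^sup>2)"
        proof -
          have "v\<^sup>2 * real (N k) \<le> v\<^sup>2 * (8 * real (N k - 2 - s k))"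
            using elim by (intro mult_left_mono) (auto simp flip: of_nat_mult of_nat_diff simp del: of_nat_le_iff simp add: of_nat_le_iff)
          then show ?thesis unfolding v2[symmetric] by (simp add: ac_simps)
        qed
        finally have 1: "((cos v)\<^sup>2) ^ (N k - 2 - s k) \<le> exp (- (1/72) * u\<^sup>2)" .
        \<comment> \<open>The base below is negative where \<open>4 cos^2 < 1\<close>, but never
          less than \<open>-1/3\<close>, so its modulus stays below 1.\<close>
        have "(sin v)\<^sup>2 \<le> 1" by (simp add: sin_squared_eq)
        then have "\<bar>1 - 4/3 * (sin v)\<^sup>2\<bar> \<le> 1" using zero_le_power2[of "sin v"] by (auto simp: abs_le_iff)
        then have 2: "\<bar>1 - 4/3 * (sin v)\<^sup>2\<bar> ^ s k \<le> 1" by (simp add: power_le_one)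
        have "(sin v)\<^sup>2 \<le> v\<^sup>2" using abs_sin_x_le_abs_x[of v] by (simp add: abs_le_square_iff)
        then have 3: "N k * (sin v)\<^sup>2 \<le> u\<^sup>2" unfolding v2[symmetric] by (simp add: mult.commute mult_left_mono)
        have "((cos v)\<^sup>2) ^ (N k - 2 - s k) * \<bar>1 - 4/3 * (sin v)\<^sup>2\<bar> ^ s k * (N k * (sin v)\<^sup>2)
           \<le> exp (- (1/72) * u\<^sup>2) * 1 * u\<^sup>2"
          by (intro mult_mono 1 2 3) auto
        then show ?thesis using True unfolding g_def w_def v_def[symmetric]
          by (simp add: abs_mult power_abs mult.commute)
      qed
    qed
  qed
  have wint: "integrable lborel w"
    using gaussian_second_moment[of "1/72"] unfolding w_def[abs_def]
    by (auto simp: has_bochner_integral_iff)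
  have lint: "(LINT u|lborel. l u) = sqrt pi / (4 * c powr (3/2))"
    using gaussian_second_moment[OF c] unfolding l_def[abs_def]
    by (auto simp: has_bochner_integral_iff)
  obtain k0 where k0: "\<And>k u. k \<ge> k0 \<Longrightarrow> norm (g k u) \<le> w u"
    using bound unfolding eventually_sequentially by blast
  have "(\<lambda>k. LINT u|lborel. g (k + k0) u) \<longlonglongrightarrow> (LINT u|lborel. l u)"
  proof (rule integral_dominated_convergence[where w = w])
    show "AE u in lborel. (\<lambda>k. g (k + k0) u) \<longlonglongrightarrow> l u"
      using LIMSEQ_ignore_initial_segment[OF ptw] by simp
    show "AE u in lborel. norm (g (k + k0) u) \<le> w u" for k
      using k0[of "k + k0"] by simp
    show "l \<in> borel_measurable lborel" unfolding l_def[abs_def] by measurable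
    show "g (k + k0) \<in> borel_measurable lborel" for k unfolding g_def[abs_def] by measurable
  qed (rule wint)
  then have gl: "(\<lambda>k. LINT u|lborel. g k u) \<longlonglongrightarrow> sqrt pi / (4 * c powr (3/2))"
    unfolding lint by (rule LIMSEQ_offset)
  have cp: "c powr (3/2) > 0" using c by simp
  have "(\<lambda>k. (LINT u|lborel. g k u) * (4 * c powr (3/2) / sqrt pi)) \<longlonglongrightarrow>
      sqrt pi / (4 * c powr (3/2)) * (4 * c powr (3/2) / sqrt pi)"
    by (intro tendsto_mult gl tendsto_const)
  also have "sqrt pi / (4 * c powr (3/2)) * (4 * c powr (3/2) / sqrt pi) = 1"
    using cp by (simp add: field_simps)
  finally have lim1: "(\<lambda>k. (LINT u|lborel. g k u) * (4 * c powr (3/2) / sqrt pi)) \<longlonglongrightarrow> 1" .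
  show ?thesis
    unfolding c_def[symmetric]
  proof (rule asymp_equivI', rule Lim_transform_eventually[OF lim1])
    show "\<forall>\<^sub>F k in sequentially. (LINT u|lborel. g k u) * (4 * c powr (3/2) / sqrt pi) =
        cat_int (N k - 2) (s k) / (4 ^ (N k - s k) * 3 ^ s k / (16 * sqrt pi * c powr (3/2) * real (N k) powr (3/2)))"
      using ev
    proof eventually_elim
      case (elim k)
      then have N: "N k > 0" "s k + 2 \<le> N k" by auto
      have I: "cat_int (N k - 2) (s k) = 4 / pi * (4 ^ (N k - 2 - s k) * 3 ^ s k / real (N k) powr (3/2)) * (LINT u|lborel. g k u)"
        using cat_int_lebesgue[OF N] by (simp add: g_def[abs_def])
      have e: "(4::real) ^ (N k - s k) = 16 * 4 ^ (N k - 2 - s k)"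
      proof -
        have "N k - s k = (N k - 2 - s k) + 2" using N by auto
        then have "(4::real) ^ (N k - s k) = 4 ^ ((N k - 2 - s k) + 2)" by simp
        then show ?thesis by (simp add: power_add)
      qed
      have "sqrt pi * sqrt pi = pi" by simp
      then have p: "4 / pi = 4 / (sqrt pi * sqrt pi)" by simp
      have "real (N k) powr (3/2) > 0" using N by simp
      then show ?case
        unfolding I e p using cp by (simp add: field_simps)
    qed
  qed
qed

section \<open>Counting triangulations of a polygon without forbidden ears\<close>

text \<open>
  A list of length \<open>n\<close> assigns weights to the corners of a convex polygon with \<open>n + 2\<close> corners, except for
  the two at a base side.  A triangulation is weighted by the product over all ears at these corners.
  The recursion is over the third corner of the triangle at the base side.
\<close>

function ear_count :: "real list \<Rightarrow> real" where
  "ear_count xs = (if length xs \<le> 1 then (if xs = [] then 1 else hd xs)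
     else (\<Sum>k<length xs. ear_count (take k xs) * ear_count (drop (Suc k) xs)))"
  by pat_completeness auto
termination by (relation "Wellfounded.measure length") auto

declare ear_count.simps [simp del]

lemma ear_count_Nil [simp]: "ear_count [] = 1"
  and ear_count_single [simp]: "ear_count [x] = x"
  by (simp_all add: ear_count.simps)

text \<open>For weights 0 and 1 the recursion also covers \<open>[1]\<close>, since both sides are
  1. The triangle with its ear forbidden, \<open>[0]\<close>, is the only exception, and the
  inductions below need no cases on the length.\<close>

lemma ear_count_rec:
  assumes "xs \<noteq> []" "xs \<noteq> [0]" "set xs \<subseteq> {0, 1}"
  shows "ear_count xs = (\<Sum>k<length xs. ear_count (take k xs) * ear_count (drop (Suc k) xs))"
proof (cases "length xs \<le> 1")
  case True
  with assms have "xs = [1]" by (cases xs) auto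
  then show ?thesis by simp
next
  case False
  then show ?thesis by (subst ear_count.simps) simp
qed

lemma sum_split_middle:
  fixes f :: "nat \<Rightarrow> 'a::comm_monoid_add"
  shows "sum f {..<m + Suc l} = sum f {..<m} + f m + (\<Sum>k<l. f (m + Suc k))"
proof -
  have "sum f {..<m + Suc l} = sum f {..<m} + (\<Sum>k<Suc l. f (m + k))"
    by (induction l) (auto simp: add.assoc)
  then show ?thesis
    by (simp add: sum.lessThan_Suc_shift add.assoc del: sum.lessThan_Suc)
qed

text \<open>The apex of the base triangle lies before, at, or after the marked corner. In the middle
  term the marked corner is the apex and has no ear, so its weight \<open>x\<close> drops out
  there.\<close>

lemma ear_count_append:
  assumes "us @ x # vs \<noteq> [0]" "set (us @ x # vs) \<subseteq> {0, 1}"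
  shows "ear_count (us @ x # vs) =
     (\<Sum>k<length us. ear_count (take k us) * ear_count (drop (Suc k) us @ x # vs)) +
     ear_count us * ear_count vs +
     (\<Sum>k<length vs. ear_count (us @ x # take k vs) * ear_count (drop (Suc k) vs))"
  by (subst ear_count_rec[OF _ assms], simp, simp only: length_append length_Cons sum_split_middle, simp)

lemma ear_count_append':
  assumes "us @ vs \<noteq> []" "us @ vs \<noteq> [0]" "set (us @ vs) \<subseteq> {0, 1}"
  shows "ear_count (us @ vs) =
     (\<Sum>k<length us. ear_count (take k us) * ear_count (drop (Suc k) us @ vs)) +
     (\<Sum>k<length vs. ear_count (us @ take k vs) * ear_count (drop (Suc k) vs))"
proof -
  have *: "sum f {..<m + l} = sum f {..<m} + (\<Sum>k<l. f (m + k))" for f :: "nat \<Rightarrow> real" and m l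
    by (induction l) (auto simp: add.assoc)
  show ?thesis
    by (subst ear_count_rec[OF assms]) (simp add: * Suc_diff_le)
qed

text \<open>
  The side conditions say that both neighbours of the deleted corner have weight 1: after the deletion
  their ears are triangles that were not ears before.
\<close>

lemma ear_count_zero:
  assumes "set (us @ vs) \<subseteq> {0, 1}" "us = [] \<or> last us = 1" "vs = [] \<or> hd vs = 1"
  shows "ear_count (us @ 0 # vs) = ear_count (us @ 1 # vs) - ear_count (us @ vs)"
  using assms
proof (induction "length us + length vs" arbitrary: us vs rule: less_induct)
  case less
  show ?case
  proof (cases "us @ vs = []")
    case True
    then show ?thesis by simp
  next
    case False
    \<comment> \<open>Here the side conditions are essential: from a quadrilateral the deletion
      could otherwise leave \<open>[0]\<close>, for which the recursion and the claim itself
      fail.\<close>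
    have not0: "us @ vs \<noteq> [0]" using less.prems by (auto simp: append_eq_Cons_conv)
    have sub: "set (take k us) \<subseteq> set us" "set (drop k us) \<subseteq> set us" "set (take k vs) \<subseteq> set vs" "set (drop k vs) \<subseteq> set vs" for k
      by (auto dest: in_set_takeD in_set_dropD)
    have 1: "ear_count (drop (Suc k) us @ 0 # vs) = ear_count (drop (Suc k) us @ 1 # vs) - ear_count (drop (Suc k) us @ vs)"
      if "k < length us" for k
    proof (rule less.hyps)
      have "drop (Suc k) us = [] \<or> last (drop (Suc k) us) = last us"
        using last_drop[of "Suc k" us] by (cases "Suc k < length us") auto
      then show "drop (Suc k) us = [] \<or> last (drop (Suc k) us) = 1" using less.prems(2) by auto
    qed (use that less.prems sub[of "Suc k"] in auto)
    have 2: "ear_count (us @ 0 # take k vs) = ear_count (us @ 1 # take k vs) - ear_count (us @ take k vs)"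
      if "k < length vs" for k
      by (rule less.hyps) (use that less.prems sub[of k] in \<open>auto simp: hd_take\<close>)
    have "us @ (0::real) # vs \<noteq> [0]" "us @ (1::real) # vs \<noteq> [0]"
      using False by (auto simp: append_eq_Cons_conv)
    note app = ear_count_append[OF this(1)] ear_count_append[OF this(2)] ear_count_append'[OF False not0]
    \<comment> \<open>The terms with the marked corner as apex agree for the weights 0 and 1. All
      other terms change by the induction hypothesis, and the changes add up to the recursion for
      \<open>us @ vs\<close>, which has no such middle term.\<close>
    have "ear_count (us @ 0 # vs) =
       (\<Sum>k<length us. ear_count (take k us) * ear_count (drop (Suc k) us @ 1 # vs)) +
       ear_count us * ear_count vs +
       (\<Sum>k<length vs. ear_count (us @ 1 # take k vs) * ear_count (drop (Suc k) vs)) -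
       ((\<Sum>k<length us. ear_count (take k us) * ear_count (drop (Suc k) us @ vs)) +
       (\<Sum>k<length vs. ear_count (us @ take k vs) * ear_count (drop (Suc k) vs)))"
      using less.prems by (simp add: app 1 2 algebra_simps sum_subtractf)
    also have "\<dots> = ear_count (us @ 1 # vs) - ear_count (us @ vs)"
      using less.prems by (simp add: app)
    finally show ?thesis .
  qed
qed

text \<open>The generating function satisfies \<open>C = 1 + X * C^2\<close>, so
  \<open>R = 1 - 2 * X * C\<close> is a square root of \<open>1 - 4 * X\<close>. Differentiating
  \<open>R * R\<close> gives the linear equation \<open>(1 - 4 * X) * R' = - 2 * R\<close>, whose
  coefficients obey the recurrence of the moments.\<close>

lemma ear_count_replicate_1: "ear_count (replicate n 1) = cat_int n 0"
proof -
  define c where "c n = ear_count (replicate n 1)" for n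
  have c0: "c 0 = 1" by (simp add: c_def)
  have cS: "c (Suc n) = (\<Sum>k\<le>n. c k * c (n - k))" for n
  proof -
    have "c (Suc n) = (\<Sum>k<Suc n. ear_count (take k (replicate (Suc n) 1)) * ear_count (drop (Suc k) (replicate (Suc n) 1)))"
      unfolding c_def by (subst ear_count_rec) auto
    also have "\<dots> = (\<Sum>k<Suc n. c k * c (n - k))"
      by (intro sum.cong) (auto simp: c_def min_def simp del: replicate.simps)
    finally show ?thesis by (simp add: lessThan_Suc_atMost)
  qed
  define C where "C = Abs_fps c"
  have C: "C = 1 + fps_X * (C * C)"
  proof (rule fps_ext)
    fix n
    show "fps_nth C n = fps_nth (1 + fps_X * (C * C)) n"
    proof (cases n)
      case (Suc m)
      have "fps_nth (fps_X * (C * C)) (Suc m) = fps_nth (C * C) m" by simp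
      also have "\<dots> = c (Suc m)" by (simp add: C_def cS fps_mult_nth atLeast0AtMost)
      finally show ?thesis by (simp add: Suc C_def)
    qed (simp add: C_def c0)
  qed
  define R where "R = 1 - 2 * fps_X * C"
  have RR: "R * R = 1 - 4 * fps_X"
  proof -
    have "R * R = 1 - 4 * fps_X * (C - fps_X * (C * C))" unfolding R_def by (simp add: algebra_simps)
    also have "C - fps_X * (C * C) = 1" by (subst C) simp
    finally show ?thesis by simp
  qed
  have "fps_deriv (R * R) = fps_deriv (1 - 4 * fps_X)" by (simp only: RR)
  then have "2 * (R * fps_deriv R) = - 4" 
    by (simp add: fps_deriv_mult algebra_simps)
  then have "R * (2 * (R * fps_deriv R)) = - 4 * R" by (simp add: algebra_simps)
  then have "2 * ((R * R) * fps_deriv R) = 2 * (- 2 * R)" by (simp only: ac_simps) (simp add: algebra_simps)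
  then have "(1 - 4 * fps_X) * fps_deriv R = - 2 * R"
    unfolding RR mult_cancel_left by simp
  then have RD: "fps_deriv R = 4 * (fps_X * fps_deriv R) - 2 * R" by (simp add: algebra_simps)
  have Rn: "fps_nth R (Suc n) = - 2 * c n" for n
    by (simp add: R_def C_def mult.assoc fps_numeral_nth numeral_fps_const)
  have rec: "real (n + 2) * c (Suc n) = real (4 * n + 2) * c n" for n
  proof -
    have "fps_nth (fps_deriv R) (Suc n) = fps_nth (4 * (fps_X * fps_deriv R) - 2 * R) (Suc n)" using RD by simp
    then have "real (n + 2) * fps_nth R (Suc (Suc n)) = 4 * (real (n+1) * fps_nth R (Suc n)) - 2 * fps_nth R (Suc n)"
      by (simp add: numeral_fps_const)
    then show ?thesis unfolding Rn by (simp add: algebra_simps)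
  qed
  have "c n = cat_int n 0"
  proof (induction n)
    case 0
    show ?case by (simp add: c0 cat_int_0_0)
  next
    case (Suc n)
    have "real (n + 2) * c (Suc n) = real (n + 2) * cat_int (Suc n) 0"
      unfolding rec cat_int_Suc_0 Suc.IH ..
    then show ?case by simp
  qed
  then show ?thesis by (simp add: c_def)
qed

text \<open>Each zero costs one backward difference: raising it to 1 keeps the length, deleting it
  lowers the length by one, and either way one zero fewer is left. That zeros are never adjacent
  survives the deletion, because the two corners brought together both have weight 1.\<close>

lemma ear_count_eq_cat_int:
  assumes "set xs \<subseteq> {0, 1}"
    and "\<And>k. Suc k < length xs \<Longrightarrow> xs ! k = 1 \<or> xs ! Suc k = 1"
  shows "ear_count xs = cat_int (length xs) (count_list xs 0)"
  using assms
proof (induction "count_list xs 0" arbitrary: xs)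
  case 0
  then have "\<forall>x\<in>set xs. x = 1" by (auto simp: count_list_0_iff)
  then have "xs = replicate (length xs) 1" by (simp add: replicate_length_same)
  then show ?case using 0 ear_count_replicate_1[of "length xs"] by simp
next
  case (Suc t)
  then have "0 \<in> set xs" by (metis count_list_0_iff nat.distinct(1))
  then obtain us vs where xs: "xs = us @ 0 # vs" by (meson split_list)
  have l: "us = [] \<or> last us = 1"
  proof (cases "us = []")
    case False
    then show ?thesis
      using Suc.prems(2)[of "length us - 1"] by (simp add: xs last_conv_nth nth_append)
  qed simp
  have h: "vs = [] \<or> hd vs = 1"
  proof (cases "vs = []")
    case False
    then show ?thesis
      using Suc.prems(2)[of "length us"] by (simp add: xs hd_conv_nth nth_append)
  qed simp
  have t: "count_list (us @ 1 # vs) 0 = t" "count_list (us @ vs) 0 = t"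
    using Suc.hyps(2) by (auto simp: xs)
  have "(us @ 1 # vs) ! k = 1 \<or> (us @ 1 # vs) ! Suc k = 1" if "Suc k < length (us @ 1 # vs)" for k
  proof -
    have "(us @ 1 # vs) ! i = (if i = length us then 1 else xs ! i)" for i
      by (auto simp: xs nth_append nth_Cons split: nat.splits)
    then show ?thesis using Suc.prems(2)[of k] that by (auto simp: xs)
  qed
  then have 1: "ear_count (us @ 1 # vs) = cat_int (length xs) t"
    using Suc.hyps(1)[of "us @ 1 # vs"] t Suc.prems by (simp add: xs)
  have "(us @ vs) ! k = 1 \<or> (us @ vs) ! Suc k = 1" if "Suc k < length (us @ vs)" for k
  proof -
    consider "Suc k < length us" | "Suc k = length us" | "k \<ge> length us" by linarith
    then show ?thesis
    proof cases
      case 1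
      then show ?thesis using Suc.prems(2)[of k] by (simp add: xs nth_append)
    next
      case 2
      then have "us \<noteq> []" "k = length us - 1" by auto
      then show ?thesis using l 2 by (simp add: nth_append last_conv_nth)
    next
      case 3
      then show ?thesis using Suc.prems(2)[of "Suc k"] that by (simp add: xs nth_append Suc_diff_le)
    qed
  qed
  then have 2: "ear_count (us @ vs) = cat_int (length xs - 1) t"
    using Suc.hyps(1)[of "us @ vs"] t Suc.prems by (simp add: xs)
  have "t \<le> length (us @ vs)" using t(2) count_le_length[of "us @ vs" 0] by simp
  then show ?case
    using ear_count_zero[OF _ l h] Suc.prems 1 2 Suc.hyps(2)[symmetric] cat_int_Suc_right[of t "length xs"]
    by (simp add: xs)
qed

section \<open>Orientation of triples in the plane\<close>

text \<open>Twice the signed area of the triangle, positive for counterclockwise order.\<close>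

definition orient :: "real^2 \<Rightarrow> real^2 \<Rightarrow> real^2 \<Rightarrow> real" where
  "orient a b c = (b $ 1 - a $ 1) * (c $ 2 - a $ 2) - (b $ 2 - a $ 2) * (c $ 1 - a $ 1)"

lemma orient_rotate: "orient b c a = orient a b c"
  by (simp add: orient_def algebra_simps)

lemma orient_swap: "orient b a c = - orient a b c"
  by (simp add: orient_def algebra_simps)

lemma orient_swap': "orient a c b = - orient a b c"
  by (simp add: orient_def algebra_simps)

lemma orient_self [simp]: "orient a a b = 0" "orient a b a = 0" "orient a b b = 0"
  by (simp_all add: orient_def)

lemma orient_affine:
  assumes "u + v = 1"
  shows "orient a b (u *\<^sub>R x + v *\<^sub>R y) = u * orient a b x + v * orient a b y"
proof -
  have v: "v = 1 - u" using assms by simp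
  show ?thesis unfolding v orient_def by (simp add: algebra_simps)
qed

lemma convex_orient:
  "convex {x. 0 \<le> orient a b x}" "convex {x. orient a b x \<le> 0}" "convex {x. orient a b x = 0}"
  by (auto simp: convex_def orient_affine add_nonneg_nonneg add_nonpos_nonpos mult_nonneg_nonpos)

lemma orient_convex_hull:
  "(\<And>y. y \<in> A \<Longrightarrow> 0 \<le> orient a b y) \<Longrightarrow> x \<in> convex hull A \<Longrightarrow> 0 \<le> orient a b x"
  "(\<And>y. y \<in> A \<Longrightarrow> orient a b y \<le> 0) \<Longrightarrow> x \<in> convex hull A \<Longrightarrow> orient a b x \<le> 0"
  "(\<And>y. y \<in> A \<Longrightarrow> orient a b y = 0) \<Longrightarrow> x \<in> convex hull A \<Longrightarrow> orient a b x = 0"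
  using hull_minimal[of A _ convex, OF _ convex_orient(1)[of a b]]
    hull_minimal[of A _ convex, OF _ convex_orient(2)[of a b]]
    hull_minimal[of A _ convex, OF _ convex_orient(3)[of a b]]
  by (blast | auto)+

lemma vec2_eq_iff: "(x::real^2) = y \<longleftrightarrow> x $ 1 = y $ 1 \<and> x $ 2 = y $ 2"
  by (simp add: vec_eq_iff forall_2)

text \<open>Cramer's rule without division, hence also valid for collinear \<open>a\<close>,
  \<open>b\<close>, \<open>c\<close>.\<close>

lemma orient_barycentric:
  "orient a b c *\<^sub>R x = orient x b c *\<^sub>R a + orient a x c *\<^sub>R b + orient a b x *\<^sub>R c"
  by (simp add: vec2_eq_iff orient_def algebra_simps)

lemma orient_barycentric_sum: "orient x b c + orient a x c + orient a b x = orient a b c"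
  by (simp add: orient_def algebra_simps)

text \<open>The affine dependency of four points. In convex position all four coefficients are
  nonnegative, and after normalization both sides become the intersection point of the
  diagonals.\<close>

lemma orient_dependency:
  "orient b c d *\<^sub>R a + orient a b d *\<^sub>R c = orient a c d *\<^sub>R b + orient a b c *\<^sub>R d"
  "orient b c d + orient a b d = orient a c d + orient a b c"
  by (simp_all add: vec2_eq_iff orient_def algebra_simps)

lemma orient_barycentric':
  assumes "orient a b c \<noteq> 0"
  shows "x = (orient x b c / orient a b c) *\<^sub>R a + (orient a x c / orient a b c) *\<^sub>R b +
     (orient a b x / orient a b c) *\<^sub>R c"
    and "orient x b c / orient a b c + orient a x c / orient a b c + orient a b x / orient a b c = 1"
proof -
  have "x = (1 / orient a b c) *\<^sub>R (orient a b c *\<^sub>R x)" using assms by simp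
  then show "x = (orient x b c / orient a b c) *\<^sub>R a + (orient a x c / orient a b c) *\<^sub>R b +
     (orient a b x / orient a b c) *\<^sub>R c"
    unfolding orient_barycentric[of a b c x] by (simp add: scaleR_add_right)
  show "orient x b c / orient a b c + orient a x c / orient a b c + orient a b x / orient a b c = 1"
    using assms orient_barycentric_sum[of x b c a] by (simp flip: add_divide_distrib)
qed

lemma in_triangle_iff:
  assumes "0 < orient a b c"
  shows "x \<in> convex hull {a, b, c} \<longleftrightarrow> 0 \<le> orient x b c \<and> 0 \<le> orient a x c \<and> 0 \<le> orient a b x"
proof
  assume x: "x \<in> convex hull {a, b, c}"
  have "0 \<le> orient b c x" "0 \<le> orient c a x" "0 \<le> orient a b x"
    using assms by (auto intro!: orient_convex_hull(1)[OF _ x] simp: orient_rotate orient_rotate[of c a b])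
  then show "0 \<le> orient x b c \<and> 0 \<le> orient a x c \<and> 0 \<le> orient a b x"
    by (metis orient_rotate)
next
  assume "0 \<le> orient x b c \<and> 0 \<le> orient a x c \<and> 0 \<le> orient a b x"
  then show "x \<in> convex hull {a, b, c}"
    using orient_barycentric'[of a b c x] assms unfolding convex_hull_3
    by (intro CollectI exI conjI) auto
qed

lemma orient_eq_0_segment:
  assumes "orient a b c \<noteq> 0" "x \<in> convex hull {a, b, c}" "orient a b x = 0"
  shows "x \<in> closed_segment a b"
proof -
  obtain u v w where uvw: "0 \<le> u" "0 \<le> v" "0 \<le> w" "u + v + w = 1" and x: "x = u *\<^sub>R a + v *\<^sub>R b + w *\<^sub>R c"
    using assms(2) unfolding convex_hull_3 by blast
  have "orient a b x = w * orient a b c"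
  proof -
    have u: "u = 1 - v - w" using uvw by simp
    show ?thesis unfolding x u orient_def by (simp add: algebra_simps)
  qed
  then have "w = 0" using assms by simp
  with uvw have "u = 1 - v" by simp
  then show ?thesis using uvw x \<open>w = 0\<close>
    unfolding in_segment by (intro exI[of _ v]) simp
qed

lemma collinear_orient: "collinear {a, b, c} \<longleftrightarrow> orient a b c = 0"
proof
  assume "collinear {a, b, c}"
  then consider "a = c" | u where "b = u *\<^sub>R a + (1 - u) *\<^sub>R c" unfolding collinear_3_expand by blast
  then show "orient a b c = 0"
  proof cases
    case 2
    show ?thesis unfolding 2 orient_def by (simp add: algebra_simps)
  qed simp
next
  assume o: "orient a b c = 0"
  show "collinear {a, b, c}"
  proof (cases "a = c")
    case True
    then show ?thesis by (simp add: insert_commute)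
  next
    case False
    then consider "a $ 1 \<noteq> c $ 1" | "a $ 2 \<noteq> c $ 2" by (auto simp: vec2_eq_iff)
    then obtain u where u: "b $ 1 - c $ 1 = u * (a $ 1 - c $ 1)" "b $ 2 - c $ 2 = u * (a $ 2 - c $ 2)"
    proof cases
      case 1
      define u where "u = (b $ 1 - c $ 1) / (a $ 1 - c $ 1)"
      have "(b $ 2 - c $ 2) * (a $ 1 - c $ 1) = (b $ 1 - c $ 1) * (a $ 2 - c $ 2)"
        using o by (simp add: orient_def algebra_simps)
      then have "b $ 2 - c $ 2 = u * (a $ 2 - c $ 2)" "b $ 1 - c $ 1 = u * (a $ 1 - c $ 1)"
        unfolding u_def using 1 by (simp_all add: eq_divide_eq)
      then show ?thesis by (intro that[of u])
    next
      case 2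
      define u where "u = (b $ 2 - c $ 2) / (a $ 2 - c $ 2)"
      have "(b $ 1 - c $ 1) * (a $ 2 - c $ 2) = (b $ 2 - c $ 2) * (a $ 1 - c $ 1)"
        using o by (simp add: orient_def algebra_simps)
      then have "b $ 1 - c $ 1 = u * (a $ 1 - c $ 1)" "b $ 2 - c $ 2 = u * (a $ 2 - c $ 2)"
        unfolding u_def using 2 by (simp_all add: eq_divide_eq)
      then show ?thesis by (intro that[of u])
    qed
    then have "b = u *\<^sub>R a + (1 - u) *\<^sub>R c"
      by (simp add: vec2_eq_iff algebra_simps)
    then show ?thesis by (auto simp: collinear_3_expand)
  qed
qed

lemma orient_nonzero_affine_independent:
  assumes "orient a b c \<noteq> 0"
  shows "\<not> affine_dependent {a, b, c}" "a \<noteq> b" "b \<noteq> c" "a \<noteq> c"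
  using assms collinear_3_eq_affine_dependent[of a b c] collinear_orient[of a b c] by auto

lemma triangle_simplex:
  assumes "orient a b c \<noteq> 0"
  shows "2 simplex (convex hull {a, b, c})"
  using orient_nonzero_affine_independent[OF assms] by (auto simp: simplex_def)

lemma triangle_face_iff:
  assumes "orient a b c \<noteq> 0"
  shows "F face_of (convex hull {a, b, c}) \<longleftrightarrow> (\<exists>C \<subseteq> {a, b, c}. F = convex hull C)"
  by (rule face_of_convex_hull_affine_independent[OF orient_nonzero_affine_independent(1)[OF assms]])

lemma triangle_extreme_iff:
  assumes "orient a b c \<noteq> 0"
  shows "x extreme_point_of (convex hull {a, b, c}) \<longleftrightarrow> x \<in> {a, b, c}"
  by (rule extreme_point_of_convex_hull_affine_independent[OF orient_nonzero_affine_independent(1)[OF assms]])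

lemma triangle_edge_iff:
  assumes "orient a b c \<noteq> 0"
  shows "e edge_of (convex hull {a, b, c}) \<longleftrightarrow>
     e = closed_segment a b \<or> e = closed_segment b c \<or> e = closed_segment a c"
proof -
  note ind = orient_nonzero_affine_independent[OF assms]
  have dim: "aff_dim (convex hull C) = int (card C) - 1" if "C \<subseteq> {a, b, c}" for C
    using affine_independent_subset[OF ind(1) that] by (simp add: aff_dim_convex_hull affine_independent_iff_card)
  have "e edge_of (convex hull {a, b, c}) \<longleftrightarrow> (\<exists>C \<subseteq> {a, b, c}. e = convex hull C \<and> card C = 2)"
  proof
    assume "e edge_of (convex hull {a, b, c})"
    then obtain C where C: "C \<subseteq> {a, b, c}" "e = convex hull C" "aff_dim e = 1"
      unfolding edge_of_def triangle_face_iff[OF assms] by auto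
    then have "card C = 2" using dim[OF C(1)] by simp
    with C show "\<exists>C \<subseteq> {a, b, c}. e = convex hull C \<and> card C = 2" by blast
  next
    assume "\<exists>C \<subseteq> {a, b, c}. e = convex hull C \<and> card C = 2"
    then obtain C where C: "C \<subseteq> {a, b, c}" "e = convex hull C" "card C = 2" by blast
    then show "e edge_of (convex hull {a, b, c})"
      unfolding edge_of_def triangle_face_iff[OF assms] using dim[OF C(1)] by auto
  qed
  also have "\<dots> \<longleftrightarrow> e \<in> (\<lambda>C. convex hull C) ` {C. C \<subseteq> {a, b, c} \<and> card C = 2}" by blast
  also have "{C. C \<subseteq> {a, b, c} \<and> card C = 2} = {{a, b}, {b, c}, {a, c}}"
  proof (rule set_eqI)
    fix C
    show "C \<in> {C. C \<subseteq> {a, b, c} \<and> card C = 2} \<longleftrightarrow> C \<in> {{a, b}, {b, c}, {a, c}}"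
      using ind(2-4) by (auto simp: card_2_iff)
  qed
  finally show ?thesis by (auto simp: segment_convex_hull)
qed

definition empty_triangle :: "(real^2) set \<Rightarrow> real^2 \<Rightarrow> real^2 \<Rightarrow> real^2 \<Rightarrow> bool" where
  "empty_triangle P a b c \<longleftrightarrow> {a, b, c} \<subseteq> P \<and> orient a b c \<noteq> 0 \<and>
     open_segment a b \<inter> P = {} \<and> open_segment b c \<inter> P = {} \<and> open_segment a c \<inter> P = {}"

text \<open>Trades simplices, extreme points and edges for conditions on three points, so that
  everything after this can be argued with orientations.\<close>

lemma empty_triangle_iff:
  "(2 simplex T \<and> {v. v extreme_point_of T} \<subseteq> P \<and> (\<forall>e. e edge_of T \<longrightarrow> rel_interior e \<inter> P = {})) \<longleftrightarrow>
   (\<exists>a b c. empty_triangle P a b c \<and> T = convex hull {a, b, c})"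
proof
  assume T: "2 simplex T \<and> {v. v extreme_point_of T} \<subseteq> P \<and> (\<forall>e. e edge_of T \<longrightarrow> rel_interior e \<inter> P = {})"
  then obtain C where C: "\<not> affine_dependent C" "card C = 3" "T = convex hull C" by (auto simp: simplex_def)
  then obtain a b c where abc: "C = {a, b, c}" "a \<noteq> b" "b \<noteq> c" "a \<noteq> c" by (auto simp: card_3_iff)
  then have o: "orient a b c \<noteq> 0"
    using C collinear_3_eq_affine_dependent[of a b c] collinear_orient[of a b c] by auto
  have "{a, b, c} \<subseteq> P" using T triangle_extreme_iff[OF o] C abc by auto
  moreover have "rel_interior e \<inter> P = {}" if "e \<in> {closed_segment a b, closed_segment b c, closed_segment a c}" for e
    using T C abc triangle_edge_iff[OF o, of e] that by auto
  then have "open_segment a b \<inter> P = {}" "open_segment b c \<inter> P = {}" "open_segment a c \<inter> P = {}"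
    using abc(2-4) by (fastforce simp: rel_interior_closed_segment)+
  ultimately have "empty_triangle P a b c" using o by (simp add: empty_triangle_def)
  then show "\<exists>a b c. empty_triangle P a b c \<and> T = convex hull {a, b, c}" using C abc by blast
next
  assume "\<exists>a b c. empty_triangle P a b c \<and> T = convex hull {a, b, c}"
  then obtain a b c where abc: "empty_triangle P a b c" and T: "T = convex hull {a, b, c}" by blast
  then have o: "orient a b c \<noteq> 0" by (simp add: empty_triangle_def)
  show "2 simplex T \<and> {v. v extreme_point_of T} \<subseteq> P \<and> (\<forall>e. e edge_of T \<longrightarrow> rel_interior e \<inter> P = {})"
    unfolding T triangle_edge_iff[OF o] triangle_extreme_iff[OF o]
    using triangle_simplex[OF o] abc orient_nonzero_affine_independent(2-4)[OF o]
    by (auto simp: empty_triangle_def rel_interior_closed_segment)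
qed

lemma triangle_dissection_iff:
  "triangle_dissection P \<T> \<longleftrightarrow>
     finite \<T> \<and> (\<forall>T\<in>\<T>. \<forall>T'\<in>\<T>. (T \<inter> T') face_of T) \<and> \<Union>\<T> = convex hull P \<and>
     (\<forall>T\<in>\<T>. \<exists>a b c. empty_triangle P a b c \<and> T = convex hull {a, b, c})"
proof -
  define Q where "Q \<longleftrightarrow> (\<forall>T\<in>\<T>. \<exists>a b c. empty_triangle P a b c \<and> T = convex hull {a, b, c})"
  have 1: "triangle_dissection P \<T> \<longleftrightarrow> triangulation \<T> \<and> \<Union>\<T> = convex hull P \<and> Q"
    unfolding triangle_dissection_def empty_triangle_iff Q_def ..
  have 2: "triangulation \<T> \<longleftrightarrow> finite \<T> \<and> (\<forall>T\<in>\<T>. \<forall>T'\<in>\<T>. (T \<inter> T') face_of T)" if Q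
  proof -
    have "\<exists>n. n simplex T" if "T \<in> \<T>" for T
      using \<open>Q\<close> that empty_triangle_iff[of T P] unfolding Q_def by metis
    then show ?thesis by (auto simp: triangulation_def)
  qed
  show ?thesis unfolding Q_def[symmetric] using 1 2 by blast
qed

section \<open>Dissections of weakly convex chains\<close>

lemma empty_triangle_swap:
  "empty_triangle P a b c \<Longrightarrow> empty_triangle P b a c"
  "empty_triangle P a b c \<Longrightarrow> empty_triangle P a c b"
  by (auto simp: empty_triangle_def open_segment_commute orient_swap[of b a] orient_swap'[of a c])

text \<open>A supporting line meets the hull only in the hull of the points on it: the open half
  plane together with that smaller hull is convex and contains \<open>A\<close>.\<close>

lemma orient_face_hull:
  assumes "\<And>y. y \<in> A \<Longrightarrow> orient a b y \<le> 0" "x \<in> convex hull A" "orient a b x = 0"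
  shows "x \<in> convex hull {y \<in> A. orient a b y = 0}"
proof -
  let ?Z = "convex hull {y \<in> A. orient a b y = 0}"
  have Z: "orient a b z = 0" if "z \<in> ?Z" for z
    using orient_convex_hull(3)[OF _ that, of a b] by blast
  have "convex ({z. orient a b z < 0} \<union> ?Z)"
  proof (rule convexI)
    fix y z :: "real^2" and u v :: real
    assume y: "y \<in> {z. orient a b z < 0} \<union> ?Z" and z: "z \<in> {z. orient a b z < 0} \<union> ?Z"
      and uv: "0 \<le> u" "0 \<le> v" "u + v = 1"
    show "u *\<^sub>R y + v *\<^sub>R z \<in> {z. orient a b z < 0} \<union> ?Z"
    proof (cases "u *\<^sub>R y + v *\<^sub>R z \<in> {y, z} \<or> y \<in> ?Z \<and> z \<in> ?Z")
      case True
      then show ?thesis using y z uv convexD[OF convex_convex_hull, of y "{y \<in> A. orient a b y = 0}" z u v] by auto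
    next
      case False
      then have "u \<noteq> 0" "v \<noteq> 0" using uv by auto
      then have uv': "u > 0" "v > 0" using uv by auto
      have "orient a b y \<le> 0" "orient a b z \<le> 0" using y z Z by force+
      moreover have "orient a b y < 0 \<or> orient a b z < 0" using y z False by auto
      ultimately have "u * orient a b y + v * orient a b z < 0"
        using uv' by (metis add_neg_nonpos add_nonpos_neg mult_nonneg_nonpos mult_pos_neg less_imp_le)
      then show ?thesis using uv by (simp add: orient_affine)
    qed
  qed
  moreover have "A \<subseteq> {z. orient a b z < 0} \<union> ?Z"
    using assms(1) hull_subset[of "{y \<in> A. orient a b y = 0}" convex] by (force simp: order.order_iff_strict)
  ultimately have "convex hull A \<subseteq> {z. orient a b z < 0} \<union> ?Z" by (rule hull_minimal[rotated])
  then show ?thesis using assms(2,3) by auto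
qed

lemma orient_closed_segment: "x \<in> closed_segment a b \<Longrightarrow> orient a b x = 0"
  unfolding segment_convex_hull by (rule orient_convex_hull(3)[of "{a, b}"]) auto

lemma orient_open_segment: "x \<in> open_segment a b \<Longrightarrow> orient a b x = 0"
  using orient_closed_segment open_closed_segment by blast

lemma open_segment_antisym: "(x :: 'a::euclidean_space) \<in> open_segment a b \<Longrightarrow> b \<notin> open_segment a x"
  using dist_in_open_segment[of x a b] dist_in_open_segment[of b a x] by (auto simp: dist_commute)

text \<open>
  The boundary points in counterclockwise order; \<open>M\<close> contains the indices of the subdivision points.
  Every side may be subdivided, so a collinear triple through the end of the sequence cannot
  be avoided; the numbering starts at a corner and ends with a subdivision point.
\<close>

locale chain =
  fixes p :: "nat \<Rightarrow> real^2" and n :: nat and M :: "nat set"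
  assumes inj: "inj_on p {..n}"
    and nonneg: "a < b \<Longrightarrow> b < c \<Longrightarrow> c \<le> n \<Longrightarrow> 0 \<le> orient (p a) (p b) (p c)"
    and zero_iff: "a < b \<Longrightarrow> b < c \<Longrightarrow> c \<le> n \<Longrightarrow> orient (p a) (p b) (p c) = 0 \<longleftrightarrow>
          b = Suc a \<and> c = Suc b \<and> b \<in> M \<or> a = 0 \<and> Suc b = n \<and> c = n"
    and between: "Suc (Suc a) \<le> n \<Longrightarrow> Suc a \<in> M \<Longrightarrow> p (Suc a) \<in> open_segment (p a) (p (Suc (Suc a)))"
    and between_wrap: "p n \<in> open_segment (p 0) (p (n - 1))"
begin

abbreviation P where "P i j \<equiv> p ` {i..j}"
abbreviation H where "H i j \<equiv> convex hull (P i j)"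
abbreviation tri where "tri a b c \<equiv> convex hull {p a, p b, p c}"

text \<open>Increasing indices give each triangle one representation, in counterclockwise order.
  Emptiness is relative to the run from \<open>i\<close> to \<open>j\<close>.\<close>

definition etri :: "nat \<Rightarrow> nat \<Rightarrow> nat \<Rightarrow> nat \<Rightarrow> nat \<Rightarrow> bool" where
  "etri i j a b c \<longleftrightarrow> i \<le> a \<and> a < b \<and> b < c \<and> c \<le> j \<and> empty_triangle (P i j) (p a) (p b) (p c)"

lemma p_eq_iff: "a \<le> n \<Longrightarrow> b \<le> n \<Longrightarrow> p a = p b \<longleftrightarrow> a = b"
  using inj by (auto simp: inj_on_def)

lemma pos: "a < b \<Longrightarrow> b < c \<Longrightarrow> c \<le> n \<Longrightarrow> orient (p a) (p b) (p c) \<noteq> 0 \<Longrightarrow> 0 < orient (p a) (p b) (p c)"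
  using nonneg[of a b c] by simp

lemma etri_orient: "etri i j a b c \<Longrightarrow> j \<le> n \<Longrightarrow> 0 < orient (p a) (p b) (p c)"
  by (rule pos) (auto simp: etri_def empty_triangle_def)

lemma H_mono: "i' \<le> i \<Longrightarrow> j \<le> j' \<Longrightarrow> H i j \<subseteq> H i' j'"
  by (intro hull_mono image_mono) auto

lemma p_in_H: "i \<le> t \<Longrightarrow> t \<le> j \<Longrightarrow> p t \<in> H i j"
  by (simp add: hull_inc)

lemma tri_subset_H: "i \<le> a \<Longrightarrow> a < b \<Longrightarrow> b < c \<Longrightarrow> c \<le> j \<Longrightarrow> tri a b c \<subseteq> H i j"
  by (intro hull_mono) auto

lemma p_in_tri: "p a \<in> tri a b c" "p b \<in> tri a b c" "p c \<in> tri a b c"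
  by (simp_all add: hull_inc)

lemma empty_triangle_obtains_etri:
  assumes "empty_triangle (P i j) x y z" "j \<le> n"
  obtains a b c where "etri i j a b c" "convex hull {x, y, z} = tri a b c"
proof -
  obtain a b c where abc: "x = p a" "y = p b" "z = p c" "a \<in> {i..j}" "b \<in> {i..j}" "c \<in> {i..j}"
    using assms(1) unfolding empty_triangle_def by auto
  have ne: "a \<noteq> b" "b \<noteq> c" "a \<noteq> c"
    using assms(1) abc by (auto simp: empty_triangle_def)
  note e = assms(1)[unfolded abc]
  note s1 = empty_triangle_swap(1) and s2 = empty_triangle_swap(2)
  consider "a < b \<and> b < c" | "a < c \<and> c < b" | "b < a \<and> a < c" | "b < c \<and> c < a" | "c < a \<and> a < b" | "c < b \<and> b < a"
    using ne by linarith
  then show ?thesis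
  proof cases
    case 1
    then show ?thesis using that[of a b c] e abc by (auto simp: etri_def)
  next
    case 2
    then show ?thesis using that[of a c b] s2[OF e] abc by (auto simp: etri_def insert_commute)
  next
    case 3
    then show ?thesis using that[of b a c] s1[OF e] abc by (auto simp: etri_def insert_commute)
  next
    case 4
    then show ?thesis using that[of b c a] s2[OF s1[OF e]] abc by (auto simp: etri_def insert_commute)
  next
    case 5
    then show ?thesis using that[of c a b] s1[OF s2[OF e]] abc by (auto simp: etri_def insert_commute)
  next
    case 6
    then show ?thesis using that[of c b a] s1[OF s2[OF s1[OF e]]] abc by (auto simp: etri_def insert_commute)
  qed
qed

lemma dissection_iff:
  assumes "j \<le> n"
  shows "triangle_dissection (P i j) \<T> \<longleftrightarrow>
     finite \<T> \<and> (\<forall>T\<in>\<T>. \<forall>T'\<in>\<T>. (T \<inter> T') face_of T) \<and> \<Union>\<T> = H i j \<and>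
     (\<forall>T\<in>\<T>. \<exists>a b c. etri i j a b c \<and> T = tri a b c)"
proof -
  have "(\<exists>x y z. empty_triangle (P i j) x y z \<and> T = convex hull {x, y, z}) \<longleftrightarrow>
     (\<exists>a b c. etri i j a b c \<and> T = tri a b c)" for T
  proof
    assume "\<exists>x y z. empty_triangle (P i j) x y z \<and> T = convex hull {x, y, z}"
    then obtain x y z where "empty_triangle (P i j) x y z" and T: "T = convex hull {x, y, z}" by blast
    from this(1) assms obtain a b c where "etri i j a b c" "convex hull {x, y, z} = tri a b c"
      by (rule empty_triangle_obtains_etri)
    with T show "\<exists>a b c. etri i j a b c \<and> T = tri a b c" by auto
  next
    assume "\<exists>a b c. etri i j a b c \<and> T = tri a b c"
    then show "\<exists>x y z. empty_triangle (P i j) x y z \<and> T = convex hull {x, y, z}"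
      unfolding etri_def by blast
  qed
  then show ?thesis unfolding triangle_dissection_iff by simp
qed

text \<open>The index \<open>t\<close> falls into one of the gaps around \<open>a\<close>,
  \<open>b\<close>, \<open>c\<close>, and weak convexity puts \<open>p t\<close> on or beyond the
  line of the corresponding side. Inside the triangle it would have to lie on that side, which
  contains no further points.\<close>

lemma etri_vertices:
  assumes e: "etri i j a b c" and j: "j \<le> n" and t: "t \<in> {i..j}" "p t \<in> tri a b c"
  shows "t \<in> {a, b, c}"
proof (rule ccontr)
  assume nt: "t \<notin> {a, b, c}"
  note abc = e[unfolded etri_def]
  have o: "0 < orient (p a) (p b) (p c)" by (rule etri_orient[OF e j])
  have ge: "0 \<le> orient (p t) (p b) (p c)" "0 \<le> orient (p a) (p t) (p c)" "0 \<le> orient (p a) (p b) (p t)"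
    using t(2) by (simp_all add: in_triangle_iff[OF o])
  have ne: "p t \<noteq> p a" "p t \<noteq> p b" "p t \<noteq> p c"
    using nt t(1) abc j by (auto simp: p_eq_iff)
  have empty: "p t \<notin> open_segment (p a) (p b)" "p t \<notin> open_segment (p b) (p c)" "p t \<notin> open_segment (p a) (p c)"
    using abc t(1) by (auto simp: empty_triangle_def)
  have ab: "orient (p a) (p b) (p t) \<noteq> 0"
    using orient_eq_0_segment[OF _ t(2)] o empty ne by (auto simp: open_segment_def)
  have bc: "orient (p b) (p c) (p t) \<noteq> 0"
    using orient_eq_0_segment[of "p b" "p c" "p a" "p t"] t(2) o empty ne
    by (auto simp: open_segment_def orient_rotate insert_commute)
  have ac: "orient (p a) (p c) (p t) \<noteq> 0"
    using orient_eq_0_segment[of "p a" "p c" "p b" "p t"] t(2) o empty ne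
    by (auto simp: open_segment_def orient_swap'[of "p a" "p c" "p b"] insert_commute)
  consider "t < a" | "a < t \<and> t < b" | "b < t \<and> t < c" | "c < t" using nt by force
  then show False
  proof cases
    case 1
    then have "0 \<le> orient (p t) (p a) (p c)" using nonneg abc j by auto
    then show False using ac ge(2) orient_swap[of "p t" "p a" "p c"] orient_swap'[of "p a" "p c" "p t"] by linarith
  next
    case 2
    then have "0 \<le> orient (p a) (p t) (p b)" using nonneg abc j by auto
    then show False using ab ge(3) orient_swap'[of "p a" "p t" "p b"] by linarith
  next
    case 3
    then have "0 \<le> orient (p b) (p t) (p c)" using nonneg abc j by auto
    then show False using bc ge(1) orient_swap[of "p b" "p t" "p c"] orient_rotate[of "p b" "p c" "p t"] by linarith
  next
    case 4
    then have "0 \<le> orient (p a) (p c) (p t)" using nonneg abc j t(1) by auto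
    then show False using ac ge(2) orient_swap'[of "p a" "p c" "p t"] by linarith
  qed
qed

text \<open>
  Two edges with interlaced end points meet, and the face condition then makes one triangle contain
  a point that is not one of its vertices.
\<close>

lemma no_crossing:
  assumes j: "j \<le> n" and e: "etri i j a b c" and e': "etri i j a' b' c'"
    and f: "(tri a b c \<inter> tri a' b' c') face_of tri a b c"
    and t: "t1 < t2" "t2 < t3" "t3 < t4" and t13: "{t1, t3} \<subseteq> {a, b, c}" and t24: "{t2, t4} \<subseteq> {a', b', c'}"
  shows False
proof -
  note abc = e[unfolded etri_def] and abc' = e'[unfolded etri_def]
  have r: "t1 \<in> {i..j}" "t2 \<in> {i..j}" "t3 \<in> {i..j}" "t4 \<in> {i..j}"
  proof -
    have "{a, b, c} \<subseteq> {i..j}" "{a', b', c'} \<subseteq> {i..j}" using abc abc' by auto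
    with t13 t24 show "t1 \<in> {i..j}" "t2 \<in> {i..j}" "t3 \<in> {i..j}" "t4 \<in> {i..j}" by blast+
  qed
  define \<alpha>1 \<alpha>2 \<alpha>3 \<alpha>4 where "\<alpha>1 = orient (p t2) (p t3) (p t4)" and "\<alpha>2 = orient (p t1) (p t3) (p t4)"
    and "\<alpha>3 = orient (p t1) (p t2) (p t4)" and "\<alpha>4 = orient (p t1) (p t2) (p t3)"
  note \<alpha>_defs = \<alpha>1_def \<alpha>2_def \<alpha>3_def \<alpha>4_def
  have \<alpha>: "0 \<le> \<alpha>1" "0 \<le> \<alpha>2" "0 \<le> \<alpha>3" "0 \<le> \<alpha>4" unfolding \<alpha>_defs using r t j by (auto intro!: nonneg)
  define s where "s = \<alpha>1 + \<alpha>3"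
  have s': "s = \<alpha>2 + \<alpha>4" unfolding s_def \<alpha>_defs by (rule orient_dependency(2))
  have "\<not> (\<alpha>3 = 0 \<and> \<alpha>4 = 0)"
    unfolding \<alpha>_defs using r t j by (auto simp: zero_iff)
  then have s: "s > 0" using \<alpha> s' s_def by linarith
  \<comment> \<open>The affine dependency makes \<open>x\<close> a common point of the segments
    \<open>t1 t3\<close> and \<open>t2 t4\<close>; the positive total \<open>s\<close> normalizes
    the coefficients.\<close>
  define x where "x = (1/s) *\<^sub>R (\<alpha>1 *\<^sub>R p t1 + \<alpha>3 *\<^sub>R p t3)"
  have x': "x = (1/s) *\<^sub>R (\<alpha>2 *\<^sub>R p t2 + \<alpha>4 *\<^sub>R p t4)"
    unfolding x_def \<alpha>_defs by (simp only: orient_dependency(1))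
  have seg13: "x \<in> closed_segment (p t1) (p t3)"
    unfolding in_segment using \<alpha> s s_def
    by (intro exI[of _ "\<alpha>3 / s"]) (auto simp: x_def scaleR_add_right field_simps)
  have seg24: "x \<in> closed_segment (p t2) (p t4)"
    unfolding in_segment using \<alpha> s s'
    by (intro exI[of _ "\<alpha>4 / s"]) (auto simp: x' scaleR_add_right field_simps)
  have T': "closed_segment (p t2) (p t4) \<subseteq> tri a' b' c'"
    unfolding segment_convex_hull using t24 by (intro hull_mono) auto
  have T: "closed_segment (p t1) (p t3) \<subseteq> tri a b c"
    unfolding segment_convex_hull using t13 by (intro hull_mono) auto
  show False
  proof (cases "x \<in> open_segment (p t1) (p t3)")
    case True
    have "p t1 \<in> tri a' b' c'" "p t3 \<in> tri a' b' c'"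
      using face_ofD[OF f True] T T' seg13 seg24 by auto
    then have "{t1, t2, t3, t4} \<subseteq> {a', b', c'}"
      using etri_vertices[OF e' j] r t24 by auto
    then have "card {t1, t2, t3, t4} \<le> card {a', b', c'}" by (intro card_mono) auto
    moreover have "card {a', b', c'} \<le> 3" by (simp add: card_insert_if)
    moreover have "card {t1, t2, t3, t4} = 4" using t by (simp add: card_insert_if)
    ultimately show False by simp
  next
    \<comment> \<open>The crossing degenerates to an end point of the first segment. That point is
      then a vertex of the second triangle and lies on its side \<open>t2 t4\<close>, so the
      triangle would have area zero.\<close>
    case False
    then have "x = p t1 \<or> x = p t3" using seg13 by (auto simp: open_segment_def)
    then obtain t where t': "t = t1 \<or> t = t3" "x = p t" by blast
    have "t \<in> {a', b', c'}"
      using etri_vertices[OF e' j, of t] t' r seg24 T' by auto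
    then have "{t, t2, t4} \<subseteq> {a', b', c'}" using t24 by auto
    then have "t = t1 \<and> a' = t1 \<and> b' = t2 \<and> c' = t4 \<or> t = t3 \<and> a' = t2 \<and> b' = t3 \<and> c' = t4"
      using t'(1) t abc' by auto
    moreover have "orient (p t2) (p t4) (p t) = 0" using orient_closed_segment seg24 t' by blast
    moreover have "0 < orient (p a') (p b') (p c')" by (rule etri_orient[OF e' j])
    ultimately show False
      using orient_rotate[of "p t2" "p t4" "p t1"] orient_swap'[of "p t2" "p t4" "p t3"] by auto
  qed
qed


section \<open>The triangle at the base\<close>

text \<open>The functional \<open>(p i - p j) \<bullet> _\<close> increases along the base towards
  \<open>p i\<close>. Only in the wrapped case is there a third point on the base line, namely
  \<open>p (n - 1)\<close>, and it lies beyond \<open>p j = p n\<close>. A run of more than three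
  points excludes the collinear consecutive triples.\<close>

lemma base_line_bound:
  assumes "i + 2 < j" "j \<le> n" "t \<in> {i..j}" "orient (p i) (p j) (p t) = 0" "t \<noteq> i"
  shows "(p i - p j) \<bullet> p t \<le> (p i - p j) \<bullet> p j" and "t \<noteq> j \<Longrightarrow> i = 0 \<and> Suc t = n \<and> j = n"
proof -
  have wrap: "i = 0 \<and> Suc t = n \<and> j = n" if "t \<noteq> j"
  proof -
    have t: "i < t" "t < j" using assms that by auto
    have "orient (p i) (p t) (p j) = 0" using assms(4) orient_swap'[of "p i" "p t" "p j"] by simp
    then show ?thesis using zero_iff[OF t assms(2)] assms(1) by auto
  qed
  then show "t \<noteq> j \<Longrightarrow> i = 0 \<and> Suc t = n \<and> j = n" .
  show "(p i - p j) \<bullet> p t \<le> (p i - p j) \<bullet> p j"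
  proof (cases "t = j")
    case False
    then have w: "i = 0" "t = n - 1" "j = n" using wrap by auto
    obtain u where u: "0 < u" "u < 1" "p j = (1 - u) *\<^sub>R p i + u *\<^sub>R p t"
      using between_wrap unfolding in_segment w by blast
    have "p i - p j = u *\<^sub>R (p i - p t)" using u(3) by (simp add: algebra_simps)
    moreover have "p j - p t = (1 - u) *\<^sub>R (p i - p t)" using u(3) by (simp add: algebra_simps)
    ultimately have "(p i - p j) \<bullet> (p j - p t) = u * (1 - u) * ((p i - p t) \<bullet> (p i - p t))" by simp
    also have "\<dots> \<ge> 0" using u by (intro mult_nonneg_nonneg) auto
    finally show ?thesis by (simp add: inner_diff_right)
  qed simp
qed

lemma dissectionD:
  assumes "triangle_dissection (P i j) \<T>" "j \<le> n"
  shows "finite \<T>" "\<Union>\<T> = H i j" "T \<in> \<T> \<Longrightarrow> T' \<in> \<T> \<Longrightarrow> (T \<inter> T') face_of T"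
    "T \<in> \<T> \<Longrightarrow> \<exists>a b c. etri i j a b c \<and> T = tri a b c"
  using assms(1) unfolding dissection_iff[OF assms(2)] by simp_all

text \<open>Some triangle contains the midpoint of the base. The whole hull lies on one side of the
  base line, so the midpoint is in the hull of those vertices of the triangle that lie on this line,
  and these turn out to include both ends of the base.\<close>

lemma base_triangle:
  assumes \<T>: "triangle_dissection (P i j) \<T>" and ij: "i + 2 \<le> j" "j \<le> n"
  obtains k where "i < k" "k < j" "etri i j i k j" "tri i k j \<in> \<T>"
proof -
  define x where "x = (1/2) *\<^sub>R p i + (1/2) *\<^sub>R p j"
  have "x \<in> H i j"
    unfolding x_def using ij by (intro convexD[OF convex_convex_hull[of "P i j"] p_in_H[of i i j] p_in_H[of i j j]]) auto
  then obtain T where T: "T \<in> \<T>" "x \<in> T"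
    unfolding dissectionD(2)[OF \<T> ij(2), symmetric] by blast
  then obtain a b c where e: "etri i j a b c" and Teq: "T = tri a b c"
    using dissectionD(4)[OF \<T> ij(2)] by blast
  note abc = e[unfolded etri_def]
  have sub: "{a, b, c} \<subseteq> {i..j}" using abc by auto
  have "a = i \<and> c = j"
  proof (cases "j = i + 2")
    case True
    then show ?thesis using abc by auto
  next
    case False
    then have ij': "i + 2 < j" using ij by simp
    have le: "orient (p i) (p j) (p t) \<le> 0" if "t \<in> {i..j}" for t
    proof (cases "t = i \<or> t = j")
      case False
      then have "0 \<le> orient (p i) (p t) (p j)" using that ij by (intro nonneg) auto
      then show ?thesis using orient_swap'[of "p i" "p t" "p j"] by simp
    qed auto
    have ox: "orient (p i) (p j) x = 0" unfolding x_def by (subst orient_affine) auto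
    define Y where "Y = {y \<in> {p a, p b, p c}. orient (p i) (p j) y = 0}"
    have xY: "x \<in> convex hull Y"
      unfolding Y_def using T(2) ox le sub by (intro orient_face_hull) (auto simp: Teq)
    have ne: "p i \<noteq> p j" using ij by (simp add: p_eq_iff)
    have "0 < (p i - p j) \<bullet> (p i - p j)" using ne by simp
    moreover have "(p i - p j) \<bullet> x = ((p i - p j) \<bullet> p i + (p i - p j) \<bullet> p j) / 2"
      unfolding x_def by (simp add: inner_add_right)
    ultimately have gx: "(p i - p j) \<bullet> p j < (p i - p j) \<bullet> x" "(p i - p j) \<bullet> x < (p i - p j) \<bullet> p i"
      by (simp_all add: inner_diff_right)
    \<comment> \<open>Without \<open>p i\<close>, no point of \<open>Y\<close> exceeds
      \<open>p j\<close> in the functional along the base, whereas the midpoint does.\<close>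
    have i: "i \<in> {a, b, c}"
    proof (rule ccontr)
      assume "i \<notin> {a, b, c}"
      then have "Y \<subseteq> {y. (p i - p j) \<bullet> y \<le> (p i - p j) \<bullet> p j}"
        unfolding Y_def using base_line_bound(1)[OF ij' ij(2)] sub by auto
      then have "convex hull Y \<subseteq> {y. (p i - p j) \<bullet> y \<le> (p i - p j) \<bullet> p j}"
        by (rule hull_minimal) (rule convex_halfspace_le)
      then show False using xY gx(1) by auto
    qed
    \<comment> \<open>Without \<open>p j\<close>, the only possible point of \<open>Y\<close>
      besides \<open>p i\<close> is \<open>p (n - 1)\<close>; but then \<open>p n\<close> would lie
      inside the side from \<open>p 0\<close> to \<open>p (n - 1)\<close>.\<close>
    have "j \<in> {a, b, c}"
    proof (rule ccontr)
      assume nj: "j \<notin> {a, b, c}"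
      have "Y \<subseteq> {p i}"
      proof
        fix y assume "y \<in> Y"
        then obtain t where t: "t \<in> {a, b, c}" "y = p t" "orient (p i) (p j) (p t) = 0" unfolding Y_def by auto
        have "t = i"
        proof (rule ccontr)
          assume "t \<noteq> i"
          with base_line_bound(2)[OF ij' ij(2) _ t(3)] t(1) nj sub
          have w: "i = 0" "t = n - 1" "j = n" by auto
          with i t(1) nj abc have "a = 0" "c = n - 1" by auto
          then have "p n \<notin> open_segment (p 0) (p (n - 1))"
            using abc w by (auto simp: empty_triangle_def)
          with between_wrap show False by simp
        qed
        then show "y \<in> {p i}" using t(2) by simp
      qed
      then have "x \<in> {p i}" using xY hull_mono[of Y "{p i}" convex] by auto
      then show False using gx(2) by simp
    qed
    with i abc show ?thesis by auto
  qed
  then show ?thesis using that[of b] e T Teq abc by auto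
qed

text \<open>If \<open>a < k < c\<close>, one side of the triangle has end points interlaced with
  those of a side of the base triangle; which one depends on whether \<open>a = i\<close> and
  \<open>c = j\<close>.\<close>

lemma dissection_classify:
  assumes \<T>: "triangle_dissection (P i j) \<T>" and j: "j \<le> n" and k: "i < k" "k < j"
    and e0: "etri i j i k j" and T0: "tri i k j \<in> \<T>"
    and T: "tri a b c \<in> \<T>" and e: "etri i j a b c" and ne: "tri a b c \<noteq> tri i k j"
  shows "c \<le> k \<or> k \<le> a"
proof (rule ccontr)
  assume "\<not> (c \<le> k \<or> k \<le> a)"
  then have ack: "a < k" "k < c" by auto
  note abc = e[unfolded etri_def]
  have f: "(tri a b c \<inter> tri i k j) face_of tri a b c" "(tri i k j \<inter> tri a b c) face_of tri i k j"
    using dissectionD(3)[OF \<T> j] T T0 by auto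
  note x1 = no_crossing[OF j e e0 f(1)] and x2 = no_crossing[OF j e0 e f(2)]
  consider "i < a" | "a = i" "c < j" | "a = i" "c = j" using abc by linarith
  then show False
  proof cases
    case 1
    then show False using x2[of i a k c] ack by auto
  next
    case 2
    then show False using x1[of a k c j] ack by auto
  next
    case 3
    then have "b \<noteq> k" using ne by auto
    then consider "b < k" | "k < b" by linarith
    then show False
    proof cases
      case 1
      then show False using x2[of i b k j] 3 abc k by auto
    next
      case 2
      then show False using x1[of i k b j] 3 abc k x1[of a k b c] by auto
    qed
  qed
qed

text \<open>A collinear triple inside a piece could only be a corner, a subdivision point and a
  corner in succession. The subdivision point would then lie inside a side of the base
  triangle.\<close>

lemma etri_strict:
  assumes e: "etri i j i k j" and j: "j \<le> n"
  shows "i < b \<Longrightarrow> b < k \<Longrightarrow> 0 < orient (p i) (p b) (p k)"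
    and "k < b \<Longrightarrow> b < j \<Longrightarrow> 0 < orient (p k) (p b) (p j)"
proof -
  note k = e[unfolded etri_def empty_triangle_def]
  assume b: "i < b" "b < k"
  show "0 < orient (p i) (p b) (p k)"
  proof (rule pos[OF b])
    show "k \<le> n" using k j by auto
    show "orient (p i) (p b) (p k) \<noteq> 0"
    proof
      assume "orient (p i) (p b) (p k) = 0"
      then have "b = Suc i" "k = Suc b" "b \<in> M" using zero_iff[OF b \<open>k \<le> n\<close>] k j by auto
      then have "p b \<in> open_segment (p i) (p k)" using between[of i] k j by auto
      then show False using k b by auto
    qed
  qed
next
  note k = e[unfolded etri_def empty_triangle_def]
  assume b: "k < b" "b < j"
  show "0 < orient (p k) (p b) (p j)"
  proof (rule pos[OF b j])
    show "orient (p k) (p b) (p j) \<noteq> 0"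
    proof
      assume "orient (p k) (p b) (p j) = 0"
      then have "b = Suc k" "j = Suc b" "b \<in> M" using zero_iff[OF b j] k by auto
      then have "p b \<in> open_segment (p k) (p j)" using between[of k] k j by auto
      then show False using k b by auto
    qed
  qed
qed

section \<open>Cutting the hull of a chain at an apex\<close>

lemma chain_cut_sides:
  assumes "i < k" "k < j" "j \<le> n"
  shows "z \<in> H i k \<Longrightarrow> orient (p i) (p k) z \<le> 0"
    and "z \<in> H k j \<Longrightarrow> 0 \<le> orient (p i) (p k) z"
    and "z \<in> H k j \<Longrightarrow> orient (p k) (p j) z \<le> 0"
    and "z \<in> H i k \<Longrightarrow> 0 \<le> orient (p k) (p j) z"
    and "z \<in> H i j \<Longrightarrow> 0 \<le> orient (p i) z (p j)"
proof -
  have ge: "0 \<le> orient (p a) (p b) (p c)" if "a \<le> b" "b \<le> c" "c \<le> n" for a b c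
  proof (cases "a = b \<or> b = c")
    case False
    then show ?thesis using that by (intro nonneg) auto
  qed auto
  show "z \<in> H i k \<Longrightarrow> orient (p i) (p k) z \<le> 0"
    using ge[of i _ k] assms by (elim orient_convex_hull(2)[rotated]) (auto simp: orient_swap'[of "p i" "p k"])
  show "z \<in> H k j \<Longrightarrow> 0 \<le> orient (p i) (p k) z"
    using ge[of i k] assms by (elim orient_convex_hull(1)[rotated]) auto
  show "z \<in> H k j \<Longrightarrow> orient (p k) (p j) z \<le> 0"
    using ge[of k _ j] assms by (elim orient_convex_hull(2)[rotated]) (auto simp: orient_swap'[of "p k" "p j"])
  show "z \<in> H i k \<Longrightarrow> 0 \<le> orient (p k) (p j) z"
    using ge[of _ k j] assms by (elim orient_convex_hull(1)[rotated]) (auto simp: orient_rotate)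
  have "0 \<le> orient (p j) (p i) z" if "z \<in> H i j"
    using ge[of i _ j] assms that by (elim orient_convex_hull(1)[rotated]) (auto simp: orient_rotate[symmetric, of "p j" "p i"])
  then show "z \<in> H i j \<Longrightarrow> 0 \<le> orient (p i) z (p j)"
    by (simp add: orient_rotate[symmetric, of "p j" "p i"])
qed

text \<open>A common point lies on both lines through \<open>p k\<close>, so its barycentric
  coordinates at \<open>p i\<close> and \<open>p j\<close> vanish.\<close>

lemma hull_Int:
  assumes "i < k" "k < j" "j \<le> n" "orient (p i) (p k) (p j) \<noteq> 0"
  shows "H i k \<inter> H k j \<subseteq> {p k}"
proof
  fix z assume z: "z \<in> H i k \<inter> H k j"
  have "orient (p i) (p k) z = 0" "orient (p k) (p j) z = 0"
    using chain_cut_sides(1-4)[OF assms(1-3), of z] z by auto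
  then show "z \<in> {p k}"
    using orient_barycentric'[OF assms(4), of z] orient_rotate[of "p k" "p j" z] by simp
qed

text \<open>On the line, \<open>c\<close> is an affine combination of \<open>p i\<close> and
  \<open>p k\<close>. The coefficient at \<open>p k\<close> is nonnegative because \<open>c\<close>
  is on the inner side of the base; the one at \<open>p i\<close> because the line through
  \<open>p (k - 1)\<close> and \<open>p k\<close> supports the whole hull.\<close>

lemma cut_left:
  assumes ik: "i < k" "k < j" "j \<le> n" and o: "0 < orient (p i) (p k) (p j)"
    and strict: "\<And>b. i < b \<Longrightarrow> b < k \<Longrightarrow> 0 < orient (p i) (p b) (p k)"
    and k': "Suc i < k" and c: "c \<in> H i j" "orient (p i) (p k) c = 0"
  shows "c \<in> closed_segment (p i) (p k)"
proof -
  define u v where "u = orient c (p k) (p j) / orient (p i) (p k) (p j)"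
    and "v = orient (p i) c (p j) / orient (p i) (p k) (p j)"
  have c_eq: "c = u *\<^sub>R p i + v *\<^sub>R p k" "u + v = 1"
    using orient_barycentric'[of "p i" "p k" "p j" c] o c(2) by (simp_all add: u_def v_def)
  have v: "0 \<le> v" unfolding v_def using chain_cut_sides(5)[OF ik c(1)] o by simp
  have "0 \<le> orient (p (k - 1)) (p k) c"
  proof (rule orient_convex_hull(1)[OF _ c(1)])
    fix y assume "y \<in> P i j"
    then obtain t where t: "t \<in> {i..j}" "y = p t" by auto
    consider "t < k - 1" | "t = k - 1 \<or> t = k" | "k < t" using t by linarith
    then show "0 \<le> orient (p (k - 1)) (p k) y"
    proof cases
      case 1
      then have "0 \<le> orient (p t) (p (k - 1)) (p k)" using ik k' by (intro nonneg) auto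
      then show ?thesis using t by (simp add: orient_rotate)
    next
      case 2
      then show ?thesis using t by auto
    next
      case 3
      then show ?thesis unfolding t(2) using ik k' t by (intro nonneg) auto
    qed
  qed
  also have "orient (p (k - 1)) (p k) c = u * orient (p (k - 1)) (p k) (p i)"
    unfolding c_eq(1) by (subst orient_affine[OF c_eq(2)]) simp
  finally have "0 \<le> u * orient (p i) (p (k - 1)) (p k)" by (simp add: orient_rotate)
  moreover have "0 < orient (p i) (p (k - 1)) (p k)" using k' by (intro strict) auto
  ultimately have "0 \<le> u" by (simp add: zero_le_mult_iff)
  moreover have "u = 1 - v" using c_eq(2) by simp
  ultimately show ?thesis using v c_eq unfolding in_segment by (intro exI[of _ v]) auto
qed

lemma cut_right:
  assumes ik: "i < k" "k < j" "j \<le> n" and o: "0 < orient (p i) (p k) (p j)"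
    and strict: "\<And>b. k < b \<Longrightarrow> b < j \<Longrightarrow> 0 < orient (p k) (p b) (p j)"
    and k': "Suc k < j" and c: "c \<in> H i j" "orient (p k) (p j) c = 0"
  shows "c \<in> closed_segment (p k) (p j)"
proof -
  define v w where "v = orient (p i) c (p j) / orient (p i) (p k) (p j)"
    and "w = orient (p i) (p k) c / orient (p i) (p k) (p j)"
  have c_eq: "c = v *\<^sub>R p k + w *\<^sub>R p j" "v + w = 1"
    using orient_barycentric'[of "p i" "p k" "p j" c] o c(2) orient_rotate[of "p k" "p j" c]
    by (simp_all add: w_def v_def)
  have v: "0 \<le> v" unfolding v_def using chain_cut_sides(5)[OF ik c(1)] o by simp
  have "0 \<le> orient (p k) (p (Suc k)) c"
  proof (rule orient_convex_hull(1)[OF _ c(1)])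
    fix y assume "y \<in> P i j"
    then obtain t where t: "t \<in> {i..j}" "y = p t" by auto
    consider "t < k" | "t = k \<or> t = Suc k" | "Suc k < t" using t by linarith
    then show "0 \<le> orient (p k) (p (Suc k)) y"
    proof cases
      case 1
      then have "0 \<le> orient (p t) (p k) (p (Suc k))" using ik k' by (intro nonneg) auto
      then show ?thesis using t by (simp add: orient_rotate[of "p k" "p (Suc k)" "p t"])
    next
      case 2
      then show ?thesis using t by auto
    next
      case 3
      then show ?thesis unfolding t(2) using ik k' t by (intro nonneg) auto
    qed
  qed
  also have "orient (p k) (p (Suc k)) c = w * orient (p k) (p (Suc k)) (p j)"
    unfolding c_eq(1) by (subst orient_affine[OF c_eq(2)]) simp
  finally have "0 \<le> w"
    using strict[of "Suc k"] k' by (simp add: zero_le_mult_iff)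
  moreover have "v = 1 - w" using c_eq(2) by simp
  ultimately show ?thesis using v c_eq unfolding in_segment by (intro exI[of _ w]) auto
qed

end

text \<open>The map \<open>orient a b\<close> is affine along the segment; \<open>c\<close> is its
  zero, at the parameter \<open>\<tau>\<close>, and the points of the segment with negative value
  are those before it.\<close>

lemma orient_crossing:
  assumes "x \<in> closed_segment y z" "orient a b x < 0" "0 \<le> orient a b z"
  obtains c where "c \<in> closed_segment y z" "orient a b c = 0" "x \<in> closed_segment y c"
proof -
  obtain t where t: "0 \<le> t" "t \<le> 1" "x = (1 - t) *\<^sub>R y + t *\<^sub>R z" using assms(1) unfolding in_segment by blast
  have ox: "(1 - t) * orient a b y + t * orient a b z < 0"
    using assms(2) unfolding t(3) by (simp add: orient_affine)
  have oy: "orient a b y < 0"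
  proof (rule ccontr)
    assume "\<not> orient a b y < 0"
    then have "0 \<le> (1 - t) * orient a b y + t * orient a b z" using t assms(3) by simp
    with ox show False by simp
  qed
  define d where "d = orient a b z - orient a b y"
  have d: "d > 0" using oy assms(3) by (simp add: d_def)
  define \<tau> where "\<tau> = - orient a b y / d"
  have \<tau>: "0 < \<tau>" "\<tau> \<le> 1" using oy d assms(3) by (auto simp: \<tau>_def d_def divide_simps)
  have "\<tau> * d = - orient a b y" using d by (simp add: \<tau>_def)
  then have "t * d < \<tau> * d" using ox by (simp add: d_def algebra_simps)
  then have t\<tau>: "t < \<tau>" using d by simp
  define c where "c = (1 - \<tau>) *\<^sub>R y + \<tau> *\<^sub>R z"
  have 1: "c \<in> closed_segment y z" unfolding c_def in_segment using \<tau> by (intro exI[of _ \<tau>]) auto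
  have "orient a b c = (1 - \<tau>) * orient a b y + \<tau> * orient a b z" unfolding c_def by (rule orient_affine) simp
  also have "\<dots> = orient a b y + \<tau> * d" by (simp add: d_def algebra_simps)
  finally have "orient a b c = orient a b y + \<tau> * d" .
  then have 2: "orient a b c = 0" using d by (simp add: \<tau>_def)
  define r where "r = t / \<tau>"
  have r: "r * \<tau> = t" using \<tau>(1) by (simp add: r_def)
  have "(1 - r) *\<^sub>R y + r *\<^sub>R c = (1 - r * \<tau>) *\<^sub>R y + (r * \<tau>) *\<^sub>R z"
    unfolding c_def by (simp add: algebra_simps)
  then have "x = (1 - t / \<tau>) *\<^sub>R y + (t / \<tau>) *\<^sub>R c"
    unfolding r t(3) by (simp add: r_def)
  then have 3: "x \<in> closed_segment y c" unfolding in_segment using t \<tau> t\<tau> by (intro exI[of _ "t / \<tau>"]) auto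
  show thesis by (rule that[OF 1 2 3])
qed

lemma empty_triangle_subset:
  "empty_triangle P a b c \<Longrightarrow> P' \<subseteq> P \<Longrightarrow> {a, b, c} \<subseteq> P' \<Longrightarrow> empty_triangle P' a b c"
  unfolding empty_triangle_def by blast

context chain
begin

text \<open>A point of the hull lies on a segment from one piece to the other. If it is beyond a
  cutting line, the segment meets that line within the cut by \<open>cut_left\<close> or
  \<open>cut_right\<close>, and the part up to there stays in the convex piece.\<close>

lemma hull_cover:
  assumes ik: "i < k" "k < j" "j \<le> n" and o: "0 < orient (p i) (p k) (p j)"
    and strict: "\<And>b. i < b \<Longrightarrow> b < k \<Longrightarrow> 0 < orient (p i) (p b) (p k)"
      "\<And>b. k < b \<Longrightarrow> b < j \<Longrightarrow> 0 < orient (p k) (p b) (p j)"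
  shows "H i j = H i k \<union> tri i k j \<union> H k j"
proof
  show "H i k \<union> tri i k j \<union> H k j \<subseteq> H i j"
    using H_mono[of i i k j] H_mono[of i k j j] tri_subset_H[of i i k j j] ik by auto
  show "H i j \<subseteq> H i k \<union> tri i k j \<union> H k j"
  proof
    fix x assume x: "x \<in> H i j"
    have PU: "P i j = P i k \<union> P k j"
      unfolding image_Un[symmetric] using ik by (intro arg_cong[of _ _ "\<lambda>A. p ` A"]) auto
    have "H i j = convex hull (H i k \<union> H k j)" unfolding PU by (rule hull_Un) (simp add: convex_Inter)
    also have "\<dots> = {u *\<^sub>R s + v *\<^sub>R t | u v s t. u \<ge> 0 \<and> v \<ge> 0 \<and> u + v = 1 \<and> s \<in> H i k \<and> t \<in> H k j}"
      by (rule convex_hull_union_two) (use ik in auto)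
    finally obtain u v y z where yz: "y \<in> H i k" "z \<in> H k j" and uv: "0 \<le> u" "0 \<le> v" "u + v = 1" "x = u *\<^sub>R y + v *\<^sub>R z"
      using x by blast
    have "u = 1 - v" using uv by simp
    then have xs: "x \<in> closed_segment y z" unfolding in_segment using uv by (intro exI[of _ v]) auto
    have sub: "closed_segment y z \<subseteq> H i j"
      using yz H_mono[of i i k j] H_mono[of i k j j] ik by (intro closed_segment_subset) auto
    note y = chain_cut_sides(1,4)[OF ik yz(1)] and z = chain_cut_sides(2,3)[OF ik yz(2)]
    consider "orient (p i) (p k) x < 0" | "orient (p k) (p j) x < 0"
      | "0 \<le> orient (p i) (p k) x" "0 \<le> orient (p k) (p j) x" by linarith
    then show "x \<in> H i k \<union> tri i k j \<union> H k j"
    proof cases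
      case 1
      obtain c where c: "c \<in> closed_segment y z" "orient (p i) (p k) c = 0" "x \<in> closed_segment y c"
        using orient_crossing[OF xs 1 z(1)] .
      \<comment> \<open>For \<open>k = Suc i\<close> the piece is a segment on the cutting line, and
        mixing its points with \<open>z\<close> never leads to the negative side.\<close>
      have "Suc i < k"
      proof (rule ccontr)
        assume "\<not> Suc i < k"
        then have "{i..k} = {i, k}" using ik by auto
        then have "orient (p i) (p k) y = 0"
          using yz(1) orient_closed_segment by (simp add: segment_convex_hull)
        moreover have "0 \<le> u * orient (p i) (p k) y + v * orient (p i) (p k) z"
          using uv z calculation by simp
        ultimately show False using 1 uv by (simp add: orient_affine)
      qed
      then have "c \<in> closed_segment (p i) (p k)"
        using cut_left[OF ik o strict(1)] c sub by blast
      also have "\<dots> \<subseteq> H i k" using ik by (intro closed_segment_subset p_in_H) auto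
      finally have "closed_segment y c \<subseteq> H i k" using yz by (intro closed_segment_subset) auto
      then show ?thesis using c by auto
    next
      case 2
      have xs': "x \<in> closed_segment z y" using xs by (simp add: closed_segment_commute)
      obtain c where c: "c \<in> closed_segment z y" "orient (p k) (p j) c = 0" "x \<in> closed_segment z c"
        using orient_crossing[OF xs' 2 y(2)] .
      have "Suc k < j"
      proof (rule ccontr)
        assume "\<not> Suc k < j"
        then have "{k..j} = {k, j}" using ik by auto
        then have "orient (p k) (p j) z = 0"
          using yz(2) orient_closed_segment by (simp add: segment_convex_hull)
        moreover have "0 \<le> u * orient (p k) (p j) y + v * orient (p k) (p j) z"
          using uv y calculation by simp
        ultimately show False using 2 uv by (simp add: orient_affine)
      qed
      then have "c \<in> closed_segment (p k) (p j)"
        using cut_right[OF ik o strict(2)] c sub by (auto simp: closed_segment_commute)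
      also have "\<dots> \<subseteq> H k j" using ik by (intro closed_segment_subset p_in_H) auto
      finally have "closed_segment z c \<subseteq> H k j" using yz by (intro closed_segment_subset) auto
      then show ?thesis using c by auto
    next
      case 3
      then show ?thesis
        using chain_cut_sides(5)[OF ik x] by (auto simp: in_triangle_iff[OF o] orient_rotate[of "p k" "p j" x])
    qed
  qed
qed

text \<open>
  A single segment counts as a polygon with exactly one (empty) dissection.
\<close>

definition dissections :: "nat \<Rightarrow> nat \<Rightarrow> (real^2) set set set" where
  "dissections i j = (if j = Suc i then {{}} else {\<T>. triangle_dissection (P i j) \<T>})"

lemma dissections_tri:
  assumes "\<T> \<in> dissections i j" "T \<in> \<T>" "j \<le> n"
  obtains a b c where "etri i j a b c" "T = tri a b c"
  using assms dissectionD(4)[of i j \<T> T] by (auto simp: dissections_def split: if_splits)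

lemma dissections_face:
  assumes "\<T> \<in> dissections i j" "T \<in> \<T>" "T' \<in> \<T>" "j \<le> n"
  shows "(T \<inter> T') face_of T"
  using assms dissectionD(3)[of i j \<T> T T'] by (auto simp: dissections_def split: if_splits)

lemma dissections_finite:
  assumes "\<T> \<in> dissections i j" "j \<le> n"
  shows "finite \<T>"
  using assms dissectionD(1)[of i j \<T>] by (auto simp: dissections_def split: if_splits)

lemma dissections_subset:
  assumes "\<T> \<in> dissections i j" "T \<in> \<T>" "j \<le> n"
  shows "T \<subseteq> H i j"
proof -
  obtain a b c where "etri i j a b c" "T = tri a b c" using dissections_tri[OF assms] .
  then show ?thesis using tri_subset_H[of i a b c j] by (simp add: etri_def)
qed

lemma etri_shrink:
  assumes "etri i j a b c" "i \<le> i'" "j' \<le> j" "i' \<le> a" "c \<le> j'"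
  shows "etri i' j' a b c"
proof -
  have e: "i \<le> a" "a < b" "b < c" "c \<le> j" "empty_triangle (P i j) (p a) (p b) (p c)"
    using assms(1) by (simp_all add: etri_def)
  have "empty_triangle (P i' j') (p a) (p b) (p c)"
    by (rule empty_triangle_subset[OF e(5)]) (use assms(2-) e(2,3) in auto)
  then show ?thesis using assms(2-) e by (simp add: etri_def)
qed

lemma tri_not_singleton:
  assumes "a < b" "b < c" "c \<le> n"
  shows "\<not> tri a b c \<subseteq> {x}"
proof
  assume "tri a b c \<subseteq> {x}"
  from subsetD[OF this p_in_tri(1)] subsetD[OF this p_in_tri(2)] have "p a = p b" by simp
  then show False using assms by (simp add: p_eq_iff)
qed

text \<open>
  Points of the piece strictly on its side of the line are covered by triangles of the piece only; the
  remaining points of the piece are limits of such points, and finitely many triangles form a closed set.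
\<close>

lemma split_piece:
  assumes \<T>: "triangle_dissection (P i j) \<T>" and j: "j \<le> n"
    and i': "i \<le> i'" "i' < j'" "j' \<le> j"
    and piece: "\<And>a b c. etri i j a b c \<Longrightarrow> tri a b c \<in> \<T> \<Longrightarrow> tri a b c \<subseteq> H i' j' \<Longrightarrow> i' \<le> a \<and> c \<le> j'"
    and side: "\<And>T z. T \<in> \<T> \<Longrightarrow> \<not> T \<subseteq> H i' j' \<Longrightarrow> z \<in> T \<Longrightarrow> 0 \<le> orient u v z"
      "\<And>z. z \<in> H i' j' \<Longrightarrow> orient u v z \<le> 0"
    and strict: "Suc i' < j' \<Longrightarrow> orient u v (p (Suc i')) < 0"
  shows "{T \<in> \<T>. T \<subseteq> H i' j'} \<in> dissections i' j'"
proof -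
  let ?S = "{T \<in> \<T>. T \<subseteq> H i' j'}"
  have tri: "\<exists>a b c. etri i' j' a b c \<and> T = tri a b c" if T: "T \<in> ?S" for T
  proof -
    obtain a b c where e: "etri i j a b c" "T = tri a b c" using dissectionD(4)[OF \<T> j, of T] T by blast
    then have "i' \<le> a \<and> c \<le> j'" using T by (intro piece) auto
    with e show ?thesis using etri_shrink[OF e(1), of i' j'] i' by blast
  qed
  show ?thesis
  proof (cases "j' = Suc i'")
    case True
    have "?S = {}" using tri True unfolding etri_def by fastforce
    then show ?thesis using True by (simp add: dissections_def)
  next
    case False
    then have s: "orient u v (p (Suc i')) < 0" using strict i' by simp
    have cl: "closed (\<Union>?S)"
    proof (rule closed_Union)
      show "finite ?S" using dissectionD(1)[OF \<T> j] by simp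
      show "\<forall>T\<in>?S. closed T"
      proof
        fix T assume "T \<in> ?S"
        then obtain a b c where "T = tri a b c" using tri by blast
        then show "closed T" by (simp add: compact_imp_closed finite_imp_compact_convex_hull)
      qed
    qed
    have neg: "z \<in> \<Union>?S" if "z \<in> H i' j'" "orient u v z < 0" for z
    proof -
      have "z \<in> \<Union>\<T>" unfolding dissectionD(2)[OF \<T> j] using that(1) H_mono i' by blast
      then obtain T where "T \<in> \<T>" "z \<in> T" by blast
      then show ?thesis using side(1)[of T z] that(2) by force
    qed
    have "H i' j' \<subseteq> \<Union>?S"
    proof
      fix z assume z: "z \<in> H i' j'"
      show "z \<in> \<Union>?S"
      proof (cases "orient u v z < 0")
        case True
        with z neg show ?thesis by blast
      next
        case False
        then have zz: "z \<noteq> p (Suc i')" using s by auto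
        have "open_segment z (p (Suc i')) \<subseteq> \<Union>?S"
        proof
          fix w assume "w \<in> open_segment z (p (Suc i'))"
          then obtain t where t: "0 < t" "t < 1" "w = (1 - t) *\<^sub>R z + t *\<^sub>R p (Suc i')"
            unfolding in_segment by blast
          have "w \<in> H i' j'" unfolding t(3)
            using t i' by (intro convexD[OF convex_convex_hull z p_in_H]) auto
          moreover have "orient u v w = (1 - t) * orient u v z + t * orient u v (p (Suc i'))"
            unfolding t(3) by (rule orient_affine) simp
          moreover have "(1 - t) * orient u v z \<le> 0" using t side(2)[OF z] by (simp add: mult_nonneg_nonpos)
          moreover have "t * orient u v (p (Suc i')) < 0" using t s by (simp add: mult_pos_neg)
          ultimately show "w \<in> \<Union>?S" by (intro neg) linarith+
        qed
        then have "closure (open_segment z (p (Suc i'))) \<subseteq> \<Union>?S" by (rule closure_minimal[OF _ cl])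
        then show ?thesis using zz by auto
      qed
    qed
    then have cover: "\<Union>?S = H i' j'" by blast
    have "triangle_dissection (P i' j') ?S"
      unfolding dissection_iff[OF order_trans[OF i'(3) j]]
      using cover tri dissectionD(1,3)[OF \<T> j] by auto
    then show ?thesis using False by (simp add: dissections_def)
  qed
qed

text \<open>By non-crossing, each triangle except the one at the base belongs to one run of indices.
  Selecting by inclusion in a hull is unambiguous, as the two hulls meet at most in
  \<open>p k\<close>.\<close>

lemma dissection_split:
  assumes \<T>: "triangle_dissection (P i j) \<T>" and ij: "i + 2 \<le> j" "j \<le> n"
  obtains k where "i < k" "k < j" "0 < orient (p i) (p k) (p j)"
    "{T \<in> \<T>. T \<subseteq> H i k} \<in> dissections i k" "{T \<in> \<T>. T \<subseteq> H k j} \<in> dissections k j"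
    "\<T> = insert (tri i k j) ({T \<in> \<T>. T \<subseteq> H i k} \<union> {T \<in> \<T>. T \<subseteq> H k j})"
proof -
  obtain k where k: "i < k" "k < j" and e0: "etri i j i k j" and T0: "tri i k j \<in> \<T>"
    using base_triangle[OF \<T> ij] .
  have o: "0 < orient (p i) (p k) (p j)" by (rule etri_orient[OF e0 ij(2)])
  note ik = k ij(2)
  have Int: "H i k \<inter> H k j \<subseteq> {p k}" by (rule hull_Int[OF ik]) (use o in simp)
  have notk: "p j \<notin> H i k" "p i \<notin> H k j"
  proof -
    have "p j \<in> H k j" "p i \<in> H i k" using k by (auto intro!: p_in_H)
    moreover have "p j \<noteq> p k" "p i \<noteq> p k" using k ij by (auto simp: p_eq_iff)
    ultimately show "p j \<notin> H i k" "p i \<notin> H k j" using Int by auto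
  qed
  have cls: "c \<le> k \<and> tri a b c \<subseteq> H i k \<or> k \<le> a \<and> tri a b c \<subseteq> H k j"
    if e: "etri i j a b c" and T: "tri a b c \<in> \<T>" and ne: "tri a b c \<noteq> tri i k j" for a b c
    using dissection_classify[OF \<T> ij(2) k e0 T0 T e ne] e tri_subset_H[of i a b c k] tri_subset_H[of k a b c j]
    by (auto simp: etri_def)
  have T0_sides: "0 \<le> orient (p i) (p k) z" "0 \<le> orient (p k) (p j) z" if "z \<in> tri i k j" for z
    using that by (auto simp: in_triangle_iff[OF o] orient_rotate[of "p k" "p j" z])
  have disj: "\<not> tri a b c \<subseteq> H i k" if "etri i j a b c" "tri a b c \<subseteq> H k j" for a b c
    using tri_not_singleton[of a b c "p k"] that Int ij by (auto simp: etri_def)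
  have left: "{T \<in> \<T>. T \<subseteq> H i k} \<in> dissections i k"
  proof (rule split_piece[OF \<T> ij(2), where u = "p i" and v = "p k"])
    fix a b c assume e: "etri i j a b c" and T: "tri a b c \<in> \<T>" "tri a b c \<subseteq> H i k"
    have "tri a b c \<noteq> tri i k j" using T(2) notk p_in_tri(3)[of j i k] by auto
    with cls[OF e T(1)] disj[OF e] T(2) show "i \<le> a \<and> c \<le> k" using e by (auto simp: etri_def)
  next
    fix T z assume T: "T \<in> \<T>" "\<not> T \<subseteq> H i k" "z \<in> T"
    obtain a b c where e: "etri i j a b c" "T = tri a b c" using dissectionD(4)[OF \<T> ij(2) T(1)] by blast
    show "0 \<le> orient (p i) (p k) z"
    proof (cases "T = tri i k j")
      case False
      then have "T \<subseteq> H k j" using cls[OF e(1)] e(2) T by auto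
      then show ?thesis using chain_cut_sides(2)[OF ik] T by blast
    qed (use T0_sides T in blast)
  next
    assume "Suc i < k"
    then show "orient (p i) (p k) (p (Suc i)) < 0"
      using etri_strict(1)[OF e0 ij(2), of "Suc i"] by (simp add: orient_swap'[of "p i" "p k"])
  qed (use ik chain_cut_sides(1)[OF ik] in auto)
  have right: "{T \<in> \<T>. T \<subseteq> H k j} \<in> dissections k j"
  proof (rule split_piece[OF \<T> ij(2), where u = "p k" and v = "p j"])
    fix a b c assume e: "etri i j a b c" and T: "tri a b c \<in> \<T>" "tri a b c \<subseteq> H k j"
    have "tri a b c \<noteq> tri i k j" using T(2) notk p_in_tri(1)[of i k j] by auto
    with cls[OF e T(1)] disj[OF e] T(2) show "k \<le> a \<and> c \<le> j" using e by (auto simp: etri_def)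
  next
    fix T z assume T: "T \<in> \<T>" "\<not> T \<subseteq> H k j" "z \<in> T"
    obtain a b c where e: "etri i j a b c" "T = tri a b c" using dissectionD(4)[OF \<T> ij(2) T(1)] by blast
    show "0 \<le> orient (p k) (p j) z"
    proof (cases "T = tri i k j")
      case False
      then have "T \<subseteq> H i k" using cls[OF e(1)] e(2) T by auto
      then show ?thesis using chain_cut_sides(4)[OF ik] T by blast
    qed (use T0_sides T in blast)
  next
    assume "Suc k < j"
    then show "orient (p k) (p j) (p (Suc k)) < 0"
      using etri_strict(2)[OF e0 ij(2), of "Suc k"] by (simp add: orient_swap'[of "p k" "p j"])
  qed (use ik chain_cut_sides(3)[OF ik] in auto)
  have "T = tri i k j \<or> T \<subseteq> H i k \<or> T \<subseteq> H k j" if T: "T \<in> \<T>" for T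
  proof -
    obtain a b c where e: "etri i j a b c" "T = tri a b c" using dissectionD(4)[OF \<T> ij(2) T] by blast
    then show ?thesis using cls[OF e(1)] T by auto
  qed
  then have "\<T> = insert (tri i k j) ({T \<in> \<T>. T \<subseteq> H i k} \<union> {T \<in> \<T>. T \<subseteq> H k j})"
    using T0 by blast
  with k o left right show thesis by (rule that)
qed

end

section \<open>Gluing dissections of two pieces to a base triangle\<close>

text \<open>A line separates the triangles, so they meet only on it. There the first triangle is the
  hull of its vertices on the line, all of which are also vertices of the second.\<close>

lemma triangles_common_face:
  assumes ne: "orient x y z \<noteq> 0" "orient x' y' z' \<noteq> 0"
    and le: "\<And>w. w \<in> {x, y, z} \<Longrightarrow> orient u v w \<le> 0"
    and ge: "\<And>w. w \<in> {x', y', z'} \<Longrightarrow> 0 \<le> orient u v w"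
    and sub: "\<And>w. w \<in> {x, y, z} \<Longrightarrow> orient u v w = 0 \<Longrightarrow> w \<in> {x', y', z'}"
  shows "(convex hull {x, y, z} \<inter> convex hull {x', y', z'}) face_of (convex hull {x, y, z})"
    "(convex hull {x', y', z'} \<inter> convex hull {x, y, z}) face_of (convex hull {x', y', z'})"
proof -
  define C where "C = {w \<in> {x, y, z}. orient u v w = 0}"
  have C: "C \<subseteq> {x, y, z}" "C \<subseteq> {x', y', z'}" unfolding C_def using sub by blast+
  have "convex hull {x, y, z} \<inter> convex hull {x', y', z'} = convex hull C"
  proof
    show "convex hull C \<subseteq> convex hull {x, y, z} \<inter> convex hull {x', y', z'}"
      using hull_mono[OF C(1), of convex] hull_mono[OF C(2), of convex] by (rule Int_greatest)
    show "convex hull {x, y, z} \<inter> convex hull {x', y', z'} \<subseteq> convex hull C"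
    proof
      fix w assume w: "w \<in> convex hull {x, y, z} \<inter> convex hull {x', y', z'}"
      have "orient u v w \<le> 0" by (rule orient_convex_hull(2)[of "{x, y, z}"]) (use w le in auto)
      moreover have "0 \<le> orient u v w" by (rule orient_convex_hull(1)[of "{x', y', z'}"]) (use w ge in auto)
      ultimately show "w \<in> convex hull C"
        unfolding C_def using w le by (intro orient_face_hull) auto
    qed
  qed
  then show "(convex hull {x, y, z} \<inter> convex hull {x', y', z'}) face_of (convex hull {x, y, z})"
    "(convex hull {x', y', z'} \<inter> convex hull {x, y, z}) face_of (convex hull {x', y', z'})"
    unfolding Int_commute[of "convex hull {x', y', z'}"] triangle_face_iff[OF ne(1)] triangle_face_iff[OF ne(2)]
    using C by blast+
qed

text \<open>The sides stay in the hull of \<open>Q\<close>, where \<open>R\<close> has no new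
  points.\<close>

lemma empty_triangle_extend:
  assumes "empty_triangle Q a b c" "Q \<subseteq> R" and hull: "\<And>w. w \<in> R \<Longrightarrow> w \<in> convex hull Q \<Longrightarrow> w \<in> Q"
  shows "empty_triangle R a b c"
proof -
  note Q = assms(1)[unfolded empty_triangle_def]
  have "open_segment x y \<inter> R \<subseteq> open_segment x y \<inter> Q" if "x \<in> Q" "y \<in> Q" for x y
  proof -
    have "closed_segment x y \<subseteq> convex hull Q" using that by (intro closed_segment_subset hull_inc) auto
    then show ?thesis using hull segment_open_subset_closed by blast
  qed
  then have "open_segment a b \<inter> R = {}" "open_segment b c \<inter> R = {}" "open_segment a c \<inter> R = {}"
    using Q by (metis insert_subset subset_empty)+
  then show ?thesis using Q assms(2) by (auto simp: empty_triangle_def)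
qed

context chain
begin

text \<open>Three collinear points have no dissection, because its base triangle would be
  degenerate. So the mere existence of a dissection of a piece provides the strict orientations
  needed for gluing.\<close>

lemma dissections_strict:
  assumes \<T>: "\<T> \<in> dissections i j" and b: "i < b" "b < j" and j: "j \<le> n" and nw: "i = 0 \<Longrightarrow> j \<noteq> n"
  shows "0 < orient (p i) (p b) (p j)"
proof (rule pos[OF b j], rule notI)
  assume "orient (p i) (p b) (p j) = 0"
  then have eq: "b = Suc i" "j = Suc b" using zero_iff[OF b j] nw by auto
  then have "triangle_dissection (P i j) \<T>" using \<T> by (simp add: dissections_def)
  then obtain k where k: "i < k" "k < j" "etri i j i k j"
    using base_triangle[of i j \<T>] eq j by auto
  then have "k = b" using eq by auto
  then show False using etri_orient[OF k(3) j] \<open>orient (p i) (p b) (p j) = 0\<close> by simp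
qed

text \<open>A further point on a side gives a collinear triple, and \<open>zero_iff\<close> leaves
  few of these. In each, the point known to lie between the other two is not the one supposed to lie
  inside the side, or the triangle itself is degenerate.\<close>

lemma etri_base:
  assumes ik: "i < k" "k < j" "j \<le> n" and o: "0 < orient (p i) (p k) (p j)"
    and strict: "\<And>b. i < b \<Longrightarrow> b < k \<Longrightarrow> 0 < orient (p i) (p b) (p k)"
      "\<And>b. k < b \<Longrightarrow> b < j \<Longrightarrow> 0 < orient (p k) (p b) (p j)"
  shows "etri i j i k j"
proof -
  have "p t \<notin> open_segment (p i) (p k)" if t: "t \<in> {i..j}" for t
  proof
    assume s: "p t \<in> open_segment (p i) (p k)"
    then have z: "orient (p i) (p k) (p t) = 0" by (rule orient_open_segment)
    have ne: "t \<noteq> i" "t \<noteq> k" using s by (auto simp: open_segment_def)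
    show False
    proof (cases "t < k")
      case True
      then show False using strict(1)[of t] z t ne orient_swap'[of "p i" "p t" "p k"] by auto
    next
      case False
      then have kt: "k < t" using ne by auto
      have "k = Suc i \<and> t = Suc k \<and> k \<in> M"
        using zero_iff[OF ik(1) kt] z t ik o by auto
      then have "p k \<in> open_segment (p i) (p t)" using between[of i] t ik by auto
      then show False using s open_segment_antisym by blast
    qed
  qed
  moreover have "p t \<notin> open_segment (p k) (p j)" if t: "t \<in> {i..j}" for t
  proof
    assume s: "p t \<in> open_segment (p k) (p j)"
    then have z: "orient (p k) (p j) (p t) = 0" by (rule orient_open_segment)
    have ne: "t \<noteq> k" "t \<noteq> j" using s by (auto simp: open_segment_def)
    show False
    proof (cases "k < t")
      case True
      then show False using strict(2)[of t] z t ne orient_swap'[of "p k" "p t" "p j"] by auto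
    next
      case False
      then have tk: "t < k" using ne by auto
      have "orient (p t) (p k) (p j) = 0" using z orient_rotate[of "p k" "p j" "p t"] by simp
      then have "k = Suc t \<and> j = Suc k \<and> k \<in> M"
        using zero_iff[OF tk ik(2,3)] t ik o by auto
      then have "p k \<in> open_segment (p j) (p t)" using between[of t] ik by (auto simp: open_segment_commute)
      then show False using s open_segment_antisym[of "p k" "p j" "p t"] by (simp add: open_segment_commute)
    qed
  qed
  moreover have "p t \<notin> open_segment (p i) (p j)" if t: "t \<in> {i..j}" for t
  proof
    assume s: "p t \<in> open_segment (p i) (p j)"
    have ne: "t \<noteq> i" "t \<noteq> j" using s by (auto simp: open_segment_def)
    have "orient (p i) (p j) (p t) = 0" using s by (rule orient_open_segment)
    then have z: "orient (p i) (p t) (p j) = 0" using orient_swap'[of "p i" "p t" "p j"] by simp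
    have it: "i < t" "t < j" using t ne by auto
    consider "t = Suc i" "j = Suc t" | "i = 0" "t = n - 1" "j = n" using zero_iff[OF it ik(3)] z by auto
    then show False
    proof cases
      case 1
      then have "t = k" using ik by auto
      then show False using o z by simp
    next
      case 2
      then show False using between_wrap s open_segment_antisym by auto
    qed
  qed
  ultimately show ?thesis using ik o unfolding etri_def empty_triangle_def by auto
qed

text \<open>The face condition holds within each piece. Between the base triangle and a piece it
  follows from separation by the cutting line; triangles of different pieces share at most
  \<open>p k\<close>, which is a vertex of both whenever they meet.\<close>

lemma dissection_glue:
  assumes ik: "i < k" "k < j" "j \<le> n" and o: "0 < orient (p i) (p k) (p j)"
    and A: "A \<in> dissections i k" and B: "B \<in> dissections k j"
  shows "triangle_dissection (P i j) (insert (tri i k j) (A \<union> B))"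
proof -
  have kn: "k \<le> n" using ik by simp
  have strict1: "0 < orient (p i) (p b) (p k)" if "i < b" "b < k" for b
    by (rule dissections_strict[OF A that kn]) (use ik in auto)
  have strict2: "0 < orient (p k) (p b) (p j)" if "k < b" "b < j" for b
    by (rule dissections_strict[OF B that ik(3)]) (use ik in auto)
  have e0: "etri i j i k j" by (rule etri_base[OF ik o strict1 strict2])
  have Int: "H i k \<inter> H k j \<subseteq> {p k}" by (rule hull_Int[OF ik]) (use o in simp)
  have eA: "etri i j a b c" if e: "etri i k a b c" for a b c
  proof -
    have "empty_triangle (P i j) (p a) (p b) (p c)"
    proof (rule empty_triangle_extend)
      show "empty_triangle (P i k) (p a) (p b) (p c)" using e by (simp add: etri_def)
      show "P i k \<subseteq> P i j" using ik by (intro image_mono) auto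
      fix v assume v: "v \<in> P i j" "v \<in> H i k"
      then obtain t where t: "t \<in> {i..j}" "v = p t" by blast
      show "v \<in> P i k"
      proof (rule ccontr)
        assume w: "v \<notin> P i k"
        have "\<not> t \<le> k" using w t by auto
        then have "v \<in> H k j" using t by (auto intro: p_in_H)
        then have "v = p k" using Int v(2) by blast
        then show False using w ik by auto
      qed
    qed
    then show ?thesis using e ik by (simp add: etri_def)
  qed
  have eB: "etri i j a b c" if e: "etri k j a b c" for a b c
  proof -
    have "empty_triangle (P i j) (p a) (p b) (p c)"
    proof (rule empty_triangle_extend)
      show "empty_triangle (P k j) (p a) (p b) (p c)" using e by (simp add: etri_def)
      show "P k j \<subseteq> P i j" using ik by (intro image_mono) auto
      fix v assume v: "v \<in> P i j" "v \<in> H k j"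
      then obtain t where t: "t \<in> {i..j}" "v = p t" by blast
      show "v \<in> P k j"
      proof (rule ccontr)
        assume w: "v \<notin> P k j"
        have "\<not> k \<le> t" using w t by auto
        then have "v \<in> H i k" using t by (auto intro: p_in_H)
        then have "v = p k" using Int v(2) by blast
        then show False using w ik by auto
      qed
    qed
    then show ?thesis using e ik by (simp add: etri_def)
  qed
  have T0A: "(T \<inter> tri i k j) face_of T" "(tri i k j \<inter> T) face_of tri i k j" if T: "T \<in> A" for T
  proof -
    obtain a b c where e: "etri i k a b c" and Teq: "T = tri a b c" using dissections_tri[OF A T kn] .
    have abc: "i \<le> a" "a < b" "b < c" "c \<le> k" using e by (simp_all add: etri_def)
    have P: "{p a, p b, p c} \<subseteq> P i k" using abc by auto
    have line: "t = i \<or> t = k" if "t \<in> {i..k}" "orient (p i) (p k) (p t) = 0" for t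
      using strict1[of t] that orient_swap'[of "p i" "p t" "p k"] by force
    have o2: "0 \<le> orient (p i) (p k) w" if "w \<in> {p i, p k, p j}" for w
      using that o by auto
    have o1: "orient (p i) (p k) w \<le> 0" if "w \<in> {p a, p b, p c}" for w
      using that P by (intro chain_cut_sides(1)[OF ik] hull_inc) auto
    have o3: "w \<in> {p i, p k, p j}" if "w \<in> {p a, p b, p c}" "orient (p i) (p k) w = 0" for w
    proof -
      from subsetD[OF P that(1)] obtain t where "t \<in> {i..k}" "w = p t" by auto
      then show ?thesis using line[of t] that(2) by auto
    qed
    show "(T \<inter> tri i k j) face_of T" "(tri i k j \<inter> T) face_of tri i k j"
      unfolding Teq
      by (rule triangles_common_face[of "p a" "p b" "p c" "p i" "p k" "p j" "p i" "p k"],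
          use etri_orient[OF e kn] in simp, use o in simp, erule o1, erule o2, erule (1) o3)+
  qed
  have T0B: "(T \<inter> tri i k j) face_of T" "(tri i k j \<inter> T) face_of tri i k j" if T: "T \<in> B" for T
  proof -
    obtain a b c where e: "etri k j a b c" and Teq: "T = tri a b c" using dissections_tri[OF B T ik(3)] .
    have abc: "k \<le> a" "a < b" "b < c" "c \<le> j" using e by (simp_all add: etri_def)
    have P: "{p a, p b, p c} \<subseteq> P k j" using abc by auto
    have line: "t = k \<or> t = j" if "t \<in> {k..j}" "orient (p k) (p j) (p t) = 0" for t
      using strict2[of t] that orient_swap'[of "p k" "p t" "p j"] by force
    have o2: "0 \<le> orient (p k) (p j) w" if "w \<in> {p i, p k, p j}" for w
      using that o orient_rotate[of "p k" "p j" "p i"] by auto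
    have o1: "orient (p k) (p j) w \<le> 0" if "w \<in> {p a, p b, p c}" for w
      using that P by (intro chain_cut_sides(3)[OF ik] hull_inc) auto
    have o3: "w \<in> {p i, p k, p j}" if "w \<in> {p a, p b, p c}" "orient (p k) (p j) w = 0" for w
    proof -
      from subsetD[OF P that(1)] obtain t where "t \<in> {k..j}" "w = p t" by auto
      then show ?thesis using line[of t] that(2) by auto
    qed
    show "(T \<inter> tri i k j) face_of T" "(tri i k j \<inter> T) face_of tri i k j"
      unfolding Teq
      by (rule triangles_common_face[of "p a" "p b" "p c" "p i" "p k" "p j" "p k" "p j"],
          use etri_orient[OF e ik(3)] in simp, use o in simp, erule o1, erule o2, erule (1) o3)+
  qed
  have AB: "(T \<inter> T') face_of T" "(T' \<inter> T) face_of T'" if T: "T \<in> A" "T' \<in> B" for T T'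
  proof -
    obtain a b c where e: "etri i k a b c" and Teq: "T = tri a b c" using dissections_tri[OF A T(1) kn] .
    obtain a' b' c' where e': "etri k j a' b' c'" and Teq': "T' = tri a' b' c'" using dissections_tri[OF B T(2) ik(3)] .
    have sub: "T \<inter> T' \<subseteq> {p k}"
      using dissections_subset[OF A T(1) kn] dissections_subset[OF B T(2) ik(3)] Int by blast
    have "T \<inter> T' = {} \<or> T \<inter> T' = {p k}" using sub by blast
    moreover have "{p k} face_of T" if "p k \<in> T"
    proof -
      have "k \<in> {a, b, c}" using etri_vertices[OF e kn, of k] that ik by (simp add: Teq)
      then show ?thesis
        using etri_orient[OF e kn] unfolding Teq face_of_singleton by (subst triangle_extreme_iff) auto
    qed
    moreover have "{p k} face_of T'" if "p k \<in> T'"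
    proof -
      have "k \<in> {a', b', c'}" using etri_vertices[OF e' ik(3), of k] that ik by (simp add: Teq')
      then show ?thesis
        using etri_orient[OF e' ik(3)] unfolding Teq' face_of_singleton by (subst triangle_extreme_iff) auto
    qed
    moreover have "p k \<in> T" "p k \<in> T'" if "T \<inter> T' = {p k}" using that by blast+
    ultimately show "(T \<inter> T') face_of T" "(T' \<inter> T) face_of T'"
      unfolding Int_commute[of T' T] by (metis empty_face_of)+
  qed
  have "\<Union>(insert (tri i k j) (A \<union> B)) = H i j"
  proof -
    have 1: "\<Union>A \<subseteq> H i k" "\<Union>B \<subseteq> H k j"
      using dissections_subset[OF A _ kn] dissections_subset[OF B _ ik(3)] by blast+
    \<comment> \<open>A piece that is a single segment has the empty dissection; as a side of the
      base triangle it is covered by that triangle.\<close>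
    have 2: "H i k \<subseteq> \<Union>A \<union> tri i k j"
    proof (cases "k = Suc i")
      case True
      then have "{i..k} = {i, k}" by auto
      then show ?thesis by (intro le_supI2 hull_mono) auto
    next
      case False
      then have "triangle_dissection (P i k) A" using A by (simp add: dissections_def)
      then have "\<Union>A = H i k" by (rule dissectionD(2)[OF _ kn])
      then show ?thesis by (intro le_supI1) simp
    qed
    have 3: "H k j \<subseteq> \<Union>B \<union> tri i k j"
    proof (cases "j = Suc k")
      case True
      then have "{k..j} = {k, j}" by auto
      then show ?thesis by (intro le_supI2 hull_mono) auto
    next
      case False
      then have "triangle_dissection (P k j) B" using B by (simp add: dissections_def)
      then have "\<Union>B = H k j" by (rule dissectionD(2)[OF _ ik(3)])
      then show ?thesis by (intro le_supI1) simp
    qed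
    have "H i j = H i k \<union> tri i k j \<union> H k j" by (rule hull_cover[OF ik o strict1 strict2])
    with 1 2 3 show ?thesis by (simp only: Union_insert Union_Un_distrib) blast
  qed
  moreover have "finite (insert (tri i k j) (A \<union> B))"
    using dissections_finite[OF A kn] dissections_finite[OF B ik(3)] by simp
  moreover have "\<exists>a b c. etri i j a b c \<and> T = tri a b c" if T: "T \<in> insert (tri i k j) (A \<union> B)" for T
  proof -
    consider "T = tri i k j" | "T \<in> A" | "T \<in> B" using T by blast
    then show ?thesis
    proof cases
      case 1
      with e0 show ?thesis by blast
    next
      case 2
      from dissections_tri[OF A this kn] obtain a b c where "etri i k a b c" "T = tri a b c" .
      with eA show ?thesis by blast
    next
      case 3
      from dissections_tri[OF B this ik(3)] obtain a b c where "etri k j a b c" "T = tri a b c" .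
      with eB show ?thesis by blast
    qed
  qed
  moreover have "(T \<inter> T') face_of T" if "T \<in> insert (tri i k j) (A \<union> B)" "T' \<in> insert (tri i k j) (A \<union> B)" for T T'
  proof -
    have T0: "(tri i k j \<inter> tri i k j) face_of tri i k j"
      unfolding Int_absorb by (rule face_of_refl) (rule convex_convex_hull)
    have "T = tri i k j \<or> T \<in> A \<or> T \<in> B" "T' = tri i k j \<or> T' \<in> A \<or> T' \<in> B"
      using that by blast+
    then show ?thesis
      using T0 T0A(1)[of T] T0A(2)[of T'] T0B(1)[of T] T0B(2)[of T'] AB(1)[of T T'] AB(2)[of T' T]
        dissections_face[OF A _ _ kn, of T T'] dissections_face[OF B _ _ ik(3), of T T']
      by metis
  qed
  ultimately show ?thesis unfolding dissection_iff[OF ik(3)] by blast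
qed

text \<open>The pieces can be read off from the glued dissection, which makes gluing injective for
  fixed \<open>k\<close>.\<close>

lemma dissection_glue_restrict:
  assumes ik: "i < k" "k < j" "j \<le> n" and o: "0 < orient (p i) (p k) (p j)"
    and A: "A \<in> dissections i k" and B: "B \<in> dissections k j"
  shows "p j \<notin> H i k" "p i \<notin> H k j"
    "{T \<in> insert (tri i k j) (A \<union> B). T \<subseteq> H i k} = A"
    "{T \<in> insert (tri i k j) (A \<union> B). T \<subseteq> H k j} = B"
proof -
  have kn: "k \<le> n" using ik by simp
  have Int: "H i k \<inter> H k j \<subseteq> {p k}" by (rule hull_Int[OF ik]) (use o in simp)
  have "p j \<in> H k j" "p i \<in> H i k" using ik by (auto intro!: p_in_H)
  moreover have "p j \<noteq> p k" "p i \<noteq> p k" using ik by (auto simp: p_eq_iff)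
  ultimately show notk: "p j \<notin> H i k" "p i \<notin> H k j" using Int by auto
  have disj: "\<not> (T \<subseteq> H i k \<and> T \<subseteq> H k j)" if "T = tri a b c" "a < b" "b < c" "c \<le> n" for T a b c
    using tri_not_singleton[OF that(2-4), of "p k"] Int that(1) by blast
  have A': "T \<subseteq> H i k \<and> \<not> T \<subseteq> H k j" if T: "T \<in> A" for T
  proof -
    obtain a b c where "etri i k a b c" "T = tri a b c" using dissections_tri[OF A T kn] .
    then show ?thesis using disj[of T a b c] dissections_subset[OF A T kn] kn by (auto simp: etri_def)
  qed
  have B': "T \<subseteq> H k j \<and> \<not> T \<subseteq> H i k" if T: "T \<in> B" for T
  proof -
    obtain a b c where "etri k j a b c" "T = tri a b c" using dissections_tri[OF B T ik(3)] .
    then show ?thesis using disj[of T a b c] dissections_subset[OF B T ik(3)] ik(3) by (auto simp: etri_def)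
  qed
  have T0: "\<not> tri i k j \<subseteq> H i k" "\<not> tri i k j \<subseteq> H k j"
    using notk p_in_tri(3)[of j i k] p_in_tri(1)[of i k j] by blast+
  show "{T \<in> insert (tri i k j) (A \<union> B). T \<subseteq> H i k} = A" using A' B' T0 by blast
  show "{T \<in> insert (tri i k j) (A \<union> B). T \<subseteq> H k j} = B" using A' B' T0 by blast
qed

section \<open>Counting the dissections of a chain\<close>

lemma finite_dissections: "j \<le> n \<Longrightarrow> finite (dissections i j)"
proof (rule finite_subset)
  assume j: "j \<le> n"
  let ?F = "(\<lambda>(a, b, c). tri a b c) ` ({..n} \<times> {..n} \<times> {..n})"
  show "dissections i j \<subseteq> Pow ?F"
  proof
    fix \<T> assume \<T>: "\<T> \<in> dissections i j"
    have "T \<in> ?F" if mem: "T \<in> \<T>" for T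
    proof -
      obtain a b c where e: "etri i j a b c" and T: "T = tri a b c" using dissections_tri[OF \<T> mem j] .
      have "(a, b, c) \<in> {..n} \<times> {..n} \<times> {..n}" using e j by (auto simp: etri_def)
      then show ?thesis unfolding T by (rule rev_image_eqI) simp
    qed
    then show "\<T> \<in> Pow ?F" by blast
  qed
qed simp

text \<open>Splitting and gluing are inverse to each other, so a dissection amounts to an apex with
  a dissection of each piece. An apex on the base line gives no triangle and is left out.\<close>

lemma card_dissections_rec:
  assumes ij: "i + 2 \<le> j" "j \<le> n"
  shows "card (dissections i j) = (\<Sum>k | i < k \<and> k < j \<and> orient (p i) (p k) (p j) \<noteq> 0.
     card (dissections i k) * card (dissections k j))"
proof -
  define K where "K = {k. i < k \<and> k < j \<and> orient (p i) (p k) (p j) \<noteq> 0}"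
  define g where "g k = (\<lambda>(A, B). insert (tri i k j) (A \<union> B))" for k
  define D where "D k = g k ` (dissections i k \<times> dissections k j)" for k
  have K: "i < k" "k < j" "0 < orient (p i) (p k) (p j)" if "k \<in> K" for k
    using that pos[of i k j] ij by (auto simp: K_def)
  have finK: "finite K" by (rule finite_subset[of _ "{..j}"]) (auto simp: K_def)
  have "dissections i j = (\<Union>k\<in>K. D k)"
  proof (intro equalityI subsetI)
    fix \<T> assume "\<T> \<in> dissections i j"
    then have "triangle_dissection (P i j) \<T>" using ij by (simp add: dissections_def)
    from this ij obtain k where k: "i < k" "k < j" "0 < orient (p i) (p k) (p j)"
      "{T \<in> \<T>. T \<subseteq> H i k} \<in> dissections i k" "{T \<in> \<T>. T \<subseteq> H k j} \<in> dissections k j"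
      "\<T> = insert (tri i k j) ({T \<in> \<T>. T \<subseteq> H i k} \<union> {T \<in> \<T>. T \<subseteq> H k j})"
      by (rule dissection_split)
    have "k \<in> K" using k(1-3) by (simp add: K_def)
    moreover have "\<T> \<in> D k"
      unfolding D_def g_def using k(4-6)
      by (intro image_eqI[of _ _ "({T \<in> \<T>. T \<subseteq> H i k}, {T \<in> \<T>. T \<subseteq> H k j})"]) (simp_all only: split_conv, simp)
    ultimately show "\<T> \<in> (\<Union>k\<in>K. D k)" by blast
  next
    fix \<T> assume "\<T> \<in> (\<Union>k\<in>K. D k)"
    then obtain k A B where k: "k \<in> K" and AB: "A \<in> dissections i k" "B \<in> dissections k j"
      and \<T>: "\<T> = insert (tri i k j) (A \<union> B)" unfolding D_def g_def by blast
    have "triangle_dissection (P i j) \<T>" unfolding \<T> by (rule dissection_glue[OF K(1,2)[OF k] ij(2) K(3)[OF k] AB])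
    then show "\<T> \<in> dissections i j" using ij by (simp add: dissections_def)
  qed
  also have "card \<dots> = (\<Sum>k\<in>K. card (D k))"
  proof (rule card_UN_disjoint[OF finK])
    show "\<forall>k\<in>K. finite (D k)"
    proof
      fix k assume "k \<in> K"
      then have "k \<le> n" using K(2)[of k] ij by simp
      then show "finite (D k)"
        unfolding D_def using ij by (intro finite_imageI finite_cartesian_product finite_dissections)
    qed
    show "\<forall>k\<in>K. \<forall>k'\<in>K. k \<noteq> k' \<longrightarrow> D k \<inter> D k' = {}"
    proof (intro ballI impI)
      fix k k' assume k: "k \<in> K" "k' \<in> K" "k \<noteq> k'"
      show "D k \<inter> D k' = {}"
      proof (rule ccontr)
        assume "D k \<inter> D k' \<noteq> {}"
        then obtain \<T> where \<T>: "\<T> \<in> D k" "\<T> \<in> D k'" by blast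
        from \<T>(1) obtain A B where AB1: "A \<in> dissections i k" "B \<in> dissections k j"
          and eq1: "\<T> = insert (tri i k j) (A \<union> B)" unfolding D_def g_def by blast
        from \<T>(2) obtain A' B' where AB2: "A' \<in> dissections i k'" "B' \<in> dissections k' j"
          and eq2: "\<T> = insert (tri i k' j) (A' \<union> B')" unfolding D_def g_def by blast
        note AB = AB1 AB2 and eq = eq1[unfolded eq2, symmetric]
        have "k' \<le> n" using K[OF k(2)] ij by simp
        note notk = dissection_glue_restrict(1,2)[OF K(1,2)[OF k(2)] ij(2) K(3)[OF k(2)] AB(3,4)]
        \<comment> \<open>The triangle contains \<open>p i\<close> and \<open>p j\<close>, but
          neither piece for \<open>k'\<close> has both in its hull. So the triangle at the base
          determines the apex.\<close>
        have "tri i k j \<notin> A'" using dissections_subset[OF AB(3) _ \<open>k' \<le> n\<close>] notk(1) p_in_tri(3)[of j i k] by blast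
        moreover have "tri i k j \<notin> B'" using dissections_subset[OF AB(4) _ ij(2)] notk(2) p_in_tri(1)[of i k j] by blast
        moreover have "tri i k j \<in> insert (tri i k' j) (A' \<union> B')" unfolding eq[symmetric] by simp
        ultimately have "tri i k j = tri i k' j" by blast
        then have "p k extreme_point_of tri i k' j"
          using triangle_extreme_iff[of "p i" "p k" "p j" "p k"] K[OF k(1)] by simp
        then have "p k \<in> {p i, p k', p j}"
          using triangle_extreme_iff[of "p i" "p k'" "p j" "p k"] K[OF k(2)] by simp
        then show False using k K[OF k(1)] K[OF k(2)] ij by (auto simp: p_eq_iff)
      qed
    qed
  qed
  also have "\<dots> = (\<Sum>k\<in>K. card (dissections i k) * card (dissections k j))"
  proof (rule sum.cong[OF refl])
    fix k assume k: "k \<in> K"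
    note kk = K(1,2)[OF k] ij(2) K(3)[OF k]
    have "inj_on (g k) (dissections i k \<times> dissections k j)"
    proof (rule inj_onI)
      fix x y assume "x \<in> dissections i k \<times> dissections k j" "y \<in> dissections i k \<times> dissections k j" and eq: "g k x = g k y"
      then obtain A B A' B' where AB: "A \<in> dissections i k" "B \<in> dissections k j" "A' \<in> dissections i k" "B' \<in> dissections k j"
        and xy: "x = (A, B)" "y = (A', B')" by blast
      from eq have "insert (tri i k j) (A \<union> B) = insert (tri i k j) (A' \<union> B')" by (simp only: xy g_def split_conv)
      then show "x = y"
        using dissection_glue_restrict(3,4)[OF kk AB(1,2)] dissection_glue_restrict(3,4)[OF kk AB(3,4)] xy by (simp only:)
    qed
    then show "card (D k) = card (dissections i k) * card (dissections k j)"
      unfolding D_def by (simp add: card_image card_cartesian_product)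
  qed
  finally show ?thesis unfolding K_def .
qed

end

lemma ear_count_upt:
  assumes "i + 3 \<le> j"
  shows "ear_count (map f [Suc i..<j]) =
     (\<Sum>k\<in>{i<..<j}. ear_count (map f [Suc i..<k]) * ear_count (map f [Suc k..<j]))"
proof -
  let ?xs = "map f [Suc i..<j]"
  have "ear_count ?xs = (\<Sum>m<j - Suc i. ear_count (take m ?xs) * ear_count (drop (Suc m) ?xs))"
    using assms by (subst ear_count.simps) auto
  also have "\<dots> = (\<Sum>m<j - Suc i. ear_count (map f [Suc i..<Suc i + m]) * ear_count (map f [Suc (Suc i + m)..<j]))"
    by (intro sum.cong refl arg_cong2[of _ _ _ _ "(*)"] arg_cong[of _ _ ear_count])
       (auto simp: take_map drop_map take_upt drop_upt simp del: upt_Suc)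
  also have "\<dots> = (\<Sum>k\<in>{i<..<j}. ear_count (map f [Suc i..<k]) * ear_count (map f [Suc k..<j]))"
    by (rule sum.reindex_bij_witness[of _ "\<lambda>k. k - Suc i" "\<lambda>m. Suc i + m"]) auto
  finally show ?thesis .
qed

context chain
begin

text \<open>Weight 0 forbids the ear at a subdivision point, a triangle of area zero.\<close>

definition weight :: "nat \<Rightarrow> real" where
  "weight t = (if t \<in> M then 0 else 1)"

text \<open>Apart from the wrapped triple, only three consecutive points can be collinear. So every
  apex is admissible once \<open>i + 3 \<le> j\<close>, and the degenerate case
  \<open>j = i + 2\<close> is exactly where \<open>ear_count\<close> reads off a weight.\<close>

lemma card_dissections_ear_count:
  assumes "i < j" "j \<le> n" "i = 0 \<Longrightarrow> j \<noteq> n"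
  shows "real (card (dissections i j)) = ear_count (map weight [Suc i..<j])"
  using assms
proof (induction "j - i" arbitrary: i j rule: less_induct)
  case less
  consider "j = Suc i" | "j = i + 2" | "i + 3 \<le> j" using less.prems by linarith
  then show ?case
  proof cases
    case 1
    then show ?thesis by (simp add: dissections_def)
  next
    case 2
    have z: "orient (p i) (p (Suc i)) (p j) = 0 \<longleftrightarrow> Suc i \<in> M"
      using 2 less.prems zero_iff[of i "Suc i" j] by auto
    have "{k. i < k \<and> k < j \<and> orient (p i) (p k) (p j) \<noteq> 0} = (if Suc i \<in> M then {} else {Suc i})"
      using 2 z by (auto simp: less_Suc_eq)
    moreover have "dissections i (Suc i) = {{}}" "dissections (Suc i) j = {{}}"
      using 2 by (simp_all add: dissections_def)
    ultimately have "card (dissections i j) = (if Suc i \<in> M then 0 else 1)"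
      using card_dissections_rec[of i j] less.prems 2 by simp
    then show ?thesis using 2 by (simp add: weight_def)
  next
    case 3
    have "orient (p i) (p k) (p j) \<noteq> 0" if "i < k" "k < j" for k
      using that 3 less.prems zero_iff[of i k j] by auto
    then have "{k. i < k \<and> k < j \<and> orient (p i) (p k) (p j) \<noteq> 0} = {i<..<j}" by auto
    then have "real (card (dissections i j)) =
       (\<Sum>k\<in>{i<..<j}. real (card (dissections i k)) * real (card (dissections k j)))"
      using card_dissections_rec[of i j] less.prems 3 by simp
    also have "\<dots> = (\<Sum>k\<in>{i<..<j}. ear_count (map weight [Suc i..<k]) * ear_count (map weight [Suc k..<j]))"
      using less.prems by (intro sum.cong refl arg_cong2[of _ _ _ _ "(*)"] less.hyps) auto
    finally show ?thesis using ear_count_upt[OF 3] by simp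
  qed
qed

text \<open>On the whole chain the apex \<open>n - 1\<close> lies on the base line: its triangle
  would be the ear at the subdivision point \<open>p n\<close>. Omitting its term from the full sum
  is a further backward difference.\<close>

lemma card_dissections_top:
  assumes "3 \<le> n"
  shows "real (card (dissections 0 n)) = ear_count (map weight [1..<n]) - ear_count (map weight [1..<n - 1])"
proof -
  have "{k. 0 < k \<and> k < n \<and> orient (p 0) (p k) (p n) \<noteq> 0} = {0<..<n} - {n - 1}"
    using zero_iff[of 0 _ n] assms by auto
  then have "real (card (dissections 0 n)) =
       (\<Sum>k\<in>{0<..<n} - {n - 1}. real (card (dissections 0 k)) * real (card (dissections k n)))"
    using card_dissections_rec[of 0 n] assms by simp
  also have "\<dots> = (\<Sum>k\<in>{0<..<n} - {n - 1}. ear_count (map weight [Suc 0..<k]) * ear_count (map weight [Suc k..<n]))"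
    by (intro sum.cong refl arg_cong2[of _ _ _ _ "(*)"] card_dissections_ear_count) auto
  also have "\<dots> = (\<Sum>k\<in>{0<..<n}. ear_count (map weight [Suc 0..<k]) * ear_count (map weight [Suc k..<n]))
      - ear_count (map weight [Suc 0..<n - 1]) * ear_count (map weight [Suc (n - 1)..<n])"
    using assms by (subst sum_diff1) auto
  also have "\<dots> = ear_count (map weight [1..<n]) - ear_count (map weight [1..<n - 1])"
    using ear_count_upt[of 0 n weight] assms by simp
  finally show ?thesis .
qed

lemma count_list_weight: "count_list (map weight [a..<b]) 0 = card (M \<inter> {a..<b})"
proof (induction b)
  case (Suc b)
  show ?case
  proof (cases "a \<le> b")
    case True
    then have "M \<inter> {a..<Suc b} = (if b \<in> M then insert b (M \<inter> {a..<b}) else M \<inter> {a..<b})"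
      by (auto simp: less_Suc_eq)
    then show ?thesis using Suc True by (simp add: weight_def)
  qed simp
qed simp

text \<open>The \<open>Suc\<close> counts the ear at the last point, while \<open>s\<close> counts
  the inner subdivision points. As \<open>n - 1\<close> is a corner, both lists of
  \<open>card_dissections_top\<close> have the same zeros, and their lengths differ by one.\<close>

lemma card_dissections_cat_int:
  assumes n: "3 \<le> n" and M: "\<And>t. t \<in> M \<Longrightarrow> Suc t \<notin> M" "n - 1 \<notin> M"
    and s: "card (M \<inter> {1..<n}) = s" "s + 1 < n"
  shows "real (card (dissections 0 n)) = cat_int (n - 1) (Suc s)"
proof -
  have ear: "ear_count (map weight [1..<b]) = cat_int (b - 1) (card (M \<inter> {1..<b}))" for b
  proof -
    have "ear_count (map weight [1..<b]) = cat_int (length (map weight [1..<b])) (count_list (map weight [1..<b]) 0)"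
    proof (rule ear_count_eq_cat_int)
      fix k assume "Suc k < length (map weight [1..<b])"
      then show "map weight [1..<b] ! k = 1 \<or> map weight [1..<b] ! Suc k = 1"
        using M(1)[of "1 + k"] by (auto simp: weight_def)
    qed (auto simp: weight_def)
    then show ?thesis by (simp add: count_list_weight)
  qed
  have "{1..<n} = insert (n - 1) {1..<n - 1}" using n by auto
  then have "M \<inter> {1..<n - 1} = M \<inter> {1..<n}" using M(2) by auto
  then show ?thesis
    unfolding card_dissections_top[OF n] ear
    using cat_int_Suc_right[of s "n - 1"] s by simp
qed

lemma etri_subset_eq:
  assumes e: "etri i j a b c" and e': "etri i j a' b' c'" and j: "j \<le> n"
    and sub: "tri a' b' c' \<subseteq> tri a b c"
  shows "tri a' b' c' = tri a b c"
proof -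
  have o: "a < b" "b < c" "a' < b'" "b' < c'" and r: "a' \<in> {i..j}" "b' \<in> {i..j}" "c' \<in> {i..j}"
    using e e' by (auto simp: etri_def)
  have "a' \<in> {a, b, c}" "b' \<in> {a, b, c}" "c' \<in> {a, b, c}"
    using etri_vertices[OF e j r(1)] etri_vertices[OF e j r(2)] etri_vertices[OF e j r(3)]
      subsetD[OF sub p_in_tri(1)] subsetD[OF sub p_in_tri(2)] subsetD[OF sub p_in_tri(3)] by simp_all
  then have "a' = a \<and> b' = b \<and> c' = c" using o by auto
  then show ?thesis by simp
qed

text \<open>
  Maximality is automatic: no triangle of a dissection contains a further point of the set.
\<close>

lemma point_set_triangulation_iff:
  assumes j: "j \<le> n"
  shows "point_set_triangulation (P i j) \<T> \<longleftrightarrow> triangle_dissection (P i j) \<T>"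
proof -
  have "\<T>' = \<T>" if \<T>: "triangle_dissection (P i j) \<T>" and \<T>': "triangle_dissection (P i j) \<T>'"
    and ref: "refines \<T>' \<T>" for \<T>'
  proof
    show sub: "\<T>' \<subseteq> \<T>"
    proof
      fix T' assume T': "T' \<in> \<T>'"
      then obtain T where T: "T \<in> \<T>" "T' \<subseteq> T" using ref by (auto simp: refines_def)
      obtain a b c where e: "etri i j a b c" "T = tri a b c" using dissectionD(4)[OF \<T> j T(1)] by blast
      obtain a' b' c' where e': "etri i j a' b' c'" "T' = tri a' b' c'" using dissectionD(4)[OF \<T>' j T'] by blast
      have "T' = T" using etri_subset_eq[OF e(1) e'(1) j] T(2) e(2) e'(2) by simp
      with T show "T' \<in> \<T>" by simp
    qed
    show "\<T> \<subseteq> \<T>'"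
    proof
      fix T assume T: "T \<in> \<T>"
      obtain a b c where e: "etri i j a b c" "T = tri a b c" using dissectionD(4)[OF \<T> j T] by blast
      \<comment> \<open>The coarser dissection also contains \<open>T'\<close>, so \<open>T\<close>
        and \<open>T'\<close> meet in a face of \<open>T\<close>. A face with a relatively interior
        point is all of \<open>T\<close>, hence \<open>T\<close> is contained in
        \<open>T'\<close>.\<close>
      have "rel_interior T \<noteq> {}" unfolding e(2) by (subst rel_interior_eq_empty) auto
      then obtain x where x: "x \<in> rel_interior T" by blast
      have "x \<in> \<Union>\<T>" using x rel_interior_subset T by blast
      then obtain T' where T': "T' \<in> \<T>'" "x \<in> T'"
        unfolding dissectionD(2)[OF \<T> j] dissectionD(2)[OF \<T>' j, symmetric] by blast
      have "(T \<inter> T') face_of T" using dissectionD(3)[OF \<T> j T] T' sub by blast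
      moreover have "T \<inter> T' \<inter> rel_interior T \<noteq> {}" using x T' rel_interior_subset by blast
      ultimately have "T \<subseteq> T \<inter> T'" by (rule subset_of_face_of[OF _ order_refl])
      obtain a' b' c' where e': "etri i j a' b' c'" "T' = tri a' b' c'" using dissectionD(4)[OF \<T>' j T'(1)] by blast
      have "tri a b c \<subseteq> tri a' b' c'" using \<open>T \<subseteq> T \<inter> T'\<close> unfolding e(2) e'(2) by (rule order_trans) (rule Int_lower2)
      then have "T = T'" unfolding e(2) e'(2) by (rule etri_subset_eq[OF e'(1) e(1) j])
      with T' show "T \<in> \<T>'" by simp
    qed
  qed
  then show ?thesis unfolding point_set_triangulation_def by blast
qed

lemma tr_eq_cat_int:
  assumes n: "3 \<le> n" and M: "\<And>t. t \<in> M \<Longrightarrow> Suc t \<notin> M" "n - 1 \<notin> M"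
    and s: "card (M \<inter> {1..<n}) = s" "s + 1 < n"
  shows "real (tr (p ` {..n})) = cat_int (n - 1) (Suc s)"
proof -
  have "tr (p ` {..n}) = card (dissections 0 n)"
    using n point_set_triangulation_iff[of n 0] by (simp add: tr_def dissections_def atLeast0AtMost)
  then show ?thesis using card_dissections_cat_int[OF assms] by simp
qed

end

section \<open>Subdivided convex polygons\<close>

text \<open>Meant for the angular order around one corner, which is total and transitive only on the
  set of the other corners.\<close>

lemma finite_strict_order_list:
  assumes "finite A" "\<And>x y. x \<in> A \<Longrightarrow> y \<in> A \<Longrightarrow> x \<noteq> y \<Longrightarrow> R x y \<or> R y x"
    and "\<And>x y z. x \<in> A \<Longrightarrow> y \<in> A \<Longrightarrow> z \<in> A \<Longrightarrow> R x y \<Longrightarrow> R y z \<Longrightarrow> R x z"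
  shows "\<exists>xs. distinct xs \<and> set xs = A \<and> sorted_wrt R xs"
  using assms
proof (induction A rule: finite_induct)
  case empty
  show ?case by (intro exI[of _ "[]"]) simp
next
  case (insert x A)
  then obtain xs where xs: "distinct xs" "set xs = A" "sorted_wrt R xs" by blast
  let ?ys = "filter (\<lambda>y. R y x) xs @ x # filter (\<lambda>y. \<not> R y x) xs"
  have "R x y" if "y \<in> A" "\<not> R y x" for y
    using insert.prems(1)[of x y] insert.hyps that by blast
  moreover have "R y z" if "y \<in> A" "z \<in> A" "R y x" "\<not> R z x" for y z
    using insert.prems(2)[of y x z] calculation[of z] that by blast
  ultimately have "sorted_wrt R ?ys"
    using xs by (auto simp: sorted_wrt_append sorted_wrt_filter)
  moreover have "distinct ?ys" "set ?ys = insert x A" using xs insert.hyps by auto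
  ultimately show ?case by blast
qed

lemma extreme_not_in_hull:
  assumes "v extreme_point_of (convex hull V)" "A \<subseteq> V" "v \<notin> A"
  shows "v \<notin> convex hull A"
proof -
  have "convex (convex hull V - {v})"
    using assms(1) extreme_point_of_stillconvex[OF convex_convex_hull] by blast
  moreover have "A \<subseteq> convex hull V - {v}" using assms(2,3) hull_subset[of V convex] by blast
  ultimately have "convex hull A \<subseteq> convex hull V - {v}" by (rule hull_minimal[rotated])
  then show ?thesis by blast
qed

lemma extreme_points_orient_nonzero:
  assumes ext: "\<And>v. v \<in> V \<Longrightarrow> v extreme_point_of (convex hull V)"
    and V: "u \<in> V" "v \<in> V" "w \<in> V" "u \<noteq> v" "v \<noteq> w" "u \<noteq> w"
  shows "orient u v w \<noteq> 0"
proof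
  assume "orient u v w = 0"
  then have "collinear {u, v, w}" by (simp add: collinear_orient)
  then have "u \<in> convex hull {v, w} \<or> v \<in> convex hull {w, u} \<or> w \<in> convex hull {u, v}"
    by (simp add: collinear_between_cases between_mem_convex_hull)
  then show False
    using extreme_not_in_hull[OF ext, of u "{v, w}"] extreme_not_in_hull[OF ext, of v "{w, u}"]
      extreme_not_in_hull[OF ext, of w "{u, v}"] V by auto
qed

text \<open>An edge is cut out by a supporting line. Three points of \<open>V\<close> on it would be
  collinear, so it has exactly two; the rest of \<open>V\<close> lies strictly on one side, and
  exchanging \<open>x\<close> and \<open>y\<close> makes it the wanted side.\<close>

lemma edge_of_extreme_points:
  assumes V: "finite V" and ext: "\<And>v. v \<in> V \<Longrightarrow> v extreme_point_of (convex hull V)"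
    and e: "e edge_of (convex hull V)"
  obtains x y where "x \<in> V" "y \<in> V" "x \<noteq> y" "e = closed_segment x y"
    "\<And>t. t \<in> V \<Longrightarrow> t \<noteq> x \<Longrightarrow> t \<noteq> y \<Longrightarrow> 0 < orient x t y"
proof -
  have face: "e face_of (convex hull V)" and dim: "aff_dim e = 1" using e by (auto simp: edge_of_def)
  have "polyhedron (convex hull V)" using V by (simp add: polyhedron_convex_hull)
  then have "e exposed_face_of (convex hull V)" using exposed_face_of_polyhedron face by blast
  then obtain a b where ab: "convex hull V \<subseteq> {x. a \<bullet> x \<le> b}" "e = convex hull V \<inter> {x. a \<bullet> x = b}"
    unfolding exposed_face_of_def by blast
  obtain C where C: "C \<subseteq> V" "e = convex hull C"
    using face_of_convex_hull_subset[OF finite_imp_compact[OF V] face] by blast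
  have finC: "finite C" using C V finite_subset by blast
  have dimC: "aff_dim C = 1" using dim C by (simp add: aff_dim_convex_hull)
  have "1 \<le> int (card C) - 1" using aff_dim_le_card[OF finC] dimC by simp
  then have ge2: "2 \<le> card C" by simp
  have "\<not> 3 \<le> card C"
  proof
    assume "3 \<le> card C"
    then obtain D where "D \<subseteq> C" "card D = 3" using obtain_subset_with_card_n by metis
    then obtain u v w where uvw: "{u, v, w} \<subseteq> C" "u \<noteq> v" "v \<noteq> w" "u \<noteq> w" by (auto simp: card_3_iff)
    have "collinear {u, v, w}"
      using collinear_subset[OF _ uvw(1)] dimC by (simp add: collinear_aff_dim)
    then show False using extreme_points_orient_nonzero[OF ext, of u v w] uvw C(1) by (auto simp: collinear_orient)
  qed
  with ge2 have "card C = 2" by simp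
  then obtain x y where xy: "C = {x, y}" "x \<noteq> y" by (auto simp: card_2_iff)
  have xyV: "x \<in> V" "y \<in> V" using xy C by auto
  have e_eq: "e = closed_segment x y" using C xy by (simp add: segment_convex_hull)
  have axy: "a \<bullet> x = b" "a \<bullet> y = b"
    using ab(2) e_eq by (auto simp: set_eq_iff)
  have strict: "a \<bullet> t < b" if t: "t \<in> V" "t \<noteq> x" "t \<noteq> y" for t
  proof -
    have "t \<in> convex hull V" using t by (simp add: hull_inc)
    moreover have "t \<notin> e" using extreme_not_in_hull[OF ext, of t C] t xy C by auto
    ultimately show ?thesis using ab by force
  qed
  \<comment> \<open>Two affine functions that vanish at \<open>x\<close> and \<open>y\<close> are
    proportional. So \<open>orient x y\<close> has one sign on the rest of \<open>V\<close>, as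
    \<open>a \<bullet> t - b\<close> does.\<close>
  have same: "orient x y t * (a \<bullet> t' - b) = orient x y t' * (a \<bullet> t - b)" for t t'
  proof -
    have "a \<bullet> (orient x y t *\<^sub>R t') = a \<bullet> (orient t' y t *\<^sub>R x + orient x t' t *\<^sub>R y + orient x y t' *\<^sub>R t)"
      by (simp only: orient_barycentric[of x y t t'])
    then have "orient x y t * (a \<bullet> t') = orient t' y t * b + orient x t' t * b + orient x y t' * (a \<bullet> t)"
      by (simp add: inner_add_right axy)
    also have "\<dots> = (orient x y t - orient x y t') * b + orient x y t' * (a \<bullet> t)"
      by (simp only: orient_barycentric_sum[of t' y t x, symmetric]) (simp add: algebra_simps)
    finally show ?thesis by (simp add: algebra_simps)
  qed
  show thesis
  proof (cases "\<exists>t\<in>V - {x, y}. 0 < orient x y t")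
    case True
    then obtain t where t: "t \<in> V" "t \<noteq> x" "t \<noteq> y" "0 < orient x y t" by blast
    have "0 < orient x y t'" if t': "t' \<in> V" "t' \<noteq> x" "t' \<noteq> y" for t'
    proof -
      have "orient x y t * (a \<bullet> t' - b) < 0" using t(4) strict[OF t'] by (simp add: mult_pos_neg)
      then show ?thesis using same[of t t'] strict[OF t(1-3)] by (simp add: mult_less_0_iff)
    qed
    then show thesis
      using that[of y x] xyV xy e_eq by (auto simp: closed_segment_commute orient_rotate)
  next
    case False
    have "0 < orient x t y" if t: "t \<in> V" "t \<noteq> x" "t \<noteq> y" for t
    proof -
      have "orient x y t \<noteq> 0" using extreme_points_orient_nonzero[OF ext, of x y t] t xyV xy by auto
      then show ?thesis using False t orient_swap'[of x t y] by force
    qed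
    then show thesis using that[of x y] xyV xy e_eq by blast
  qed
qed

text \<open>The corners are sorted by angle around \<open>x\<close>. A failure of transitivity would
  put \<open>x\<close> into the triangle of three others; a wrongly oriented triple away from
  \<open>x\<close> would put its middle corner into the triangle of \<open>x\<close> and the other
  two.\<close>

lemma convex_polygon_order:
  assumes V: "finite V" "3 \<le> card V" and ext: "\<And>v. v \<in> V \<Longrightarrow> v extreme_point_of (convex hull V)"
    and x: "x \<in> V"
  obtains w where "bij_betw w {..<card V} V" "w 0 = x" "w (card V) = x"
    "\<And>i j k. i < j \<Longrightarrow> j < k \<Longrightarrow> k \<le> card V \<Longrightarrow> \<not> (i = 0 \<and> k = card V) \<Longrightarrow> 0 < orient (w i) (w j) (w k)"
proof -
  define c where "c = card V"
  note nz = extreme_points_orient_nonzero[OF ext]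
  have total: "0 < orient x u v \<or> 0 < orient x v u" if "u \<in> V - {x}" "v \<in> V - {x}" "u \<noteq> v" for u v
    using nz[of x u v] that x orient_swap'[of x u v] by force
  have trans: "0 < orient x u t" if uvt: "u \<in> V - {x}" "v \<in> V - {x}" "t \<in> V - {x}"
    and o: "0 < orient x u v" "0 < orient x v t" for u v t
  proof (rule ccontr)
    assume n: "\<not> 0 < orient x u t"
    have "u \<noteq> t" using o orient_swap'[of x u v] by force
    then have tu: "0 < orient x t u" using total[of u t] n uvt by auto
    have sum: "orient x v t + orient u x t + orient u v x = orient u v t" by (rule orient_barycentric_sum)
    have r: "orient u x t = orient x t u" "orient u v x = orient x u v"
      by (rule orient_rotate[symmetric], rule orient_rotate)
    have "0 < orient u v t" using sum o tu unfolding r by linarith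
    then have "x \<in> convex hull {u, v, t}"
      using o tu unfolding in_triangle_iff[OF \<open>0 < orient u v t\<close>] r by simp
    then show False using extreme_not_in_hull[OF ext[OF x], of "{u, v, t}"] uvt by auto
  qed
  have "\<exists>xs. distinct xs \<and> set xs = V - {x} \<and> sorted_wrt (\<lambda>u v. 0 < orient x u v) xs"
    by (rule finite_strict_order_list, simp add: V, erule (2) total, erule (4) trans)
  then obtain xs where xs: "distinct xs" "set xs = V - {x}" "sorted_wrt (\<lambda>u v. 0 < orient x u v) xs"
    by blast
  define vs where "vs = x # xs"
  have vs: "distinct vs" "set vs = V" "length vs = c"
  proof -
    show d: "distinct vs" using xs(1,2) by (simp add: vs_def)
    show s: "set vs = V" using xs(2) x by (simp add: vs_def insert_absorb)
    show "length vs = c" using distinct_card[OF d] unfolding s c_def ..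
  qed
  have v0: "vs ! 0 = x" by (simp add: vs_def)
  have vin: "vs ! i \<in> V" if "i < c" for i using that nth_mem[of i vs] vs(2,3) by simp
  have vne: "vs ! i \<noteq> vs ! j" if "i < j" "j < c" for i j
    using that vs(3) nth_eq_iff_index_eq[OF vs(1), of i j] by simp
  have or0: "0 < orient x (vs ! i) (vs ! j)" if "0 < i" "i < j" "j < c" for i j
  proof -
    have "length xs = c - 1" using vs(3) by (simp add: vs_def)
    then have "0 < orient x (xs ! (i - 1)) (xs ! (j - 1))"
      using that by (intro sorted_wrt_nth_less[OF xs(3)]) auto
    then show ?thesis using that by (simp add: vs_def nth_Cons')
  qed
  have or: "0 < orient (vs ! i) (vs ! j) (vs ! k)" if ijk: "i < j" "j < k" "k < c" for i j k
  proof (cases "i = 0")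
    case True
    then show ?thesis using or0[of j k] ijk v0 by simp
  next
    case False
    have ij: "0 < orient x (vs ! i) (vs ! j)" and jk: "0 < orient x (vs ! j) (vs ! k)" and ik: "0 < orient x (vs ! i) (vs ! k)"
      using or0 ijk False by auto
    show ?thesis
    proof (rule ccontr)
      assume "\<not> ?thesis"
      then have "0 \<le> orient (vs ! j) (vs ! i) (vs ! k)" using orient_swap[of "vs ! j" "vs ! i" "vs ! k"] by simp
      then have "vs ! j \<in> convex hull {x, vs ! i, vs ! k}"
        unfolding in_triangle_iff[OF ik] using ij jk by simp
      moreover have "vs ! j \<notin> {x, vs ! i, vs ! k}"
        using vne[of 0 j] vne[of i j] vne[of j k] ijk v0 by auto
      ultimately show False
        using extreme_not_in_hull[OF ext[OF vin[of j]], of "{x, vs ! i, vs ! k}"] x vin ijk by auto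
    qed
  qed
  \<comment> \<open>The index \<open>c\<close> repeats the first corner, so that the closing side
    also joins \<open>w i\<close> to \<open>w (Suc i)\<close>.\<close>
  define w where "w i = (if i = c then x else vs ! i)" for i
  have bij: "bij_betw w {..<c} V"
  proof -
    have "bij_betw (\<lambda>i. vs ! i) {..<length vs} (set vs)" by (rule bij_betw_nth) (use vs in auto)
    then show ?thesis
      unfolding vs by (rule bij_betw_cong[THEN iffD1, rotated]) (auto simp: w_def)
  qed
  have w0: "w 0 = x" and wc: "w c = x" using v0 by (auto simp: w_def)
  have o: "0 < orient (w i) (w j) (w k)" if "i < j" "j < k" "k \<le> c" "\<not> (i = 0 \<and> k = c)" for i j k
  proof (cases "k = c")
    case True
    then have "0 < orient x (vs ! i) (vs ! j)" using that by (intro or0) auto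
    then show ?thesis using that True by (simp add: w_def orient_rotate[of "vs ! i" "vs ! j" x])
  next
    case False
    then show ?thesis using that or by (simp add: w_def)
  qed
  show thesis by (rule that[of w, folded c_def, OF bij w0 wc o])
qed

lemma polygon_side_index:
  assumes w: "\<And>i j k. i < j \<Longrightarrow> j < k \<Longrightarrow> k \<le> c \<Longrightarrow> \<not> (i = 0 \<and> k = c) \<Longrightarrow> 0 < orient (w i) (w j) (w k)"
    and wc: "w c = w 0" and inj: "inj_on w {..<c}" and c: "3 \<le> c"
    and ij: "i < c" "j < c" "i \<noteq> j"
    and side: "\<And>t. t < c \<Longrightarrow> t \<noteq> i \<Longrightarrow> t \<noteq> j \<Longrightarrow> 0 < orient (w i) (w t) (w j)"
  shows "i = Suc j \<or> i = 0 \<and> Suc j = c"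
proof (rule ccontr)
  assume n: "\<not> ?thesis"
  \<comment> \<open>In each disjunct \<open>t\<close>, \<open>i\<close>, \<open>j\<close> follow one
    another counterclockwise, so that \<open>orient (w i) (w t) (w j)\<close> is negative.\<close>
  have "\<exists>t<c. t < i \<and> i < j \<or> i < j \<and> j < t \<or> j < t \<and> t < i"
  proof -
    consider "i < j" "0 < i" | "i < j" "i = 0" "Suc j < c" | "Suc j < i" using n ij by linarith
    then show ?thesis
    proof cases
      case 1
      then show ?thesis using ij by (intro exI[of _ 0]) auto
    next
      case 2
      then show ?thesis by (intro exI[of _ "Suc j"]) auto
    next
      case 3
      then show ?thesis using ij by (intro exI[of _ "Suc j"]) auto
    qed
  qed
  then obtain t where t: "t < c" "t < i \<and> i < j \<or> i < j \<and> j < t \<or> j < t \<and> t < i" by blast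
  then have s: "0 < orient (w i) (w t) (w j)" using side[of t] by auto
  from t(2) show False
  proof (elim disjE conjE)
    assume "t < i" "i < j"
    then have "0 < orient (w t) (w i) (w j)" using w[of t i j] ij by auto
    then show False using s orient_swap[of "w i" "w t" "w j"] by simp
  next
    assume "i < j" "j < t"
    then have "0 < orient (w i) (w j) (w t)" using w[of i j t] t by auto
    then show False using s orient_swap'[of "w i" "w t" "w j"] by simp
  next
    assume "j < t" "t < i"
    then have "0 < orient (w j) (w t) (w i)" using w[of j t i] ij by auto
    then show False using s orient_swap[of "w i" "w t" "w j"] orient_rotate[of "w t" "w i" "w j"] by linarith
  qed
qed

section \<open>Orientations of corners and side points\<close>

lemma orient_mix:
  "orient ((1 - \<theta>) *\<^sub>R x + \<theta> *\<^sub>R x') y z = (1 - \<theta>) * orient x y z + \<theta> * orient x' y z"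
  "orient y ((1 - \<theta>) *\<^sub>R x + \<theta> *\<^sub>R x') z = (1 - \<theta>) * orient y x z + \<theta> * orient y x' z"
  "orient y z ((1 - \<theta>) *\<^sub>R x + \<theta> *\<^sub>R x') = (1 - \<theta>) * orient y z x + \<theta> * orient y z x'"
  by (simp_all add: orient_def algebra_simps)

lemma mix_nonneg_pos:
  fixes f :: "nat \<Rightarrow> real"
  assumes "0 < \<theta>" "\<theta> < 1" "0 \<le> f i" "0 \<le> f j"
  shows "0 \<le> (1 - \<theta>) * f i + \<theta> * f j"
    and "t \<in> {i, j} \<Longrightarrow> 0 < f t \<Longrightarrow> 0 < (1 - \<theta>) * f i + \<theta> * f j"
  using assms by (auto intro: add_pos_nonneg add_nonneg_pos)

text \<open>The point with index \<open>a\<close> will be a mixture of the corners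
  \<open>a div 2\<close> and \<open>Suc a div 2\<close>, which coincide for even \<open>a\<close>.
  The orientation of three such points averages nonnegative orientations of corners, so one strictly
  increasing choice other than one from \<open>0\<close> to \<open>c\<close> makes it
  positive.\<close>

lemma strict_index_choice:
  fixes a b d c :: nat
  assumes "a < b" "b < d" "d < 2 * c" "3 \<le> c"
    and "\<not> (even a \<and> b = Suc a \<and> d = Suc b)" "\<not> (a = 0 \<and> b = 2 * c - 2 \<and> d = 2 * c - 1)"
  shows "\<exists>i j k. i \<in> {a div 2, Suc a div 2} \<and> j \<in> {b div 2, Suc b div 2} \<and> k \<in> {d div 2, Suc d div 2} \<and>
     i < j \<and> j < k \<and> k \<le> c \<and> \<not> (i = 0 \<and> k = c)"
proof -
  obtain a' ra where a: "a = 2 * a' + ra" "ra < 2" "even a \<longleftrightarrow> ra = 0"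
    using that[of "a div 2" "a mod 2"] by (auto simp: even_iff_mod_2_eq_zero)
  obtain b' rb where b: "b = 2 * b' + rb" "rb < 2"
    using that[of "b div 2" "b mod 2"] by auto
  obtain d' rd where d: "d = 2 * d' + rd" "rd < 2"
    using that[of "d div 2" "d mod 2"] by auto
  have div: "a div 2 = a'" "Suc a div 2 = a' + ra" "b div 2 = b'" "Suc b div 2 = b' + rb" "d div 2 = d'" "Suc d div 2 = d' + rd"
    using a b d by auto
  have bounds: "a' + ra \<le> c" "d' + rd \<le> c" using assms(1-3) a d by auto
  have top: "d = 2 * c - 1" "Suc d' = c" "rd = 1" if "d' + rd = c" using that assms(3) d by auto
  show ?thesis
    unfolding div
  proof (cases "rb = 0")
    case True
    have j: "a' < b'" "b' < d' + rd" using True assms(1,2) a b d by auto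
    \<comment> \<open>The outermost choice \<open>a'\<close>, \<open>d' + rd\<close> is strictly
      increasing; only if it is the forbidden pair \<open>0\<close>, \<open>c\<close> does one end
      have to move inwards.\<close>
    consider "\<not> (a' = 0 \<and> d' + rd = c)" | "a' = 0" "d' + rd = c" "ra = 1" "2 \<le> b'" | "a' = 0" "d' + rd = c" "b' < d'"
    proof -
      have "ra = 1 \<and> 2 \<le> b' \<or> b' < d'" if e: "a' = 0" "d' + rd = c"
      proof (cases "b' = d'")
        case bd: True
        have "b = 2 * c - 2" using top(2)[OF e(2)] b(1) True bd by simp
        then have "a \<noteq> 0" using assms(6) top(1)[OF e(2)] by auto
        then have "ra = 1" using a(1,2) e(1) by simp
        moreover have "2 \<le> b'" using top(2)[OF e(2)] bd assms(4) by simp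
        ultimately show ?thesis by simp
      next
        case False
        then show ?thesis using j(2) top(3)[OF e(2)] by simp
      qed
      then show thesis using that by blast
    qed
    then show "\<exists>i j k. i \<in> {a', a' + ra} \<and> j \<in> {b', b' + rb} \<and> k \<in> {d', d' + rd} \<and> i < j \<and> j < k \<and> k \<le> c \<and> \<not> (i = 0 \<and> k = c)"
    proof cases
      case 1
      then show ?thesis using j bounds by (intro exI[of _ a'] exI[of _ b'] exI[of _ "d' + rd"]) auto
    next
      case 2
      then show ?thesis using j bounds by (intro exI[of _ "a' + ra"] exI[of _ b'] exI[of _ "d' + rd"]) auto
    next
      case 3
      then show ?thesis using j top by (intro exI[of _ a'] exI[of _ b'] exI[of _ d']) auto
    qed
  next
    case False
    then have rb: "rb = 1" using b by auto
    have ab: "a' \<le> b'" and bd: "b' < d'" using rb assms(1,2) a b d by auto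
    consider "a' < b'" "\<not> (a' = 0 \<and> d' + rd = c)" | "a' < b'" "a' = 0" "d' + rd = c"
      | "a' = b'" "\<not> (a' = 0 \<and> d' + rd = c)" | "a' = b'" "a' = 0" "d' + rd = c"
      using ab by linarith
    then show "\<exists>i j k. i \<in> {a', a' + ra} \<and> j \<in> {b', b' + rb} \<and> k \<in> {d', d' + rd} \<and> i < j \<and> j < k \<and> k \<le> c \<and> \<not> (i = 0 \<and> k = c)"
    proof cases
      case 1
      then show ?thesis using bd bounds by (intro exI[of _ a'] exI[of _ b'] exI[of _ "d' + rd"]) auto
    next
      case 2
      then show ?thesis using bd top by (intro exI[of _ a'] exI[of _ b'] exI[of _ d']) auto
    next
      case 3
      then have "ra = 0" using rb assms(1) a b by auto
      then have "d' + rd \<noteq> Suc b'" using 3 rb assms(5) a b d bd by auto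
      then show ?thesis using 3 rb bd bounds by (intro exI[of _ a'] exI[of _ "b' + rb"] exI[of _ "d' + rd"]) auto
    next
      case 4
      then show ?thesis using rb top assms(4) by (intro exI[of _ a'] exI[of _ "b' + rb"] exI[of _ d']) auto
    qed
  qed
qed

text \<open>
  Index \<open>2 * i\<close> stands for the \<open>i\<close>-th corner and \<open>2 * i + 1\<close> for a point on the side following it.
\<close>

lemma subdivided_polygon_orient:
  assumes w: "\<And>i j k. i < j \<Longrightarrow> j < k \<Longrightarrow> k \<le> c \<Longrightarrow> \<not> (i = 0 \<and> k = c) \<Longrightarrow> 0 < orient (w i) (w j) (w k)"
    and wc: "w c = w 0" and c: "3 \<le> c"
    and q: "\<And>a. a < 2 * c \<Longrightarrow> \<exists>\<theta>. 0 < \<theta> \<and> \<theta> < 1 \<and> q a = (1 - \<theta>) *\<^sub>R w (a div 2) + \<theta> *\<^sub>R w (Suc a div 2)"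
    and abd: "a < b" "b < d" "d < 2 * c"
  shows "0 \<le> orient (q a) (q b) (q d)"
    and "\<not> (even a \<and> b = Suc a \<and> d = Suc b) \<Longrightarrow> \<not> (a = 0 \<and> b = 2 * c - 2 \<and> d = 2 * c - 1) \<Longrightarrow>
      0 < orient (q a) (q b) (q d)"
proof -
  have w0: "0 \<le> orient (w i) (w j) (w k)" if "i \<le> j" "j \<le> k" "k \<le> c" for i j k
  proof (cases "i = j \<or> j = k \<or> i = 0 \<and> k = c")
    case False
    then show ?thesis using that by (intro less_imp_le[OF w]) auto
  qed (auto simp: wc)
  have le: "i \<le> j" if "i \<in> {a div 2, Suc a div 2}" "j \<in> {b div 2, Suc b div 2}" for i j
    using that abd by auto
  have le': "j \<le> k" "k \<le> c" if "j \<in> {b div 2, Suc b div 2}" "k \<in> {d div 2, Suc d div 2}" for j k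
    using that abd by auto
  obtain \<theta> where \<theta>: "0 < \<theta>" "\<theta> < 1" "q a = (1 - \<theta>) *\<^sub>R w (a div 2) + \<theta> *\<^sub>R w (Suc a div 2)"
    using q[of a] abd by auto
  obtain \<phi> where \<phi>: "0 < \<phi>" "\<phi> < 1" "q b = (1 - \<phi>) *\<^sub>R w (b div 2) + \<phi> *\<^sub>R w (Suc b div 2)"
    using q[of b] abd by auto
  obtain \<psi> where \<psi>: "0 < \<psi>" "\<psi> < 1" "q d = (1 - \<psi>) *\<^sub>R w (d div 2) + \<psi> *\<^sub>R w (Suc d div 2)"
    using q[of d] abd by auto
  have 0: "0 \<le> orient (w i) (w j) (w k)"
    if "i \<in> {a div 2, Suc a div 2}" "j \<in> {b div 2, Suc b div 2}" "k \<in> {d div 2, Suc d div 2}" for i j k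
    by (rule w0[OF le[OF that(1,2)] le'[OF that(2,3)]])
  \<comment> \<open>One corner at a time is replaced by a mixture; every orientation is then a
    convex combination of two from the stage before.\<close>
  have 1: "0 \<le> orient (q a) (w j) (w k)" if "j \<in> {b div 2, Suc b div 2}" "k \<in> {d div 2, Suc d div 2}" for j k
    unfolding \<theta>(3) orient_mix
    by (rule mix_nonneg_pos(1)[OF \<theta>(1,2), of "\<lambda>i. orient (w i) (w j) (w k)"]; rule 0[OF _ that]; simp)
  have 2: "0 \<le> orient (q a) (q b) (w k)" if "k \<in> {d div 2, Suc d div 2}" for k
    unfolding \<phi>(3) orient_mix
    by (rule mix_nonneg_pos(1)[OF \<phi>(1,2), of "\<lambda>j. orient (q a) (w j) (w k)"]; rule 1[OF _ that]; simp)
  show "0 \<le> orient (q a) (q b) (q d)"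
    unfolding \<psi>(3) orient_mix
    by (rule mix_nonneg_pos(1)[OF \<psi>(1,2), of "\<lambda>k. orient (q a) (q b) (w k)"]; rule 2; simp)
  assume "\<not> (even a \<and> b = Suc a \<and> d = Suc b)" "\<not> (a = 0 \<and> b = 2 * c - 2 \<and> d = 2 * c - 1)"
  from strict_index_choice[OF abd c this] obtain i j k where
    ijk: "i \<in> {a div 2, Suc a div 2}" "j \<in> {b div 2, Suc b div 2}" "k \<in> {d div 2, Suc d div 2}"
    and "i < j" "j < k" "k \<le> c" "\<not> (i = 0 \<and> k = c)" by blast
  then have p0: "0 < orient (w i) (w j) (w k)" by (intro w)
  have p1: "0 < orient (q a) (w j) (w k)"
    unfolding \<theta>(3) orient_mix
    by (rule mix_nonneg_pos(2)[OF \<theta>(1,2) _ _ ijk(1), of "\<lambda>i. orient (w i) (w j) (w k)"],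
        rule 0[OF _ ijk(2,3)], simp, rule 0[OF _ ijk(2,3)], simp, rule p0)
  have p2: "0 < orient (q a) (q b) (w k)"
    unfolding \<phi>(3) orient_mix
    by (rule mix_nonneg_pos(2)[OF \<phi>(1,2) _ _ ijk(2), of "\<lambda>j. orient (q a) (w j) (w k)"],
        rule 1[OF _ ijk(3)], simp, rule 1[OF _ ijk(3)], simp, rule p1)
  show "0 < orient (q a) (q b) (q d)"
    unfolding \<psi>(3) orient_mix
    by (rule mix_nonneg_pos(2)[OF \<psi>(1,2) _ _ ijk(3), of "\<lambda>k. orient (q a) (q b) (w k)"],
        rule 2, simp, rule 2, simp, rule p2)
qed

section \<open>From subdivided polygons to chains\<close>

text \<open>With a point on every side the index arithmetic is uniform; the increasing enumeration
  \<open>f\<close> then skips the unwanted side points. No corner is skipped, so a retained side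
  point keeps both neighbours and the collinear triples are the expected ones.
  \<open>c - 1 \<in> I\<close> makes the last point a subdivision point.\<close>

lemma tr_thinned:
  fixes q :: "nat \<Rightarrow> real^2"
  assumes c: "3 \<le> c"
    and nonneg: "\<And>a b d. a < b \<Longrightarrow> b < d \<Longrightarrow> d < 2 * c \<Longrightarrow> 0 \<le> orient (q a) (q b) (q d)"
    and pos: "\<And>a b d. a < b \<Longrightarrow> b < d \<Longrightarrow> d < 2 * c \<Longrightarrow> \<not> (even a \<and> b = Suc a \<and> d = Suc b) \<Longrightarrow>
        \<not> (a = 0 \<and> b = 2 * c - 2 \<and> d = 2 * c - 1) \<Longrightarrow> 0 < orient (q a) (q b) (q d)"
    and mid: "\<And>i. Suc i < c \<Longrightarrow> q (Suc (2 * i)) \<in> open_segment (q (2 * i)) (q (Suc (Suc (2 * i))))"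
    and mid_wrap: "q (2 * c - 1) \<in> open_segment (q 0) (q (2 * c - 2))"
    and I: "I \<subseteq> {..<c}" "c - 1 \<in> I"
  shows "real (tr (q ` ((\<lambda>i. 2 * i) ` {..<c} \<union> (\<lambda>i. Suc (2 * i)) ` I))) = cat_int (c + card I - 2) (card I)"
proof -
  define J where "J = (\<lambda>i. 2 * i) ` {..<c} \<union> (\<lambda>i. Suc (2 * i)) ` I"
  define N where "N = c + card I"
  have finI: "finite I" using I(1) finite_subset by blast
  have finJ: "finite J" using finI by (simp add: J_def)
  have Jeven: "2 * i \<in> J" if "i < c" for i using that by (auto simp: J_def)
  have Jlt: "x < 2 * c" if "x \<in> J" for x using that I(1) by (auto simp: J_def)
  have "card J = card ((\<lambda>i. 2 * i) ` {..<c}) + card ((\<lambda>i. Suc (2 * i)) ` I)"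
    unfolding J_def using finI by (intro card_Un_disjoint) (auto, presburger)
  also have "\<dots> = N" unfolding N_def by (subst (1 2) card_image) (auto simp: inj_on_def)
  finally have cardJ: "card J = N" .
  have cI: "1 \<le> card I" using I(2) finI by (metis card_gt_0_iff empty_iff One_nat_def Suc_leI)
  have N: "4 \<le> N" using c cI by (simp add: N_def)
  obtain f where bij: "bij_betw f {..<N} J" and mono: "strict_mono_on {..<N} f"
    using ex_bij_betw_strict_mono_card[OF finJ] unfolding cardJ by blast
  have less: "f a < f b" if "a < b" "b < N" for a b
    using strict_mono_onD[OF mono, of a b] that by auto
  have less_iff: "f a < f b \<longleftrightarrow> a < b" if "a < N" "b < N" for a b
    using less[of a b] less[of b a] that by (metis less_asym' linorder_neqE_nat)
  have finj: "a = b" if "f a = f b" "a < N" "b < N" for a b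
    using that bij by (auto simp: bij_betw_def inj_on_def)
  have fJ: "f t \<in> J" if "t < N" for t using that bij by (auto simp: bij_betw_def)
  have Jf: "\<exists>t<N. f t = x" if "x \<in> J" for x using that bij by (auto simp: bij_betw_def)
  have flt: "f t < 2 * c" if "t < N" for t using Jlt fJ that by blast
  have succ: "f (Suc b) \<le> x" if h: "x \<in> J" "f b < x" "Suc b < N" for b x
  proof -
    obtain t where t: "t < N" "f t = x" using Jf h(1) by blast
    then have "b < t" using h less_iff[of b t] by auto
    then show ?thesis using less[of "Suc b" t] t by (cases "Suc b = t") auto
  qed
  have pred: "x \<le> f b" if h: "x \<in> J" "x < f (Suc b)" "Suc b < N" for b x
  proof -
    obtain t where t: "t < N" "f t = x" using Jf h(1) by blast
    then have "t \<le> b" using h less_iff[of t "Suc b"] by auto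
    then show ?thesis using less[of t b] t h by (cases "t = b") auto
  qed
  have f0: "f 0 = 0"
  proof -
    obtain t where t: "t < N" "f t = 0" using Jf Jeven[of 0] c by auto
    then show ?thesis using less[of 0 t] by (cases "t = 0") auto
  qed
  have fn: "f (N - 1) = 2 * c - 1"
  proof -
    have "Suc (2 * (c - 1)) \<in> J" using I(2) by (auto simp: J_def)
    then have "2 * c - 1 \<in> J" using c by (simp add: algebra_simps Suc_diff_Suc numeral_2_eq_2)
    then obtain t where t: "t < N" "f t = 2 * c - 1" using Jf by blast
    moreover have "f t \<le> f (N - 1)"
    proof (cases "t = N - 1")
      case False
      then have "t < N - 1" "N - 1 < N" using t N by linarith+
      then show ?thesis using less by (intro less_imp_le) blast
    qed simp
    moreover have "f (N - 1) < 2 * c" using flt[of "N - 1"] N by simp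
    ultimately show ?thesis by linarith
  qed
  have fn1: "f (N - 2) = 2 * c - 2"
  proof -
    have e: "Suc (N - 2) = N - 1" using N by simp
    have "2 * (c - 1) \<in> J" using Jeven[of "c - 1"] c by simp
    then have "2 * (c - 1) \<le> f (N - 2)" using pred[of "2 * (c - 1)" "N - 2"] fn N c unfolding e by simp
    moreover have "f (N - 2) < f (N - 1)" using N by (intro less) auto
    ultimately show ?thesis using fn by simp
  qed
  have odd: "\<exists>i. Suc i < c \<and> f a = 2 * i \<and> f (Suc a) = Suc (2 * i) \<and> f (Suc (Suc a)) = Suc (Suc (2 * i))"
    if "odd (f (Suc a))" "Suc (Suc a) < N" for a
  proof -
    obtain i where i: "f (Suc a) = Suc (2 * i)" using \<open>odd (f (Suc a))\<close> oddE by fastforce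
    have lt: "f a < f (Suc a)" "f (Suc a) < f (Suc (Suc a))" using that(2) by (auto intro: less)
    have ic: "Suc i < c" using lt(2) flt[OF that(2)] i by simp
    have "2 * i \<le> f a" using pred[of "2 * i" a] Jeven[of i] ic i that(2) by simp
    moreover have "f (Suc (Suc a)) \<le> 2 * Suc i" using succ[of "2 * Suc i" "Suc a"] Jeven[of "Suc i"] ic i that(2) by simp
    ultimately show ?thesis using i lt ic by (intro exI[of _ i]) auto
  qed
  \<comment> \<open>Two points differ if some third point gives a positive orientation; the cases
    choose one for which neither collinear exception applies.\<close>
  have qinj: "q a \<noteq> q b" if ab: "a < b" "b < 2 * c" for a b
  proof
    assume e: "q a = q b"
    have z: "\<not> 0 < orient (q a) (q b) (q d)" "\<not> 0 < orient (q a) (q d) (q b)" "\<not> 0 < orient (q d) (q a) (q b)" for d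
      unfolding e by simp_all
    consider "b < 2 * c - 1" "\<not> (a = 0 \<and> b = 2 * c - 2)" | "a = 0" "2 * c - 2 \<le> b" | "a = 1" "b = 2 * c - 1"
      | "2 \<le> a" "a \<noteq> 2 * c - 2" "b = 2 * c - 1" | "a = 2 * c - 2" "b = 2 * c - 1"
      using ab by linarith
    then show False
    proof cases
      case 1
      have "even a \<and> b = Suc a \<and> 2 * c - 1 = Suc b \<Longrightarrow> False" using c by presburger
      then show False using pos[of a b "2 * c - 1"] z 1 ab c by auto
    next
      case 2
      then have "2 < b" using c by linarith
      then show False using pos[of 0 2 b] z(2) ab(2) c 2(1) by auto
    next
      case 3
      then have "3 < b" using c by linarith
      then show False using pos[of 1 3 b] z(2) ab(2) 3(1) by auto
    next
      case 4
      then have "0 < a" "a \<noteq> Suc 0" by linarith+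
      then show False using pos[of 0 a b] z(3) ab 4(2) by auto
    next
      case 5
      then have "2 < a" "b \<noteq> Suc 3" using c by linarith+
      then show False using pos[of 2 a b] z(3) ab by auto
    qed
  qed
  define M where "M = {t. t < N \<and> odd (f t)}"
  interpret chain "\<lambda>t. q (f t)" "N - 1" M
  proof
    show "inj_on (\<lambda>t. q (f t)) {..N - 1}"
    proof (rule linorder_inj_onI)
      fix a b assume "a < b" "b \<in> {..N - 1}"
      then have "a < b" "b < N" using N by auto
      then show "q (f a) \<noteq> q (f b)" using qinj[OF less flt] by blast
    qed auto
  next
    fix a b d assume "a < b" "b < d" "d \<le> N - 1"
    then have "f a < f b" "f b < f d" "f d < 2 * c" using N by (auto intro!: less flt)
    then show "0 \<le> orient (q (f a)) (q (f b)) (q (f d))" by (rule nonneg)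
  next
    fix a b d assume abd: "a < b" "b < d" "d \<le> N - 1"
    then have r: "a < N" "b < N" "d < N" using N by auto
    have lt: "f a < f b" "f b < f d" "f d < 2 * c" using abd r by (auto intro!: less flt)
    show "orient (q (f a)) (q (f b)) (q (f d)) = 0 \<longleftrightarrow>
        b = Suc a \<and> d = Suc b \<and> b \<in> M \<or> a = 0 \<and> Suc b = N - 1 \<and> d = N - 1"
    proof
      assume "orient (q (f a)) (q (f b)) (q (f d)) = 0"
      then consider "even (f a)" "f b = Suc (f a)" "f d = Suc (f b)"
        | "f a = 0" "f b = 2 * c - 2" "f d = 2 * c - 1"
        using pos[OF lt] by force
      then show "b = Suc a \<and> d = Suc b \<and> b \<in> M \<or> a = 0 \<and> Suc b = N - 1 \<and> d = N - 1"
      proof cases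
        case 1
        have "b = Suc a"
        proof (rule ccontr)
          assume "b \<noteq> Suc a"
          then have "f a < f (Suc a)" "f (Suc a) < f b" using abd r by (auto intro!: less)
          then show False using 1 by simp
        qed
        moreover have "d = Suc b"
        proof (rule ccontr)
          assume "d \<noteq> Suc b"
          then have "f b < f (Suc b)" "f (Suc b) < f d" using abd r by (auto intro!: less)
          then show False using 1 by simp
        qed
        moreover have "b \<in> M" using 1 r by (simp add: M_def)
        ultimately show ?thesis by blast
      next
        case 2
        have "a = 0" using finj[of a 0] 2 f0 r by simp
        moreover have "d = N - 1" using finj[of d "N - 1"] 2 fn r by simp
        moreover have "b = N - 2" using finj[of b "N - 2"] 2 fn1 r by simp
        ultimately show ?thesis using N by auto
      qed
    next
      assume "b = Suc a \<and> d = Suc b \<and> b \<in> M \<or> a = 0 \<and> Suc b = N - 1 \<and> d = N - 1"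
      then consider "b = Suc a" "d = Suc b" "b \<in> M" | "a = 0" "b = N - 2" "d = N - 1" by auto
      then show "orient (q (f a)) (q (f b)) (q (f d)) = 0"
      proof cases
        case 1
        then obtain i where i: "Suc i < c" "f a = 2 * i" "f b = Suc (2 * i)" "f d = Suc (Suc (2 * i))"
          using odd[of a] r by (auto simp: M_def)
        have "orient (q (f a)) (q (f d)) (q (f b)) = 0"
          unfolding i by (rule orient_open_segment) (rule mid[OF i(1)])
        then show ?thesis by (simp add: orient_swap'[of _ "q (f b)"])
      next
        case 2
        have "orient (q 0) (q (2 * c - 2)) (q (2 * c - 1)) = 0"
          by (rule orient_open_segment) (rule mid_wrap)
        then show ?thesis by (simp only: 2 f0 fn fn1)
      qed
    qed
  next
    fix a assume a: "Suc (Suc a) \<le> N - 1" "Suc a \<in> M"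
    have "odd (f (Suc a))" "Suc (Suc a) < N" using a N by (simp_all add: M_def)
    from odd[OF this] obtain i where
      i: "Suc i < c" "f a = 2 * i" "f (Suc a) = Suc (2 * i)" "f (Suc (Suc a)) = Suc (Suc (2 * i))" by blast
    show "q (f (Suc a)) \<in> open_segment (q (f a)) (q (f (Suc (Suc a))))"
      unfolding i by (rule mid[OF i(1)])
  next
    have "N - 1 - 1 = N - 2" by simp
    then show "q (f (N - 1)) \<in> open_segment (q (f 0)) (q (f (N - 1 - 1)))"
      using mid_wrap by (simp only: f0 fn fn1)
  qed
  have Mn: "N - 1 \<in> M" unfolding M_def mem_Collect_eq fn using N c by simp
  have M0: "0 \<notin> M" by (simp add: M_def f0)
  have "card M = card I"
  proof -
    have "f ` M = (\<lambda>i. Suc (2 * i)) ` I"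
    proof (intro equalityI subsetI)
      fix x assume "x \<in> f ` M"
      then have "x \<in> J" "odd x" using fJ by (auto simp: M_def)
      then show "x \<in> (\<lambda>i. Suc (2 * i)) ` I" by (auto simp: J_def)
    next
      fix x assume x: "x \<in> (\<lambda>i. Suc (2 * i)) ` I"
      then obtain t where "t < N" "f t = x" using Jf[of x] by (auto simp: J_def)
      then show "x \<in> f ` M" using x by (auto simp: M_def)
    qed
    moreover have "card (f ` M) = card M"
      using finj by (intro card_image inj_onI) (auto simp: M_def)
    moreover have "card ((\<lambda>i. Suc (2 * i)) ` I) = card I"
      by (intro card_image inj_onI) simp
    ultimately show ?thesis by simp
  qed
  moreover have "M = insert (N - 1) (M \<inter> {1..<N - 1})"
  proof -
    have "t \<in> {1..<N - 1} \<or> t = N - 1" if "t \<in> M" for t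
    proof -
      have "t \<noteq> 0" using that M0 by metis
      then show ?thesis using that by (auto simp: M_def)
    qed
    then show ?thesis using Mn by blast
  qed
  moreover have "card (insert (N - 1) (M \<inter> {1..<N - 1})) = Suc (card (M \<inter> {1..<N - 1}))"
    by (subst card_insert_disjoint) auto
  \<comment> \<open>The last subdivision point lies outside the range, hence the 1 subtracted; the
    \<open>Suc\<close> in \<open>tr_eq_cat_int\<close> restores it.\<close>
  ultimately have cM: "card (M \<inter> {1..<N - 1}) = card I - 1" by simp
  have "real (tr ((\<lambda>t. q (f t)) ` {..N - 1})) = cat_int (N - 1 - 1) (Suc (card I - 1))"
  proof (rule tr_eq_cat_int[OF _ _ _ cM])
    show "3 \<le> N - 1" using N by simp
    show "card I - 1 + 1 < N - 1" using c cI by (simp add: N_def)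
    have "N - 1 - 1 = N - 2" by simp
    then show "N - 1 - 1 \<notin> M" unfolding M_def mem_Collect_eq by (simp only: fn1) simp
    show "Suc t \<notin> M" if tM: "t \<in> M" for t
    proof
      assume s: "Suc t \<in> M"
      obtain b where b: "t = Suc b" using tM M0 by (cases t) auto
      have "odd (f (Suc b))" "Suc (Suc b) < N" using tM s b by (simp_all add: M_def)
      from odd[OF this] obtain i where "f (Suc t) = Suc (Suc (2 * i))" using b by blast
      then show False using s by (simp add: M_def)
    qed
  qed
  also have "(\<lambda>t. q (f t)) ` {..N - 1} = q ` J"
  proof -
    have "{..N - 1} = {..<N}" using N by auto
    then have "f ` {..N - 1} = J" using bij by (simp add: bij_betw_def)
    then show ?thesis by (simp only: image_image[symmetric])
  qed
  finally show ?thesis using cI by (simp add: J_def N_def numeral_2_eq_2)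
qed

text \<open>The numbering starts at the end \<open>x\<close> of a subdivided side \<open>e0\<close>
  for which \<open>e0\<close> becomes the closing side; \<open>s \<ge> 1\<close> provides such a
  side. The value shows that the count does not depend on which sides are subdivided.\<close>

lemma tr_subdivided_polygon:
  assumes "subdivided_polygon N s P" and s: "1 \<le> s"
  shows "real (tr P) = cat_int (N - 2) s"
proof -
  obtain V S m where V: "finite V" "3 \<le> card V" and N: "card V + s = N"
    and ext: "\<And>v. v \<in> V \<Longrightarrow> v extreme_point_of (convex hull V)"
    and S: "S \<subseteq> {e. e edge_of (convex hull V)}" "card S = s"
    and m: "\<And>e. e \<in> S \<Longrightarrow> m e \<in> rel_interior e" and P: "P = V \<union> m ` S"
    using assms(1) unfolding subdivided_polygon_def by blast
  define c where "c = card V"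
  have c: "3 \<le> c" using V by (simp add: c_def)
  obtain e0 where e0: "e0 \<in> S" using S(2) s by fastforce
  then have "e0 edge_of (convex hull V)" using S(1) by blast
  from edge_of_extreme_points[OF V(1) ext this] obtain x y where xy: "x \<in> V" "y \<in> V" "x \<noteq> y" "e0 = closed_segment x y"
    and side0: "\<And>t. t \<in> V \<Longrightarrow> t \<noteq> x \<Longrightarrow> t \<noteq> y \<Longrightarrow> 0 < orient x t y" by metis
  from convex_polygon_order[OF V ext xy(1), folded c_def] obtain w where
    bij: "bij_betw w {..<c} V" and w0: "w 0 = x" and wc: "w c = x"
    and w: "\<And>i j k. i < j \<Longrightarrow> j < k \<Longrightarrow> k \<le> c \<Longrightarrow> \<not> (i = 0 \<and> k = c) \<Longrightarrow> 0 < orient (w i) (w j) (w k)"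
    by metis
  have wc0: "w c = w 0" by (simp add: w0 wc)
  have winj: "inj_on w {..<c}" and wV: "w ` {..<c} = V" using bij by (simp_all add: bij_betw_def)
  have w_eq: "w i = w j \<longleftrightarrow> i = j" if "i < c" "j < c" for i j
    using winj that by (auto simp: inj_on_def)
  have w_ne: "w i \<noteq> w (Suc i)" if "i < c" for i
    using w_eq[of i "Suc i"] w_eq[of i 0] wc0 that c by (cases "Suc i = c") auto
  define seg where "seg i = closed_segment (w i) (w (Suc i))" for i
  have side: "i = Suc j \<or> i = 0 \<and> Suc j = c"
    if ij: "i < c" "j < c" "i \<noteq> j" "\<And>t. t \<in> V \<Longrightarrow> t \<noteq> w i \<Longrightarrow> t \<noteq> w j \<Longrightarrow> 0 < orient (w i) t (w j)" for i j
  proof -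
    have "0 < orient (w i) (w t) (w j)" if t: "t < c" "t \<noteq> i" "t \<noteq> j" for t
    proof (rule ij(4))
      show "w t \<in> V" using t(1) wV by blast
      show "w t \<noteq> w i" "w t \<noteq> w j" using w_eq t ij(1,2) by simp_all
    qed
    then show ?thesis using ij(1-3) by (intro polygon_side_index[OF w wc0 winj c])
  qed
  have seg_of: "\<exists>i<c. e = seg i" if e: "e \<in> S" for e
  proof -
    have "e edge_of (convex hull V)" using S(1) e by blast
    from edge_of_extreme_points[OF V(1) ext this] obtain x' y' where
      xy': "x' \<in> V" "y' \<in> V" "x' \<noteq> y'" "e = closed_segment x' y'"
      and side': "\<And>t. t \<in> V \<Longrightarrow> t \<noteq> x' \<Longrightarrow> t \<noteq> y' \<Longrightarrow> 0 < orient x' t y'" by metis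
    from xy'(1,2) obtain i j where ij: "i < c" "j < c" "x' = w i" "y' = w j" unfolding wV[symmetric] by blast
    have "i \<noteq> j" using xy'(3) ij by auto
    then have "i = Suc j \<or> i = 0 \<and> Suc j = c" using side[of i j] ij side' by blast
    then have "e = seg j"
      unfolding seg_def xy'(4) ij(3,4) using wc0 by (auto simp: closed_segment_commute)
    with ij show ?thesis by blast
  qed
  have e0_seg: "e0 = seg (c - 1)"
  proof -
    from xy(2) obtain j where j: "j < c" "y = w j" unfolding wV[symmetric] by blast
    have "0 \<noteq> j" using xy(3) j w0 by metis
    then have "Suc j = c" using side[of 0 j] j side0 w0 c by force
    then have "c - 1 = j" by simp
    then show ?thesis unfolding seg_def xy(4) using \<open>Suc j = c\<close> wc j by (simp add: closed_segment_commute)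
  qed
  have seg_inj: "inj_on seg {..<c}"
  proof (rule linorder_inj_onI)
    fix i j assume ij: "i < j" "j \<in> {..<c}"
    show "seg i \<noteq> seg j"
    proof
      assume "seg i = seg j"
      then have "{w i, w (Suc i)} = {w j, w (Suc j)}" unfolding seg_def closed_segment_eq .
      then have "w i = w (Suc j)" "w (Suc i) = w j" using w_eq[of i j] ij by (auto simp: doubleton_eq_iff)
      then have "Suc j = c \<and> i = 0" "Suc i = j"
        using w_eq[of i "Suc j"] w_eq[of i 0] w_eq[of "Suc i" j] wc0 ij c by (cases "Suc j = c"; force)+
      then show False using c by simp
    qed
  qed auto
  define I where "I = {i. i < c \<and> seg i \<in> S}"
  have I: "I \<subseteq> {..<c}" "c - 1 \<in> I" using e0 e0_seg c by (auto simp: I_def)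
  have segI: "seg ` I = S" using seg_of by (auto simp: I_def)
  have cI: "card I = s"
    using card_image[OF inj_on_subset[OF seg_inj I(1)]] segI S(2) by simp
  \<comment> \<open>A side without a subdivision point gets its midpoint as a placeholder, which
    \<open>I\<close> leaves out again.\<close>
  define q where "q a = (if even a then w (a div 2) else if seg (a div 2) \<in> S then m (seg (a div 2))
      else midpoint (w (a div 2)) (w (Suc (a div 2))))" for a
  have q_even: "q (2 * i) = w i" for i by (simp add: q_def)
  have q_odd: "q (Suc (2 * i)) \<in> open_segment (w i) (w (Suc i))" if "i < c" for i
    using m[of "seg i"] w_ne[OF that] by (auto simp: q_def seg_def rel_interior_closed_segment midpoint_in_open_segment)
  have q_mix: "\<exists>\<theta>. 0 < \<theta> \<and> \<theta> < 1 \<and> q a = (1 - \<theta>) *\<^sub>R w (a div 2) + \<theta> *\<^sub>R w (Suc a div 2)" if a: "a < 2 * c" for a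
  proof (cases "even a")
    case True
    then have "Suc a div 2 = a div 2" "q a = w (a div 2)" by (simp_all add: q_def)
    then show ?thesis by (intro exI[of _ "1/2"]) (simp flip: scaleR_add_left)
  next
    case False
    then obtain i where i: "a = Suc (2 * i)" using oddE by fastforce
    have "i < c" using a i by simp
    then show ?thesis using q_odd[of i] unfolding i in_segment by auto
  qed
  have "real (tr (q ` ((\<lambda>i. 2 * i) ` {..<c} \<union> (\<lambda>i. Suc (2 * i)) ` I))) = cat_int (c + card I - 2) (card I)"
  proof (rule tr_thinned[OF c _ _ _ _ I])
    show "0 \<le> orient (q a) (q b) (q d)" if "a < b" "b < d" "d < 2 * c" for a b d
      by (rule subdivided_polygon_orient(1)[OF w wc0 c q_mix that])
    show "0 < orient (q a) (q b) (q d)" if "a < b" "b < d" "d < 2 * c" "\<not> (even a \<and> b = Suc a \<and> d = Suc b)"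
        "\<not> (a = 0 \<and> b = 2 * c - 2 \<and> d = 2 * c - 1)" for a b d
      by (rule subdivided_polygon_orient(2)[OF w wc0 c q_mix that])
    show "q (Suc (2 * i)) \<in> open_segment (q (2 * i)) (q (Suc (Suc (2 * i))))" if "Suc i < c" for i
      using q_odd[of i] q_even[of i] q_even[of "Suc i"] that by simp
    have "2 * c - 1 = Suc (2 * (c - 1))" "2 * c - 2 = 2 * (c - 1)" using c by simp_all
    then show "q (2 * c - 1) \<in> open_segment (q 0) (q (2 * c - 2))"
      using q_odd[of "c - 1"] q_even[of 0] q_even[of "c - 1"] c wc0
      by (simp add: open_segment_commute)
  qed
  also have "q ` ((\<lambda>i. 2 * i) ` {..<c} \<union> (\<lambda>i. Suc (2 * i)) ` I) = P"
  proof -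
    have "q ` (\<lambda>i. 2 * i) ` {..<c} = V" unfolding image_image q_even by (rule wV)
    moreover have "q ` (\<lambda>i. Suc (2 * i)) ` I = m ` S"
      unfolding segI[symmetric] image_image by (intro image_cong) (auto simp: q_def I_def)
    ultimately show ?thesis unfolding P image_Un by simp
  qed
  finally show ?thesis using cI N by (simp add: c_def)
qed

text \<open>The \<open>N\<close>-th power magnifies errors in \<open>s / N\<close>: the leading term
  \<open>4 ^ (N - s) * 3 ^ s\<close> is \<open>(3/4) powr (s - \<alpha> * N)\<close> times
  \<open>(4 powr (1 - \<alpha>) * 3 powr \<alpha>) ^ N\<close>, and convergence of
  \<open>s / N\<close> alone does not control that factor. So the exponents carry
  \<open>s / N\<close> in general, and \<open>\<alpha>\<close> when \<open>s - \<alpha> * N\<close>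
  tends to 0.\<close>

theorem theorem7p2:
  fixes \<alpha> :: real and N s :: "nat \<Rightarrow> nat" and P :: "nat \<Rightarrow> (real^2) set"
  assumes "0 \<le> \<alpha>" and "\<alpha> \<le> 1/2"
    and "filterlim N at_top sequentially"
    and "filterlim s at_top sequentially"
    and "(\<lambda>k. real (s k) / real (N k)) \<longlonglongrightarrow> \<alpha>"
    and "\<And>k. subdivided_polygon (N k) (s k) (P k)"
  shows "((\<lambda>k. real (tr (P k))) \<sim>[sequentially]
           (\<lambda>k. (4 powr (1 - real (s k) / real (N k)) * 3 powr (real (s k) / real (N k))) ^ N k
                / (16 * sqrt pi * (1 + \<alpha> / 3) powr (3/2) * real (N k) powr (3/2)))) \<and>
         ((\<lambda>k. real (s k) - \<alpha> * real (N k)) \<longlonglongrightarrow> 0 \<longrightarrow>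
         ((\<lambda>k. real (tr (P k))) \<sim>[sequentially]
           (\<lambda>k. (4 powr (1 - \<alpha>) * 3 powr \<alpha>) ^ N k
                / (16 * sqrt pi * (1 + \<alpha> / 3) powr (3/2) * real (N k) powr (3/2)))))"
proof -
  define D where "D k = 16 * sqrt pi * (1 + \<alpha> / 3) powr (3/2) * real (N k) powr (3/2)" for k
  have power: "(4 powr (1 - \<beta>) * 3 powr \<beta>) ^ n = 4 powr (real n - \<beta> * n) * 3 powr (\<beta> * n)"
    for \<beta> :: real and n :: nat
    by (simp add: power_mult_distrib powr_power algebra_simps)
  have N0: "N k > 0" for k using assms(6)[of k] by (auto simp: subdivided_polygon_def)
  have base: "4 ^ (N k - s k) * 3 ^ s k = (4 powr (1 - real (s k) / real (N k)) * 3 powr (real (s k) / real (N k))) ^ N k" for k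
  proof -
    have "s k \<le> N k" using assms(6)[of k] by (auto simp: subdivided_polygon_def)
    then show ?thesis
      unfolding power using N0[of k] by (simp add: powr_realpow flip: of_nat_diff)
  qed
  \<comment> \<open>The growth of \<open>s\<close> provides the subdivided side at which the chain
    closes.\<close>
  have "\<forall>\<^sub>F k in sequentially. 1 \<le> s k" using assms(4) by (simp add: filterlim_at_top)
  then have "\<forall>\<^sub>F k in sequentially. real (tr (P k)) = cat_int (N k - 2) (s k)"
    by eventually_elim (rule tr_subdivided_polygon[OF assms(6)])
  then have "(\<lambda>k. real (tr (P k))) \<sim>[sequentially] (\<lambda>k. cat_int (N k - 2) (s k))"
    by (rule asymp_equiv_refl_ev)
  also have "\<dots> \<sim>[sequentially] (\<lambda>k. 4 ^ (N k - s k) * 3 ^ s k / D k)"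
    unfolding D_def by (rule cat_int_asymptotics[OF assms(1,2,3,5)])
  finally have 1: "(\<lambda>k. real (tr (P k))) \<sim>[sequentially]
     (\<lambda>k. (4 powr (1 - real (s k) / real (N k)) * 3 powr (real (s k) / real (N k))) ^ N k / D k)"
    unfolding base .
  have 2: "(\<lambda>k. real (tr (P k))) \<sim>[sequentially] (\<lambda>k. (4 powr (1 - \<alpha>) * 3 powr \<alpha>) ^ N k / D k)"
    if z: "(\<lambda>k. real (s k) - \<alpha> * real (N k)) \<longlonglongrightarrow> 0"
  proof -
    have "(\<lambda>k. (3/4) powr (real (s k) - \<alpha> * real (N k))) \<longlonglongrightarrow> (3/4 :: real) powr 0"
      by (intro tendsto_intros z) auto
    then have l: "(\<lambda>k. (3/4) powr (real (s k) - \<alpha> * real (N k))) \<longlonglongrightarrow> (1 :: real)" by simp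
    have "(4 powr (1 - real (s k) / real (N k)) * 3 powr (real (s k) / real (N k))) ^ N k
        = (3/4) powr (real (s k) - \<alpha> * real (N k)) * (4 powr (1 - \<alpha>) * 3 powr \<alpha>) ^ N k" for k
      unfolding power using N0[of k]
      by (simp add: powr_divide powr_diff powr_add field_simps)
    moreover have "(\<lambda>k. (3/4) powr (real (s k) - \<alpha> * real (N k))) \<sim>[sequentially] (\<lambda>_. 1 :: real)"
      using l by (simp add: tendsto_imp_asymp_equiv_const)
    ultimately have "(\<lambda>k. (4 powr (1 - real (s k) / real (N k)) * 3 powr (real (s k) / real (N k))) ^ N k / D k)
       \<sim>[sequentially] (\<lambda>k. 1 * (4 powr (1 - \<alpha>) * 3 powr \<alpha>) ^ N k / D k)"
      by (simp only:) (intro asymp_equiv_intros)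
    with 1 show ?thesis by (simp add: asymp_equiv_trans)
  qed
  show ?thesis using 1 2 unfolding D_def by blast
qed

end
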